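(* Let $k$ be any field, and let $G\subset S_m$ and $H\subset S_n$ be subgroups, acting on the rational function fields $k(x_1,\ldots,x_m)$ and $k(y_1,\ldots,y_n)$ respectively by the $k$-automorphisms $g\cdot x_i=x_{g(i)}$ and $h\cdot y_j=y_{h(j)}$ for all $g\in G$, $h\in H$, $1\le i\le m$, $1\le j\le n$. Then the wreath product $\widetilde{G}:=H\wr G=H\wr_{X_m}G$, where $X_m=\{1,\ldots,m\}$, can be regarded as a subgroup of $S_{mn}$ (via its faithful action on $\{1,\ldots,n\}\times\{1,\ldots,m\}$), and so acts by permutation of variables on the rational function field $k(z_1,\ldots,z_{mn})$. If $k(x_1,\ldots,x_m)^G$ and $k(y_1,\ldots,y_n)^H$ are $k$-rational, then $k(z_1,\ldots,z_{mn})^{\widetilde{G}}$ is also $k$-rational.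
   Context: A finitely generated field extension $L$ of a field $k$ is called $k$-rational if $L$ is purely transcendental over $k$. Wreath product: let $G$ act on $X_m=\{1,\ldots,m\}$ from the left and let $H$ be a group. Let $A=\prod_{1\le i\le m}H$ be the group of all functions $\alpha:X_m\to H$ with pointwise multiplication; $G$ acts on $A$ by $({}^{g}\alpha)(x)=\alpha(g^{-1}\cdot x)$. The wreath product $H\wr_{X_m}G$ is the semi-direct product $A\rtimes G$ with multiplication $(\alpha;g_1)\cdot(\beta;g_2)=(\alpha\cdot{}^{g_1}\beta;\,g_1g_2)$. For $G\subset S_m$ and $H\subset S_n$, the group $H\wr_{X_m}G$ acts faithfully on the set $\{1,\ldots,n\}\times\{1,\ldots,m\}$ by $(\alpha;g)\cdot(j,i)=(\alpha(g(i))(j),\,g(i))$. Identifying this set with $\{1,\ldots,mn\}$, the group becomes a subgroup of $S_{mn}$. A subgroup of $S_N$ acts on $k(z_1,\ldots,z_N)$ by the $k$-automorphisms $\sigma\cdot z_i=z_{\sigma(i)}$. *)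

theory Defs
  imports "HOL-Algebra.Algebra" "HOL-Algebra.Algebraic_Closure_Type" "HOL-Library.Poly_Mapping"
begin

section \<open>Polynomials and rational functions in several variables\<close>

text \<open>
  A polynomial over \<open>'k\<close> in variables indexed by \<open>'i\<close> is a finitely supported map from exponent
  vectors \<open>'i \<Rightarrow>\<^sub>0 nat\<close> to coefficients.
\<close>

type_synonym ('i, 'k) mpoly = "('i \<Rightarrow>\<^sub>0 nat) \<Rightarrow>\<^sub>0 'k"

text \<open>The value at \<open>x\<close> of the monomial with exponent vector \<open>t\<close>.\<close>

definition monom_eval :: "('i \<Rightarrow> 'b::comm_ring_1) \<Rightarrow> ('i \<Rightarrow>\<^sub>0 nat) \<Rightarrow> 'b" where
  "monom_eval x t = (\<Prod>i\<in>Poly_Mapping.keys t. x i ^ Poly_Mapping.lookup t i)"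

text \<open>Substitution of \<open>x i\<close> for the \<open>i\<close>-th variable, with coefficients mapped along \<open>c\<close>.\<close>

definition mpoly_eval ::
  "('k::zero \<Rightarrow> 'b::comm_ring_1) \<Rightarrow> ('i \<Rightarrow> 'b) \<Rightarrow> ('i, 'k) mpoly \<Rightarrow> 'b" where
  "mpoly_eval c x p =
     (\<Sum>t\<in>Poly_Mapping.keys p. c (Poly_Mapping.lookup p t) * monom_eval x t)"

definition mpoly_const :: "'k::zero \<Rightarrow> ('i, 'k) mpoly" where
  "mpoly_const a = Poly_Mapping.single 0 a"

definition mpoly_var :: "'i \<Rightarrow> ('i, 'k::zero_neq_one) mpoly" where
  "mpoly_var i = Poly_Mapping.single (Poly_Mapping.single i 1) 1"

text \<open>
  Rational functions in countably many variables, indexed by \<^typ>\<open>nat\<close>. The field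
  $k(x_1, \dots, x_N)$ is its subfield \<open>rat_fun_field N\<close> below.
\<close>

type_synonym 'k rat_fun = "(nat, 'k) mpoly fract"

definition rat_const :: "'k::field \<Rightarrow> 'k rat_fun" where
  "rat_const a = Fraction_Field.Fract (mpoly_const a) 1"

definition rat_var :: "nat \<Rightarrow> 'k::field rat_fun" where
  "rat_var i = Fraction_Field.Fract (mpoly_var i) 1"


section \<open>Field extensions and rationality\<close>

text \<open>
  In this section an extension of \<open>'k\<close> is a subset of a field \<open>'a\<close> that contains the image of a
  field homomorphism \<open>c :: 'k \<Rightarrow> 'a\<close>.
\<close>

definition field_adjoin :: "('k::field \<Rightarrow> 'a::field) \<Rightarrow> 'a set \<Rightarrow> 'a set" where
  "field_adjoin c S = generate_field ring_of_type_algebra (range c \<union> S)"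

text \<open>The polynomials below have the elements of \<open>'a\<close> themselves as names of the variables.\<close>

definition algebraically_independent :: "('k::field \<Rightarrow> 'a::field) \<Rightarrow> 'a set \<Rightarrow> bool" where
  "algebraically_independent c B \<longleftrightarrow>
     (\<forall>p :: ('a, 'k) mpoly. (\<forall>t\<in>Poly_Mapping.keys p. Poly_Mapping.keys t \<subseteq> B) \<longrightarrow>
        mpoly_eval c (\<lambda>b. b) p = 0 \<longrightarrow> p = 0)"

definition purely_transcendental :: "('k::field \<Rightarrow> 'a::field) \<Rightarrow> 'a set \<Rightarrow> bool" where
  "purely_transcendental c L \<longleftrightarrow> (\<exists>B. algebraically_independent c B \<and> L = field_adjoin c B)"

definition finitely_generated_ext :: "('k::field \<Rightarrow> 'a::field) \<Rightarrow> 'a set \<Rightarrow> bool" where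
  "finitely_generated_ext c L \<longleftrightarrow> (\<exists>S. finite S \<and> L = field_adjoin c S)"

definition rational_ext :: "('k::field \<Rightarrow> 'a::field) \<Rightarrow> 'a set \<Rightarrow> bool" where
  "rational_ext c L \<longleftrightarrow> finitely_generated_ext c L \<and> purely_transcendental c L"


section \<open>Permutation of variables\<close>

definition rat_fun_field :: "nat \<Rightarrow> 'k::field rat_fun set" where
  "rat_fun_field N = field_adjoin rat_const (rat_var ` {1..N})"

definition perm_mpoly :: "(nat \<Rightarrow> nat) \<Rightarrow> (nat, 'k::field) mpoly \<Rightarrow> (nat, 'k) mpoly" where
  "perm_mpoly \<sigma> p = mpoly_eval mpoly_const (\<lambda>i. mpoly_var (\<sigma> i)) p"

text \<open>
  Only used for bijective \<open>\<sigma>\<close>, where it is the automorphism over the constants that sends the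
  \<open>i\<close>-th variable to the \<open>\<sigma> i\<close>-th one; see \<open>perm_rat_fun_hom\<close> and \<open>bij_perm_rat_fun\<close>.
\<close>

definition perm_rat_fun :: "(nat \<Rightarrow> nat) \<Rightarrow> 'k::field rat_fun \<Rightarrow> 'k rat_fun" where
  "perm_rat_fun \<sigma> f =
     (THE r. \<exists>p q. q \<noteq> 0 \<and> f = Fraction_Field.Fract p q \<and>
        r = Fraction_Field.Fract (perm_mpoly \<sigma> p) (perm_mpoly \<sigma> q))"

definition fixed_field :: "nat \<Rightarrow> (nat \<Rightarrow> nat) set \<Rightarrow> 'k::field rat_fun set" where
  "fixed_field N P = {f \<in> rat_fun_field N. \<forall>\<sigma>\<in>P. perm_rat_fun \<sigma> f = f}"


subsection \<open>The action is by field automorphisms over the constants\<close>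

lemma monom_eval_superset:
  assumes "finite A" "Poly_Mapping.keys t \<subseteq> A"
  shows "monom_eval x t = (\<Prod>i\<in>A. x i ^ Poly_Mapping.lookup t i)"
  unfolding monom_eval_def using assms
  by (intro prod.mono_neutral_left) (auto simp: in_keys_iff)

lemma monom_eval_add: "monom_eval x (s + t) = monom_eval x s * monom_eval x t"
proof -
  let ?A = "Poly_Mapping.keys s \<union> Poly_Mapping.keys t"
  have "monom_eval x (s + t) = (\<Prod>i\<in>?A. x i ^ Poly_Mapping.lookup (s + t) i)"
    by (rule monom_eval_superset) (use Poly_Mapping.keys_add[of s t] in auto)
  also have "\<dots> = (\<Prod>i\<in>?A. x i ^ Poly_Mapping.lookup s i) * (\<Prod>i\<in>?A. x i ^ Poly_Mapping.lookup t i)"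
    by (simp add: lookup_add power_add prod.distrib)
  also have "\<dots> = monom_eval x s * monom_eval x t"
    by (subst (1 2) monom_eval_superset[where A = ?A]) auto
  finally show ?thesis .
qed

lemma monom_eval_0 [simp]: "monom_eval x 0 = 1"
  by (simp add: monom_eval_def)

lemma monom_eval_single [simp]: "monom_eval x (Poly_Mapping.single i n) = x i ^ n"
  by (simp add: monom_eval_def)

lemma mpoly_sum_monomials:
  "(p :: ('i, 'k::comm_monoid_add) mpoly) =
     (\<Sum>t\<in>Poly_Mapping.keys p. Poly_Mapping.single t (Poly_Mapping.lookup p t))"
  by (rule poly_mapping_eqI) (auto simp: lookup_sum lookup_single when_def in_keys_iff)

locale coeff_hom =
  fixes c :: "'k::comm_ring_1 \<Rightarrow> 'b::comm_ring_1"
  assumes c_0: "c 0 = 0" and c_1: "c 1 = 1"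
    and c_add: "c (a + b) = c a + c b" and c_mult: "c (a * b) = c a * c b"
begin

lemma eval_0 [simp]: "mpoly_eval c x 0 = 0"
  by (simp add: mpoly_eval_def)

lemma eval_single: "mpoly_eval c x (Poly_Mapping.single t a) = c a * monom_eval x t"
  by (simp add: mpoly_eval_def c_0)

lemma eval_add: "mpoly_eval c x (p + q) = mpoly_eval c x p + mpoly_eval c x q"
  unfolding mpoly_eval_def
  by (rule setsum_keys_plus_distrib) (simp_all add: c_0 c_add algebra_simps)

lemma eval_sum: "mpoly_eval c x (sum f A) = (\<Sum>a\<in>A. mpoly_eval c x (f a))"
  by (induction A rule: infinite_finite_induct) (simp_all add: eval_add)

lemma eval_mult: "mpoly_eval c x (p * q) = mpoly_eval c x p * mpoly_eval c x q"
proof -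
  let ?m = "\<lambda>r t. Poly_Mapping.single t (Poly_Mapping.lookup r t)"
  have "p * q = (\<Sum>s\<in>Poly_Mapping.keys p. \<Sum>t\<in>Poly_Mapping.keys q. ?m p s * ?m q t)"
    by (subst mpoly_sum_monomials[of p], subst mpoly_sum_monomials[of q], rule sum_product)
  also have "mpoly_eval c x \<dots> =
      (\<Sum>s\<in>Poly_Mapping.keys p. \<Sum>t\<in>Poly_Mapping.keys q.
        mpoly_eval c x (?m p s) * mpoly_eval c x (?m q t))"
    by (simp add: eval_sum mult_single eval_single c_mult monom_eval_add algebra_simps)
  also have "\<dots> = mpoly_eval c x p * mpoly_eval c x q"
    by (subst (3) mpoly_sum_monomials[of p], subst (3) mpoly_sum_monomials[of q])
       (simp add: eval_sum sum_product)
  finally show ?thesis .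
qed

lemma eval_1 [simp]: "mpoly_eval c x 1 = 1"
  using eval_single[of x 0 1] by (simp add: c_1)

end

lemma coeff_hom_const: "coeff_hom (mpoly_const :: 'k::comm_ring_1 \<Rightarrow> ('i, 'k) mpoly)"
  by unfold_locales (simp_all add: mpoly_const_def single_add mult_single)

interpretation const: coeff_hom "mpoly_const :: 'k::field \<Rightarrow> (nat, 'k) mpoly"
  by (rule coeff_hom_const)

lemma perm_mpoly_hom:
  "perm_mpoly \<sigma> (mpoly_const a) = mpoly_const a"
  "perm_mpoly \<sigma> (mpoly_var i) = mpoly_var (\<sigma> i)"
  "perm_mpoly \<sigma> 0 = 0" "perm_mpoly \<sigma> 1 = 1"
  "perm_mpoly \<sigma> (p + q) = perm_mpoly \<sigma> p + perm_mpoly \<sigma> q"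
  "perm_mpoly \<sigma> (p * q) = perm_mpoly \<sigma> p * perm_mpoly \<sigma> q"
  unfolding perm_mpoly_def
  by (simp_all add: const.eval_add const.eval_mult)
     (simp_all add: mpoly_const_def mpoly_var_def mpoly_eval_def)

lemma perm_mpoly_power: "perm_mpoly \<sigma> (p ^ n) = perm_mpoly \<sigma> p ^ n"
  by (induction n) (simp_all add: perm_mpoly_hom)

lemma perm_mpoly_prod: "perm_mpoly \<sigma> (prod f A) = (\<Prod>a\<in>A. perm_mpoly \<sigma> (f a))"
  by (induction A rule: infinite_finite_induct) (simp_all add: perm_mpoly_hom)

lemma perm_mpoly_sum: "perm_mpoly \<sigma> (sum f A) = (\<Sum>a\<in>A. perm_mpoly \<sigma> (f a))"
  by (induction A rule: infinite_finite_induct) (simp_all add: perm_mpoly_hom)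

lemma perm_mpoly_comp: "perm_mpoly \<sigma> (perm_mpoly \<tau> p) = perm_mpoly (\<sigma> \<circ> \<tau>) p"
  by (simp add: perm_mpoly_def[of \<tau>] perm_mpoly_def[of "\<sigma> \<circ> \<tau>"] mpoly_eval_def monom_eval_def
      perm_mpoly_sum perm_mpoly_prod perm_mpoly_power perm_mpoly_hom)

lemma monom_eval_var:
  "monom_eval mpoly_var t = (Poly_Mapping.single t 1 :: ('i, 'k::comm_ring_1) mpoly)"
proof -
  have pow: "(mpoly_var i :: ('i, 'k) mpoly) ^ n =
      Poly_Mapping.single (Poly_Mapping.single i n) 1" for i n
    by (induction n) (simp_all add: mpoly_var_def mult_single flip: single_add)
  have prd: "(\<Prod>i\<in>A. Poly_Mapping.single (f i) (1::'k)) = Poly_Mapping.single (sum f A) 1"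
    for f :: "'i \<Rightarrow> 'i \<Rightarrow>\<^sub>0 nat" and A
    by (induction A rule: infinite_finite_induct) (simp_all add: mult_single)
  have "t = (\<Sum>i\<in>Poly_Mapping.keys t. Poly_Mapping.single i (Poly_Mapping.lookup t i))"
    by (rule poly_mapping_eqI) (auto simp: lookup_sum lookup_single when_def in_keys_iff)
  then show ?thesis
    by (simp add: monom_eval_def pow prd)
qed

lemma perm_mpoly_id: "perm_mpoly id p = p"
  by (subst (2) mpoly_sum_monomials)
     (simp add: perm_mpoly_def mpoly_eval_def monom_eval_var mpoly_const_def mult_single)

lemma perm_mpoly_inverse:
  assumes "bij \<sigma>"
  shows "perm_mpoly (inv' \<sigma>) (perm_mpoly \<sigma> p) = p" "perm_mpoly \<sigma> (perm_mpoly (inv' \<sigma>) p) = p"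
  using assms by (simp_all add: perm_mpoly_comp perm_mpoly_id bij_is_inj bij_is_surj surj_iff[THEN iffD1])

lemma perm_mpoly_eq_0_iff: "bij \<sigma> \<Longrightarrow> perm_mpoly \<sigma> p = 0 \<longleftrightarrow> p = 0"
  by (metis perm_mpoly_inverse(1) perm_mpoly_hom(3))

lemma perm_rat_fun_Fract:
  assumes \<sigma>: "bij \<sigma>" and q: "q \<noteq> 0"
  shows "perm_rat_fun \<sigma> (Fraction_Field.Fract p q) =
    Fraction_Field.Fract (perm_mpoly \<sigma> p) (perm_mpoly \<sigma> q)"
  unfolding perm_rat_fun_def
proof (rule the_equality)
  show "\<exists>p' q'. q' \<noteq> 0 \<and> Fraction_Field.Fract p q = Fraction_Field.Fract p' q' \<and>
      Fraction_Field.Fract (perm_mpoly \<sigma> p) (perm_mpoly \<sigma> q) =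
      Fraction_Field.Fract (perm_mpoly \<sigma> p') (perm_mpoly \<sigma> q')"
    using q by blast
next
  fix r
  assume "\<exists>p' q'. q' \<noteq> 0 \<and> Fraction_Field.Fract p q = Fraction_Field.Fract p' q' \<and>
      r = Fraction_Field.Fract (perm_mpoly \<sigma> p') (perm_mpoly \<sigma> q')"
  then obtain p' q' where q': "q' \<noteq> 0"
    and eq: "Fraction_Field.Fract p q = Fraction_Field.Fract p' q'"
    and r: "r = Fraction_Field.Fract (perm_mpoly \<sigma> p') (perm_mpoly \<sigma> q')" by blast
  from eq q q' have "perm_mpoly \<sigma> (p * q') = perm_mpoly \<sigma> (p' * q)"
    by (simp add: eq_fract)
  then show "r = Fraction_Field.Fract (perm_mpoly \<sigma> p) (perm_mpoly \<sigma> q)"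
    unfolding r using q q' \<sigma> by (simp add: eq_fract perm_mpoly_eq_0_iff perm_mpoly_hom)
qed

lemma perm_rat_fun_hom:
  assumes "bij \<sigma>"
  shows "perm_rat_fun \<sigma> (rat_const a) = rat_const a"
    and "perm_rat_fun \<sigma> (rat_var i) = rat_var (\<sigma> i)"
    and "perm_rat_fun \<sigma> (f + g) = perm_rat_fun \<sigma> f + perm_rat_fun \<sigma> g"
    and "perm_rat_fun \<sigma> (f * g) = perm_rat_fun \<sigma> f * perm_rat_fun \<sigma> g"
proof -
  show "perm_rat_fun \<sigma> (rat_const a) = rat_const a"
    and "perm_rat_fun \<sigma> (rat_var i) = rat_var (\<sigma> i)"
    using assms by (simp_all add: rat_const_def rat_var_def perm_rat_fun_Fract perm_mpoly_hom)
  show "perm_rat_fun \<sigma> (f + g) = perm_rat_fun \<sigma> f + perm_rat_fun \<sigma> g"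
    by (cases f; cases g) (use assms in
      \<open>simp add: perm_rat_fun_Fract perm_mpoly_hom perm_mpoly_eq_0_iff\<close>)
  show "perm_rat_fun \<sigma> (f * g) = perm_rat_fun \<sigma> f * perm_rat_fun \<sigma> g"
    by (cases f; cases g) (use assms in
      \<open>simp add: perm_rat_fun_Fract perm_mpoly_hom perm_mpoly_eq_0_iff\<close>)
qed

lemma bij_perm_rat_fun:
  assumes "bij \<sigma>"
  shows "bij (perm_rat_fun \<sigma> :: 'k::field rat_fun \<Rightarrow> 'k rat_fun)"
proof (rule o_bij[of "perm_rat_fun (inv' \<sigma>)"])
  have *: "bij (inv' \<sigma>)" by (rule bij_imp_bij_inv[OF assms])
  show "perm_rat_fun (inv' \<sigma>) \<circ> perm_rat_fun \<sigma> = (id :: 'k rat_fun \<Rightarrow> _)"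
  proof
    fix f :: "'k rat_fun"
    show "(perm_rat_fun (inv' \<sigma>) \<circ> perm_rat_fun \<sigma>) f = id f"
      by (cases f) (simp add: perm_rat_fun_Fract perm_mpoly_inverse perm_mpoly_eq_0_iff assms *)
  qed
  show "perm_rat_fun \<sigma> \<circ> perm_rat_fun (inv' \<sigma>) = (id :: 'k rat_fun \<Rightarrow> _)"
  proof
    fix f :: "'k rat_fun"
    show "(perm_rat_fun \<sigma> \<circ> perm_rat_fun (inv' \<sigma>)) f = id f"
      by (cases f) (simp add: perm_rat_fun_Fract perm_mpoly_inverse perm_mpoly_eq_0_iff assms *)
  qed
qed


section \<open>Wreath products\<close>

definition semidirect_product ::
  "('a, 'c) monoid_scheme \<Rightarrow> ('g, 'd) monoid_scheme \<Rightarrow> ('g \<Rightarrow> 'a \<Rightarrow> 'a) \<Rightarrow> ('a \<times> 'g) monoid" where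
  "semidirect_product A G \<phi> =
     \<lparr>carrier = carrier A \<times> carrier G,
      monoid.mult = (\<lambda>(\<alpha>, g) (\<beta>, h). (\<alpha> \<otimes>\<^bsub>A\<^esub> \<phi> g \<beta>, g \<otimes>\<^bsub>G\<^esub> h)),
      one = (\<one>\<^bsub>A\<^esub>, \<one>\<^bsub>G\<^esub>)\<rparr>"

text \<open>
  Here \<open>act\<close> is a left action of \<open>G\<close> on \<open>\<Omega>\<close>. Functions from \<open>\<Omega>\<close> to \<open>H\<close> are represented by
  extensional functions.
\<close>

definition wreath_product ::
  "('h, 'c) monoid_scheme \<Rightarrow> ('g, 'd) monoid_scheme \<Rightarrow> 'x set \<Rightarrow> ('g \<Rightarrow> 'x \<Rightarrow> 'x)
    \<Rightarrow> (('x \<Rightarrow> 'h) \<times> 'g) monoid" where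
  "wreath_product H G \<Omega> act =
     semidirect_product (product_group \<Omega> (\<lambda>_. H)) G
       (\<lambda>g \<alpha>. \<lambda>x\<in>\<Omega>. \<alpha> (act (inv\<^bsub>G\<^esub> g) x))"

text \<open>The wreath product of permutation groups \<open>H\<close> of \<open>{1..n}\<close> and \<open>G\<close> of \<open>{1..m}\<close>.\<close>

definition perm_wreath ::
  "nat \<Rightarrow> nat \<Rightarrow> (nat \<Rightarrow> nat) set \<Rightarrow> (nat \<Rightarrow> nat) set
    \<Rightarrow> ((nat \<Rightarrow> nat \<Rightarrow> nat) \<times> (nat \<Rightarrow> nat)) monoid" where
  "perm_wreath n m H G =
     wreath_product (sym_group n\<lparr>carrier := H\<rparr>) (sym_group m\<lparr>carrier := G\<rparr>) {1..m} (\<lambda>g x. g x)"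

definition wreath_action ::
  "nat \<Rightarrow> nat \<Rightarrow> (nat \<Rightarrow> nat \<Rightarrow> nat) \<times> (nat \<Rightarrow> nat) \<Rightarrow> nat \<times> nat \<Rightarrow> nat \<times> nat" where
  "wreath_action n m = (\<lambda>(\<alpha>, g). \<lambda>(j, i)\<in>{1..n} \<times> {1..m}. (\<alpha> (g i) j, g i))"

text \<open>
  The permutation of \<open>{1..m * n}\<close> induced by a wreath product element, where
  \<open>{1..n} \<times> {1..m}\<close> is identified with \<open>{1..m * n}\<close> along a bijection \<open>e\<close>.
\<close>

definition wreath_perm ::
  "(nat \<times> nat \<Rightarrow> nat) \<Rightarrow> nat \<Rightarrow> nat \<Rightarrow> (nat \<Rightarrow> nat \<Rightarrow> nat) \<times> (nat \<Rightarrow> nat) \<Rightarrow> nat \<Rightarrow> nat" where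
  "wreath_perm e n m w = (\<lambda>k. if k \<in> {1..m * n}
     then e (wreath_action n m w (inv_into ({1..n} \<times> {1..m}) e k)) else k)"

end

theory Submission
  imports Defs
begin

text \<open>
  Write the variables of the big rational function field as \<open>z j i\<close>, where \<open>i\<close> numbers the \<open>m\<close> blocks
  and \<open>j\<close> the \<open>n\<close> positions in a block. The base group \<open>H\<^sup>m\<close> permutes the variables inside each
  block, and \<open>G\<close> permutes the blocks. The fixed field is computed in these two steps.

  Let \<open>B\<close> be a transcendence basis that generates \<open>k(y)\<^sup>H\<close>, and let \<open>\<phi> i\<close> be the embedding of
  \<open>k(y)\<close> as the functions of block \<open>i\<close>. The elements fixed by \<open>H\<^sup>m\<close> are the rational functions of
  the \<open>\<phi> i b\<close> with \<open>b \<in> B\<close>. This is proved one block at a time (\<open>fixed_in_blocks\<close>): over the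
  functions of one block, the generators of all other blocks are algebraically independent and they
  are fixed by the copy of \<open>H\<close> that acts on that block. The group \<open>G\<close> now permutes the index
  \<open>i\<close> of the \<open>\<phi> i b\<close> simultaneously for all \<open>b\<close>.

  For the second step choose \<open>b0 \<in> B\<close>, which exists because \<open>k(y)\<^sup>H\<close> contains the sum of the \<open>y j\<close>.
  The elements \<open>\<theta> i = \<phi> i b0\<close> are permuted by \<open>G\<close> like the variables \<open>x i\<close>, so with
  \<open>L = k(\<theta> 1, \<dots>, \<theta> m)\<close> the field \<open>L\<^sup>G\<close> is rational. For the other \<open>b\<close> the \<open>m\<close> elements \<open>\<phi> i b\<close>
  are replaced by the \<open>m\<close> twisted power sums \<open>W (t, b) = (\<Sum>i. \<theta> i ^ t * \<phi> i b)\<close> with \<open>t < m\<close>. These are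
  invariant, and the change of variables is invertible over \<open>L\<close>, because its matrix is a Vandermonde
  matrix in the distinct elements \<open>\<theta> i\<close>; Lagrange interpolation gives the inverse. Hence the fixed
  field is \<open>L\<^sup>G\<close> with the independent elements \<open>W (t, b)\<close> adjoined (\<open>rational_fixed_field\<close>).

  Both steps rest on one descent lemma, \<open>fixed_field_of_adjoined_invariants\<close>: adjoining
  algebraically independent invariants commutes with taking fixed elements. The independence of each
  new system of generators comes from the tower lemmas \<open>indep_Un\<close> and \<open>indep_over_gen_field\<close> and from \<open>indep_linear_change\<close>.
\<close>

section \<open>Subfields and field homomorphisms\<close>

text \<open>Closure under \<^const>\<open>inverse\<close> carries no side condition, because \<open>inverse 0 = 0\<close>.\<close>

definition is_subfield :: "'a::field set \<Rightarrow> bool" where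
  "is_subfield S \<longleftrightarrow> 1 \<in> S \<and> (\<forall>a\<in>S. \<forall>b\<in>S. a + b \<in> S \<and> a * b \<in> S) \<and>
     (\<forall>a\<in>S. - a \<in> S \<and> inverse a \<in> S)"

abbreviation gen_field :: "'a::field set \<Rightarrow> 'a set" where
  "gen_field S \<equiv> generate_field ring_of_type_algebra S"

lemma is_subfieldD:
  assumes "is_subfield S"
  shows "1 \<in> S" "0 \<in> S"
    and "a \<in> S \<Longrightarrow> b \<in> S \<Longrightarrow> a + b \<in> S"
    and "a \<in> S \<Longrightarrow> b \<in> S \<Longrightarrow> a * b \<in> S"
    and "a \<in> S \<Longrightarrow> - a \<in> S"
    and "a \<in> S \<Longrightarrow> b \<in> S \<Longrightarrow> a - b \<in> S"
    and "a \<in> S \<Longrightarrow> inverse a \<in> S"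
    and "a \<in> S \<Longrightarrow> b \<in> S \<Longrightarrow> a / b \<in> S"
proof -
  have add: "a + b \<in> S" if "a \<in> S" "b \<in> S" for a b
    using assms that unfolding is_subfield_def by blast
  have mult: "a * b \<in> S" if "a \<in> S" "b \<in> S" for a b
    using assms that unfolding is_subfield_def by blast
  have minus: "- a \<in> S" if "a \<in> S" for a
    using assms that unfolding is_subfield_def by blast
  have inverse: "inverse a \<in> S" if "a \<in> S" for a
    using assms that unfolding is_subfield_def by blast
  show 1: "1 \<in> S"
    using assms unfolding is_subfield_def by blast
  show "0 \<in> S"
    using add[OF 1 minus[OF 1]] by simp
  show "a + b \<in> S" "a * b \<in> S" "a - b \<in> S" "a / b \<in> S" if "a \<in> S" "b \<in> S"
    using that add[of a b] add[of a "- b"] mult[of a b] mult[of a "inverse b"] minus inverse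
    by (simp_all add: divide_inverse)
  show "- a \<in> S" "inverse a \<in> S" if "a \<in> S"
    using that minus inverse by simp_all
qed

lemma is_subfield_sum:
  assumes "is_subfield S" "\<And>i. i \<in> I \<Longrightarrow> f i \<in> S"
  shows "sum f I \<in> S"
  using assms(2) by (induction I rule: infinite_finite_induct) (auto intro: is_subfieldD[OF assms(1)])

lemma is_subfield_prod:
  assumes "is_subfield S" "\<And>i. i \<in> I \<Longrightarrow> f i \<in> S"
  shows "prod f I \<in> S"
  using assms(2) by (induction I rule: infinite_finite_induct) (auto intro: is_subfieldD[OF assms(1)])

lemma is_subfield_power: "is_subfield S \<Longrightarrow> a \<in> S \<Longrightarrow> a ^ n \<in> S"
  by (induction n) (auto intro: is_subfieldD)

lemma inv_ring_of_type_algebra: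
  assumes "(a :: 'a::field) \<noteq> 0"
  shows "inv\<^bsub>ring_of_type_algebra\<^esub> a = inverse a"
proof -
  interpret R: Ring.field "ring_of_type_algebra :: 'a ring"
    by (rule field_from_type_algebra)
  show ?thesis
    by (rule R.comm_inv_char) (use assms in \<open>auto simp: ring_of_type_algebra_def\<close>)
qed

lemma a_inv_ring_of_type_algebra: "\<ominus>\<^bsub>ring_of_type_algebra\<^esub> (a :: 'a::field) = - a"
proof -
  interpret R: Ring.field "ring_of_type_algebra :: 'a ring"
    by (rule field_from_type_algebra)
  show ?thesis
    by (rule sym, rule R.sum_zero_eq_neg) (auto simp: ring_of_type_algebra_def)
qed

lemma is_subfield_gen_field: "is_subfield (gen_field S)"
proof -
  let ?R = "ring_of_type_algebra :: 'a ring"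
  have R: "\<one>\<^bsub>?R\<^esub> = 1" "\<zero>\<^bsub>?R\<^esub> = 0" "x \<oplus>\<^bsub>?R\<^esub> y = x + y" "x \<otimes>\<^bsub>?R\<^esub> y = x * y" for x y
    by (auto simp: ring_of_type_algebra_def)
  have 1: "1 \<in> gen_field S"
    using generate_field.one[of ?R S] by (simp add: R)
  have add: "a + b \<in> gen_field S" if "a \<in> gen_field S" "b \<in> gen_field S" for a b
    using generate_field.eng_add[OF that] by (simp add: R)
  have mult: "a * b \<in> gen_field S" if "a \<in> gen_field S" "b \<in> gen_field S" for a b
    using generate_field.eng_mult[OF that] by (simp add: R)
  have minus: "- a \<in> gen_field S" if "a \<in> gen_field S" for a
    using generate_field.a_inv[OF that] by (simp add: a_inv_ring_of_type_algebra)
  have 0: "0 \<in> gen_field S"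
    using add[OF 1 minus[OF 1]] by simp
  have "inverse a \<in> gen_field S" if "a \<in> gen_field S" for a
  proof (cases "a = 0")
    case False
    have "inv\<^bsub>?R\<^esub> a \<in> gen_field S"
      by (rule generate_field.m_inv[OF that]) (simp add: R False)
    then show ?thesis
      unfolding inv_ring_of_type_algebra[OF False] .
  next
    case True
    show ?thesis
      unfolding True inverse_zero by (rule 0)
  qed
  then show ?thesis
    unfolding is_subfield_def using 1 add mult minus by (intro conjI ballI)
qed

lemma gen_field_incl: "S \<subseteq> gen_field S"
  by (auto intro: generate_field.incl)

lemma gen_field_least:
  assumes "is_subfield T" "S \<subseteq> T"
  shows "gen_field S \<subseteq> T"
proof
  fix a assume "a \<in> gen_field S"
  then show "a \<in> T"
  proof induction
    case (m_inv h)
    then have "h \<noteq> 0" by (simp add: ring_of_type_algebra_def)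
    from m_inv.IH show ?case
      unfolding inv_ring_of_type_algebra[OF \<open>h \<noteq> 0\<close>] by (rule is_subfieldD(7)[OF assms(1)])
  next
    case (a_inv h)
    from a_inv.IH show ?case
      unfolding a_inv_ring_of_type_algebra by (rule is_subfieldD(5)[OF assms(1)])
  next
    case (incl h)
    then show ?case using assms(2) by (rule subsetD[rotated])
  qed (use is_subfieldD(1,3,4)[OF assms(1)] in \<open>simp_all add: ring_of_type_algebra_def\<close>)
qed

lemma gen_field_mono: "S \<subseteq> T \<Longrightarrow> gen_field S \<subseteq> gen_field T"
  by (meson gen_field_incl gen_field_least is_subfield_gen_field subset_trans)

lemma gen_field_subset: "S \<subseteq> gen_field T \<Longrightarrow> gen_field S \<subseteq> gen_field T"
  by (intro gen_field_least is_subfield_gen_field)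

lemma gen_field_idem: "is_subfield S \<Longrightarrow> gen_field S = S"
  using gen_field_incl gen_field_least by blast

lemma gen_field_Un_gen_field: "gen_field (gen_field S \<union> T) = gen_field (S \<union> T)"
proof
  have "gen_field S \<subseteq> gen_field (S \<union> T)" "T \<subseteq> gen_field (S \<union> T)"
    using gen_field_mono[of S "S \<union> T"] gen_field_incl[of "S \<union> T"] by auto
  then show "gen_field (gen_field S \<union> T) \<subseteq> gen_field (S \<union> T)"
    by (intro gen_field_subset) auto
  show "gen_field (S \<union> T) \<subseteq> gen_field (gen_field S \<union> T)"
    using gen_field_incl[of S] by (intro gen_field_mono) auto
qed

lemma (in coeff_hom) c_sum: "c (sum f A) = (\<Sum>a\<in>A. c (f a))"
  by (induction A rule: infinite_finite_induct) (simp_all add: c_0 c_add)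

lemma (in coeff_hom) c_prod: "c (prod f A) = (\<Prod>a\<in>A. c (f a))"
  by (induction A rule: infinite_finite_induct) (simp_all add: c_1 c_mult)

lemma (in coeff_hom) c_power: "c (a ^ n) = c a ^ n"
  by (induction n) (simp_all add: c_1 c_mult)

lemma (in coeff_hom) c_minus: "c (- a) = - c a"
  using c_add[of a "- a"] by (simp add: c_0 add_eq_0_iff)

lemma (in coeff_hom) c_diff: "c (a - b) = c a - c b"
  using c_add[of a "- b"] by (simp add: c_minus)

lemma (in coeff_hom) c_monom_eval: "c (monom_eval x t) = monom_eval (\<lambda>i. c (x i)) t"
  by (simp add: monom_eval_def c_prod c_power)

locale field_hom = coeff_hom c for c :: "'k::field \<Rightarrow> 'a::field"
begin

lemma c_eq_0_iff: "c a = 0 \<longleftrightarrow> a = 0"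
proof
  assume "c a = 0"
  show "a = 0"
  proof (rule ccontr)
    assume "a \<noteq> 0"
    then have "c (a * inverse a) = 1" by (simp add: c_1)
    then show False using \<open>c a = 0\<close> by (simp add: c_mult)
  qed
qed (simp add: c_0)

lemma inj: "inj c"
  by (rule injI) (metis c_diff c_eq_0_iff right_minus_eq)

lemma c_inverse: "c (inverse a) = inverse (c a)"
proof (cases "a = 0")
  case False
  then have "c a * c (inverse a) = 1" by (metis c_1 c_mult right_inverse)
  then show ?thesis by (metis inverse_unique)
qed (simp add: c_0)

lemma is_subfield_vimage: "is_subfield T \<Longrightarrow> is_subfield {a. c a \<in> T}"
  by (auto simp: is_subfield_def c_1 c_add c_mult c_minus c_inverse)

lemma is_subfield_image:
  assumes "is_subfield T"
  shows "is_subfield (c ` T)"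
proof -
  have "1 \<in> c ` T"
    using imageI[OF is_subfieldD(1)[OF assms], of c] by (simp add: c_1)
  then show ?thesis
    unfolding is_subfield_def
    by (auto simp flip: c_add c_mult c_minus c_inverse intro!: imageI is_subfieldD[OF assms])
qed

lemma image_gen_field: "c ` gen_field S = gen_field (c ` S)"
proof
  have "gen_field S \<subseteq> {a. c a \<in> gen_field (c ` S)}"
    by (intro gen_field_least is_subfield_vimage is_subfield_gen_field)
       (auto intro: subsetD[OF gen_field_incl])
  then show "c ` gen_field S \<subseteq> gen_field (c ` S)" by auto
  show "gen_field (c ` S) \<subseteq> c ` gen_field S"
    by (intro gen_field_least is_subfield_image is_subfield_gen_field image_mono gen_field_incl)
qed

end

lemma field_hom_compose: "field_hom f \<Longrightarrow> field_hom g \<Longrightarrow> field_hom (\<lambda>x. f (g x))"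
  unfolding field_hom_def coeff_hom_def by simp

lemma field_hom_id: "field_hom (\<lambda>x. x)"
  unfolding field_hom_def coeff_hom_def by simp

text \<open>The equalizer of two homomorphisms is a subfield.\<close>

lemma field_homs_agree:
  assumes "field_hom f" "field_hom g" "\<And>a. a \<in> S \<Longrightarrow> f a = g a" "a \<in> gen_field S"
  shows "f a = g a"
proof -
  interpret f: field_hom f by fact
  interpret g: field_hom g by fact
  have "is_subfield {a. f a = g a}"
    by (auto simp: is_subfield_def f.c_1 g.c_1 f.c_add g.c_add f.c_mult g.c_mult
        f.c_minus g.c_minus f.c_inverse g.c_inverse)
  then have "gen_field S \<subseteq> {a. f a = g a}"
    by (rule gen_field_least) (use assms(3) in auto)
  then show ?thesis using assms(4) by auto
qed

section \<open>Algebraic independence over a subfield\<close>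

text \<open>
  Algebraic independence is expressed as linear independence of the monomials. In this form the
  tower lemmas below become the usual statements about bases in towers of extensions. Working with
  families instead of sets allows substitutions that rename the elements.
\<close>

definition exps :: "'i set \<Rightarrow> ('i \<Rightarrow>\<^sub>0 nat) set" where
  "exps V = {t. Poly_Mapping.keys t \<subseteq> V}"

definition indep :: "'a::field set \<Rightarrow> 'i set \<Rightarrow> ('i \<Rightarrow> 'a) \<Rightarrow> bool" where
  "indep L V x \<longleftrightarrow> (\<forall>T a. finite T \<longrightarrow> T \<subseteq> exps V \<longrightarrow> a ` T \<subseteq> L \<longrightarrow>
     (\<Sum>t\<in>T. a t * monom_eval x t) = 0 \<longrightarrow> (\<forall>t\<in>T. a t = 0))"

text \<open>The ring \<open>L[x i | i \<in> V]\<close>.\<close>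

definition poly_span :: "'a::field set \<Rightarrow> 'i set \<Rightarrow> ('i \<Rightarrow> 'a) \<Rightarrow> 'a set" where
  "poly_span L V x = {\<Sum>t\<in>T. a t * monom_eval x t | T a. finite T \<and> T \<subseteq> exps V \<and> a ` T \<subseteq> L}"

lemma exps_0 [simp]: "0 \<in> exps V"
  by (simp add: exps_def)

lemma exps_add: "s \<in> exps V \<Longrightarrow> t \<in> exps V \<Longrightarrow> s + t \<in> exps V"
  unfolding exps_def using Poly_Mapping.keys_add[of s t] by blast

lemma exps_single: "i \<in> V \<Longrightarrow> Poly_Mapping.single i n \<in> exps V"
  by (simp add: exps_def)

lemma exps_mono: "V \<subseteq> W \<Longrightarrow> exps V \<subseteq> exps W"
  by (auto simp: exps_def)

lemma monom_eval_cong: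
  "t \<in> exps V \<Longrightarrow> (\<And>i. i \<in> V \<Longrightarrow> x i = y i) \<Longrightarrow> monom_eval x t = monom_eval y t"
  unfolding monom_eval_def exps_def by (intro prod.cong) auto

lemma indepD:
  "indep L V x \<Longrightarrow> finite T \<Longrightarrow> T \<subseteq> exps V \<Longrightarrow> (\<And>t. t \<in> T \<Longrightarrow> a t \<in> L) \<Longrightarrow>
     (\<Sum>t\<in>T. a t * monom_eval x t) = 0 \<Longrightarrow> t \<in> T \<Longrightarrow> a t = 0"
  unfolding indep_def image_subset_iff by blast

lemma indepI:
  "(\<And>T a t. finite T \<Longrightarrow> T \<subseteq> exps V \<Longrightarrow> (\<And>t. t \<in> T \<Longrightarrow> a t \<in> L) \<Longrightarrow>
     (\<Sum>t\<in>T. a t * monom_eval x t) = 0 \<Longrightarrow> t \<in> T \<Longrightarrow> a t = 0) \<Longrightarrow> indep L V x"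
  unfolding indep_def image_subset_iff by blast

lemma indep_mono: "indep L V x \<Longrightarrow> W \<subseteq> V \<Longrightarrow> indep L W x"
  unfolding indep_def using exps_mono[of W V] by (auto dest: subset_trans)

text \<open>
  The exponents \<open>f i\<close> may coincide, so sums and products of elements of the ring can be entered
  termwise.
\<close>

lemma poly_spanI:
  assumes L: "is_subfield L" and "finite I"
    and "\<And>i. i \<in> I \<Longrightarrow> a i \<in> L" "\<And>i. i \<in> I \<Longrightarrow> f i \<in> exps V"
  shows "(\<Sum>i\<in>I. a i * monom_eval x (f i)) \<in> poly_span L V x"
proof -
  have "(\<Sum>i\<in>I. a i * monom_eval x (f i)) =
      (\<Sum>t\<in>f ` I. \<Sum>i\<in>{i \<in> I. f i = t}. a i * monom_eval x (f i))"
    by (rule sum.image_gen[OF \<open>finite I\<close>])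
  also have "\<dots> = (\<Sum>t\<in>f ` I. (\<Sum>i\<in>{i \<in> I. f i = t}. a i) * monom_eval x t)"
    by (intro sum.cong refl) (simp add: sum_distrib_right)
  finally show ?thesis
    unfolding poly_span_def mem_Collect_eq
    by (intro exI[of _ "f ` I"] exI[of _ "\<lambda>t. \<Sum>i\<in>{i \<in> I. f i = t}. a i"])
       (use assms in \<open>auto intro!: is_subfield_sum\<close>)
qed

lemma poly_spanE:
  assumes "p \<in> poly_span L V x"
  obtains T a where "finite T" "T \<subseteq> exps V" "\<And>t. t \<in> T \<Longrightarrow> a t \<in> L"
    "p = (\<Sum>t\<in>T. a t * monom_eval x t)"
  using assms unfolding poly_span_def by (auto simp: image_subset_iff)

lemma poly_span_const: "is_subfield L \<Longrightarrow> a \<in> L \<Longrightarrow> a \<in> poly_span L V x"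
  using poly_spanI[of L "{()}" "\<lambda>_. a" "\<lambda>_. 0" V x] by simp

lemma poly_span_var: "is_subfield L \<Longrightarrow> i \<in> V \<Longrightarrow> x i \<in> poly_span L V x"
  using poly_spanI[of L "{()}" "\<lambda>_. 1" "\<lambda>_. Poly_Mapping.single i 1" V x]
  by (simp add: is_subfieldD(1) exps_single)

lemma poly_span_add:
  assumes "is_subfield L" "p \<in> poly_span L V x" "q \<in> poly_span L V x"
  shows "p + q \<in> poly_span L V x"
proof -
  obtain S a where S: "finite S" "S \<subseteq> exps V" "\<And>t. t \<in> S \<Longrightarrow> a t \<in> L"
      "p = (\<Sum>t\<in>S. a t * monom_eval x t)" by (rule poly_spanE[OF assms(2)]) blast
  obtain T b where T: "finite T" "T \<subseteq> exps V" "\<And>t. t \<in> T \<Longrightarrow> b t \<in> L"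
      "q = (\<Sum>t\<in>T. b t * monom_eval x t)" by (rule poly_spanE[OF assms(3)]) blast
  have "p + q = (\<Sum>z\<in>S <+> T. case_sum a b z * monom_eval x (case_sum id id z))"
    using S T by (simp add: sum.Plus)
  also have "\<dots> \<in> poly_span L V x"
    by (rule poly_spanI[OF assms(1)]) (use S T in auto)
  finally show ?thesis .
qed

lemma poly_span_mult:
  assumes "is_subfield L" "p \<in> poly_span L V x" "q \<in> poly_span L V x"
  shows "p * q \<in> poly_span L V x"
proof -
  obtain S a where S: "finite S" "S \<subseteq> exps V" "\<And>t. t \<in> S \<Longrightarrow> a t \<in> L"
      "p = (\<Sum>t\<in>S. a t * monom_eval x t)" by (rule poly_spanE[OF assms(2)]) blast
  obtain T b where T: "finite T" "T \<subseteq> exps V" "\<And>t. t \<in> T \<Longrightarrow> b t \<in> L"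
      "q = (\<Sum>t\<in>T. b t * monom_eval x t)" by (rule poly_spanE[OF assms(3)]) blast
  have "p * q = (\<Sum>(s, t)\<in>S \<times> T. (a s * monom_eval x s) * (b t * monom_eval x t))"
    unfolding S(4) T(4) sum_product by (rule sum.cartesian_product)
  also have "\<dots> = (\<Sum>z\<in>S \<times> T. (a (fst z) * b (snd z)) * monom_eval x (fst z + snd z))"
    by (intro sum.cong refl) (auto simp: monom_eval_add algebra_simps)
  also have "\<dots> \<in> poly_span L V x"
    by (rule poly_spanI[OF assms(1)]) (use S T assms(1) in \<open>auto intro!: exps_add is_subfieldD\<close>)
  finally show ?thesis .
qed

lemma poly_span_uminus:
  assumes L: "is_subfield L" and p: "p \<in> poly_span L V x"
  shows "- p \<in> poly_span L V x"
proof -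
  have "- 1 \<in> L" using L by (intro is_subfieldD)
  from poly_span_mult[OF L poly_span_const[OF L this] p] show ?thesis by simp
qed

lemma poly_span_prod:
  assumes L: "is_subfield L" and "\<And>i. i \<in> I \<Longrightarrow> f i \<in> poly_span L V x"
  shows "prod f I \<in> poly_span L V x"
  using assms(2)
proof (induction I rule: infinite_finite_induct)
  case (insert i I)
  then show ?case by (simp add: poly_span_mult[OF L])
qed (simp_all add: poly_span_const[OF L] is_subfieldD(1)[OF L])

lemma monom_eval_in_subfield:
  "is_subfield F \<Longrightarrow> x ` V \<subseteq> F \<Longrightarrow> t \<in> exps V \<Longrightarrow> monom_eval x t \<in> F"
  unfolding monom_eval_def exps_def by (intro is_subfield_prod is_subfield_power) auto

lemma poly_span_subset:
  assumes F: "is_subfield F" "L \<subseteq> F" "x ` V \<subseteq> F"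
  shows "poly_span L V x \<subseteq> F"
proof
  fix p assume "p \<in> poly_span L V x"
  then obtain T a where T: "T \<subseteq> exps V" "\<And>t. t \<in> T \<Longrightarrow> a t \<in> L"
      and p: "p = (\<Sum>t\<in>T. a t * monom_eval x t)" by (rule poly_spanE) blast
  show "p \<in> F"
    unfolding p using T F(2)
    by (intro is_subfield_sum[OF F(1)] is_subfieldD(4)[OF F(1)] monom_eval_in_subfield[OF F(1,3)]) auto
qed

text \<open>The fractions with numerator and denominator in the ring \<open>L[x]\<close> already form a subfield.\<close>

lemma gen_field_fractions:
  assumes L: "is_subfield L" and f: "f \<in> gen_field (L \<union> x ` V)"
  obtains p q where "p \<in> poly_span L V x" "q \<in> poly_span L V x" "q \<noteq> 0" "f = p / q"
proof -
  let ?R = "poly_span L V x"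
  define F where "F = {p / q | p q. p \<in> ?R \<and> q \<in> ?R \<and> q \<noteq> 0}"
  note R = poly_span_add[OF L] poly_span_mult[OF L] poly_span_uminus[OF L]
  have 1: "1 \<in> ?R" and 0: "0 \<in> ?R"
    using L by (auto intro: poly_span_const is_subfieldD)
  have F: "p / q \<in> F" if "p \<in> ?R" "q \<in> ?R" "q \<noteq> 0" for p q
    using that unfolding F_def by blast
  have "is_subfield F"
    unfolding is_subfield_def
  proof (intro conjI ballI)
    show "1 \<in> F" using F[OF 1 1] by simp
  next
    fix a b assume "a \<in> F" "b \<in> F"
    then obtain p q r s where *: "a = p / q" "b = r / s" "p \<in> ?R" "q \<in> ?R" "q \<noteq> 0"
        "r \<in> ?R" "s \<in> ?R" "s \<noteq> 0" unfolding F_def by blast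
    have "a + b = (p * s + r * q) / (q * s)" "a * b = (p * r) / (q * s)"
      using * by (auto simp: field_simps)
    moreover have "p * s + r * q \<in> ?R" "p * r \<in> ?R" "q * s \<in> ?R"
      using * by (simp_all add: R)
    ultimately show "a + b \<in> F" "a * b \<in> F"
      using * by (simp_all add: F)
  next
    fix a assume "a \<in> F"
    then obtain p q where *: "a = p / q" "p \<in> ?R" "q \<in> ?R" "q \<noteq> 0" unfolding F_def by blast
    show "- a \<in> F" using F[OF R(3)[OF *(2)] *(3,4)] *(1) by simp
    show "inverse a \<in> F"
    proof (cases "p = 0")
      case True
      have "inverse a = 0 / 1" using *(1) True by simp
      then show ?thesis using F[OF 0 1 one_neq_zero] by (simp only:)
    next
      case False
      have "inverse a = q / p" using *(1) by simp
      then show ?thesis using F[OF *(3,2) False] by (simp only:)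
    qed
  qed
  moreover have "L \<union> x ` V \<subseteq> F"
    using F[OF poly_span_const[OF L] 1] F[OF poly_span_var[OF L] 1] by auto
  ultimately have "f \<in> F" using gen_field_least f by blast
  then show ?thesis unfolding F_def using that by blast
qed

lemma gen_field_poly_span: "poly_span L V x \<subseteq> gen_field (L \<union> x ` V)"
  using gen_field_incl[of "L \<union> x ` V"]
  by (intro poly_span_subset is_subfield_gen_field) auto

text \<open>The part of an exponent vector that lies in the variables \<open>V\<close>.\<close>

lift_definition restr :: "'i set \<Rightarrow> ('i \<Rightarrow>\<^sub>0 nat) \<Rightarrow> ('i \<Rightarrow>\<^sub>0 nat)" is
  "\<lambda>V t i. if i \<in> V then t i else 0"
  by (erule rev_finite_subset) auto

lemma restr_exps: "restr V t \<in> exps V"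
  by (auto simp: exps_def in_keys_iff restr.rep_eq split: if_splits)

lemma restr_split:
  "t \<in> exps (V \<union> W) \<Longrightarrow> V \<inter> W = {} \<Longrightarrow> restr V t + restr W t = t"
  by (rule poly_mapping_eqI) (auto simp: exps_def lookup_add restr.rep_eq in_keys_iff)

lemma restr_add:
  assumes "s \<in> exps V" "t \<in> exps W" "V \<inter> W = {}"
  shows "restr V (s + t) = s" "restr W (s + t) = t"
proof -
  have "Poly_Mapping.lookup s i = 0" if "i \<notin> V" for i
    using that assms(1) by (auto simp: exps_def in_keys_iff)
  moreover have "Poly_Mapping.lookup t i = 0" if "i \<notin> W" for i
    using that assms(2) by (auto simp: exps_def in_keys_iff)
  ultimately show "restr V (s + t) = s" "restr W (s + t) = t"
    using assms(3) by (auto intro!: poly_mapping_eqI simp: lookup_add restr.rep_eq) (metis disjoint_iff)+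
qed

text \<open>
  Every monomial in \<open>V \<union> W\<close> is a product of a monomial in \<open>V\<close> and one in \<open>W\<close>. Collecting the terms
  with the same \<open>W\<close>-part turns a relation over \<open>k\<close> into a relation between monomials in \<open>W\<close> with
  coefficients in \<open>L\<close>.
\<close>

lemma indep_Un:
  assumes k: "is_subfield k" and L: "is_subfield L" "k \<subseteq> L"
    and V: "indep k V x" "x ` V \<subseteq> L" and W: "indep L W x" and disj: "V \<inter> W = {}"
  shows "indep k (V \<union> W) x"
proof (rule indepI)
  fix T a t assume T: "finite T" "T \<subseteq> exps (V \<union> W)" "\<And>t. t \<in> T \<Longrightarrow> a t \<in> k"
    and 0: "(\<Sum>t\<in>T. a t * monom_eval x t) = 0" and t: "t \<in> T"
  define b where "b s = (\<Sum>t\<in>{t \<in> T. restr W t = s}. a t * monom_eval x (restr V t))" for s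
  have split: "monom_eval x t = monom_eval x (restr V t) * monom_eval x (restr W t)" if "t \<in> T" for t
    using restr_split[of t V W] T(2) that disj by (metis monom_eval_add subsetD)
  have "(\<Sum>s\<in>restr W ` T. b s * monom_eval x s) =
      (\<Sum>s\<in>restr W ` T. \<Sum>t\<in>{t \<in> T. restr W t = s}. a t * monom_eval x t)"
    by (auto simp: b_def sum_distrib_right split intro!: sum.cong)
  also have "\<dots> = 0"
    using sum.image_gen[OF T(1), of "\<lambda>t. a t * monom_eval x t" "restr W"] 0 by simp
  finally have *: "(\<Sum>s\<in>restr W ` T. b s * monom_eval x s) = 0" .
  have "b s \<in> L" for s
    unfolding b_def
    by (intro is_subfield_sum[OF L(1)] is_subfieldD(4)[OF L(1)] monom_eval_in_subfield[OF L(1) V(2)])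
       (use T L restr_exps in auto)
  then have "b (restr W t) = 0"
    using indepD[OF W _ _ _ *] T(1) t restr_exps by blast
  define T' where "T' = {t' \<in> T. restr W t' = restr W t}"
  have T': "t' \<in> T" "restr V t' + restr W t = t'" if "t' \<in> T'" for t'
    using that restr_split[of t' V W] T(2) disj unfolding T'_def by auto
  have inj: "inj_on (restr V) T'"
    by (rule inj_onI) (metis T'(2))
  have "(\<Sum>u\<in>restr V ` T'. a (u + restr W t) * monom_eval x u) =
      (\<Sum>t'\<in>T'. a t' * monom_eval x (restr V t'))"
    unfolding sum.reindex[OF inj] by (intro sum.cong refl) (simp add: T'(2))
  also have "\<dots> = 0"
    using \<open>b (restr W t) = 0\<close> by (simp add: b_def T'_def)
  finally have "a (restr V t + restr W t) = 0"
  proof (rule indepD[OF V(1) _ _ _, rotated 3])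
    show "finite (restr V ` T')" using T(1) by (simp add: T'_def)
    show "restr V ` T' \<subseteq> exps V" using restr_exps by blast
    show "a (u + restr W t) \<in> k" if "u \<in> restr V ` T'" for u
      using that T' T(3) by auto
    show "restr V t \<in> restr V ` T'" by (rule imageI) (simp add: t T'_def)
  qed
  then show "a t = 0"
    using restr_split[OF subsetD[OF T(2) t] disj] by simp
qed

lemma common_denominator:
  assumes k: "is_subfield k" and "finite T" "\<And>t. t \<in> T \<Longrightarrow> a t \<in> gen_field (k \<union> x ` V)"
  obtains d where "d \<in> poly_span k V x" "d \<noteq> 0" "\<And>t. t \<in> T \<Longrightarrow> d * a t \<in> poly_span k V x"
proof -
  have "\<exists>d\<in>poly_span k V x. d \<noteq> 0 \<and> (\<forall>t\<in>T. d * a t \<in> poly_span k V x)"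
    using assms(2,3)
  proof (induction T rule: finite_induct)
    case empty
    show ?case
      by (intro bexI[OF _ poly_span_const[OF k is_subfieldD(1)[OF k]]]) simp
  next
    case (insert t T)
    have "\<exists>d\<in>poly_span k V x. d \<noteq> 0 \<and> (\<forall>t\<in>T. d * a t \<in> poly_span k V x)"
      by (rule insert.IH) (rule insert.prems, simp)
    then obtain d where d: "d \<in> poly_span k V x" "d \<noteq> 0" "\<forall>t\<in>T. d * a t \<in> poly_span k V x"
      by (elim bexE conjE)
    obtain p q where pq: "p \<in> poly_span k V x" "q \<in> poly_span k V x" "q \<noteq> 0" "a t = p / q"
      by (rule gen_field_fractions[OF k insert.prems[OF insertI1]])
    show ?case
    proof (intro bexI[of _ "q * d"] conjI ballI)
      fix s assume "s \<in> insert t T"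
      then consider "s = t" | "s \<in> T" by auto
      then show "q * d * a s \<in> poly_span k V x"
      proof cases
        case 1
        have "q * d * a s = p * d" using pq 1 by simp
        then show ?thesis using poly_span_mult[OF k pq(1) d(1)] by (simp only:)
      next
        case 2
        then show ?thesis using poly_span_mult[OF k pq(2) bspec[OF d(3)]] by (simp only: mult.assoc)
      qed
    next
      show "q * d \<in> poly_span k V x" by (rule poly_span_mult[OF k pq(2) d(1)])
      show "q * d \<noteq> 0" using d(2) pq(3) by simp
    qed
  qed
  then show ?thesis by (elim bexE conjE) (rule that, auto)
qed

text \<open>
  The converse direction. A relation over \<open>k(x i | i \<in> V)\<close> is multiplied by a common denominator and
  its coefficients are expanded into monomials in \<open>V\<close>, which gives a relation over \<open>k\<close>.
\<close>

lemma indep_over_gen_field: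
  assumes k: "is_subfield k" and VW: "indep k (V \<union> W) x" and disj: "V \<inter> W = {}"
  shows "indep (gen_field (k \<union> x ` V)) W x"
proof (rule indepI)
  fix T a t assume T: "finite T" "T \<subseteq> exps W" "\<And>t. t \<in> T \<Longrightarrow> a t \<in> gen_field (k \<union> x ` V)"
    and 0: "(\<Sum>t\<in>T. a t * monom_eval x t) = 0" and t: "t \<in> T"
  obtain d where d: "d \<in> poly_span k V x" "d \<noteq> 0" "\<And>t. t \<in> T \<Longrightarrow> d * a t \<in> poly_span k V x"
    by (rule common_denominator[OF k T(1,3)]) blast+
  have "\<forall>t\<in>T. \<exists>z. finite (fst z) \<and> fst z \<subseteq> exps V \<and> snd z ` fst z \<subseteq> k \<and>
      d * a t = (\<Sum>s\<in>fst z. snd z s * monom_eval x s)"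
  proof
    fix t assume "t \<in> T"
    obtain S c where "finite S" "S \<subseteq> exps V" "\<And>s. s \<in> S \<Longrightarrow> c s \<in> k"
        "d * a t = (\<Sum>s\<in>S. c s * monom_eval x s)"
      by (rule poly_spanE[OF d(3)[OF \<open>t \<in> T\<close>]]) blast
    then show "\<exists>z. finite (fst z) \<and> fst z \<subseteq> exps V \<and> snd z ` fst z \<subseteq> k \<and>
        d * a t = (\<Sum>s\<in>fst z. snd z s * monom_eval x s)"
      by (intro exI[of _ "(S, c)"]) auto
  qed
  from bchoice[OF this] obtain z where z: "\<forall>t\<in>T. finite (fst (z t)) \<and> fst (z t) \<subseteq> exps V \<and>
      snd (z t) ` fst (z t) \<subseteq> k \<and> d * a t = (\<Sum>s\<in>fst (z t). snd (z t) s * monom_eval x s)" ..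
  define S where "S t = fst (z t)" for t
  define c where "c t = snd (z t)" for t
  have S: "finite (S t)" "S t \<subseteq> exps V" "s \<in> S t \<Longrightarrow> c t s \<in> k"
      "d * a t = (\<Sum>s\<in>S t. c t s * monom_eval x s)" if "t \<in> T" for t s
    using bspec[OF z that] by (auto simp: S_def c_def)
  note add = restr_add[OF subsetD[OF S(2)] subsetD[OF T(2)] disj]
  define U where "U = (\<lambda>(t, s). s + t) ` Sigma T S"
  have inj: "inj_on (\<lambda>(t, s). s + t) (Sigma T S)"
  proof (rule inj_onI, clarify)
    fix t s t' s' assume *: "t \<in> T" "s \<in> S t" "t' \<in> T" "s' \<in> S t'" "s + t = s' + t'"
    then show "t = t' \<and> s = s'"
      using add[of t s t] add[of t' s' t'] by metis
  qed
  have "(\<Sum>u\<in>U. c (restr W u) (restr V u) * monom_eval x u) =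
      (\<Sum>(t, s)\<in>Sigma T S. c t s * (monom_eval x s * monom_eval x t))"
    unfolding U_def sum.reindex[OF inj]
    by (intro sum.cong refl) (auto simp: monom_eval_add add)
  also have "\<dots> = (\<Sum>t\<in>T. \<Sum>s\<in>S t. c t s * (monom_eval x s * monom_eval x t))"
    by (rule sum.Sigma[symmetric]) (use T S in auto)
  also have "\<dots> = d * (\<Sum>t\<in>T. a t * monom_eval x t)"
    unfolding sum_distrib_left
    by (intro sum.cong refl) (simp add: S(4) sum_distrib_right flip: mult.assoc)
  finally have *: "(\<Sum>u\<in>U. c (restr W u) (restr V u) * monom_eval x u) = 0"
    by (simp add: 0)
  have c: "c (restr W u) (restr V u) = 0" if "u \<in> U" for u
  proof (rule indepD[OF VW _ _ _ * that])
    show "finite U" unfolding U_def using T S by auto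
    show "U \<subseteq> exps (V \<union> W)"
      unfolding U_def using T(2) S(2) exps_mono[of V "V \<union> W"] exps_mono[of W "V \<union> W"]
      by (auto intro!: exps_add)
    show "c (restr W u) (restr V u) \<in> k" if "u \<in> U" for u
      using that unfolding U_def
      by (auto simp: add S(3))
  qed
  have "c t s = 0" if "s \<in> S t" for s
  proof -
    have "s + t \<in> U" unfolding U_def using t that by force
    from c[OF this] show ?thesis
      using restr_add[OF subsetD[OF S(2)[OF t] that] subsetD[OF T(2) t] disj] by simp
  qed
  then have "d * a t = 0" using S(4)[OF t] by simp
  then show "a t = 0" using d(2) by simp
qed

section \<open>Fixed fields of purely transcendental extensions\<close>

lemma field_hom_poly_sum:
  assumes "field_hom \<gamma>" "\<And>i. i \<in> V \<Longrightarrow> \<gamma> (x i) = x i" "T \<subseteq> exps V"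
  shows "\<gamma> (\<Sum>t\<in>T. a t * monom_eval x t) = (\<Sum>t\<in>T. \<gamma> (a t) * monom_eval x t)"
proof -
  interpret field_hom \<gamma> by fact
  show ?thesis
    unfolding c_sum c_mult c_monom_eval
    by (intro sum.cong refl arg_cong2[where f = "(*)"] monom_eval_cong[of _ V]) (use assms in auto)
qed

text \<open>
  The \<open>\<gamma>\<close> act only on the coefficients, and by independence the coefficients of \<open>p\<close> and of
  \<open>\<gamma> p\<close> agree.
\<close>

lemma poly_span_fixed:
  assumes L: "is_subfield L" and V: "indep L V x"
    and \<Gamma>: "\<And>\<gamma>. \<gamma> \<in> \<Gamma> \<Longrightarrow> field_hom \<gamma>" "\<And>\<gamma>. \<gamma> \<in> \<Gamma> \<Longrightarrow> \<gamma> ` L \<subseteq> L"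
      "\<And>\<gamma> i. \<gamma> \<in> \<Gamma> \<Longrightarrow> i \<in> V \<Longrightarrow> \<gamma> (x i) = x i"
    and p: "p \<in> poly_span L V x" "\<And>\<gamma>. \<gamma> \<in> \<Gamma> \<Longrightarrow> \<gamma> p = p"
  shows "p \<in> poly_span {a \<in> L. \<forall>\<gamma>\<in>\<Gamma>. \<gamma> a = a} V x"
proof -
  obtain T a where T: "finite T" "T \<subseteq> exps V" "\<And>t. t \<in> T \<Longrightarrow> a t \<in> L"
      and pe: "p = (\<Sum>t\<in>T. a t * monom_eval x t)"
    by (rule poly_spanE[OF p(1)]) blast
  have "\<gamma> (a t) = a t" if t: "t \<in> T" and g: "\<gamma> \<in> \<Gamma>" for t \<gamma>
  proof -
    interpret field_hom \<gamma> by (rule \<Gamma>(1)[OF g])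
    have "\<gamma> p = (\<Sum>t\<in>T. \<gamma> (a t) * monom_eval x t)"
      unfolding pe by (rule field_hom_poly_sum[OF \<Gamma>(1)[OF g] \<Gamma>(3)[OF g] T(2)])
    then have "(\<Sum>t\<in>T. (\<gamma> (a t) - a t) * monom_eval x t) = \<gamma> p - p"
      by (simp add: pe sum_subtractf left_diff_distrib)
    also have "\<dots> = 0" using p(2)[OF g] by simp
    finally have 0: "(\<Sum>t\<in>T. (\<gamma> (a t) - a t) * monom_eval x t) = 0" .
    have "\<gamma> (a t) - a t = 0"
    proof (rule indepD[where a = "\<lambda>t. \<gamma> (a t) - a t", OF V T(1,2) _ 0 t])
      show "\<gamma> (a t) - a t \<in> L" if "t \<in> T" for t
        using T(3)[OF that] \<Gamma>(2)[OF g] by (intro is_subfieldD(6)[OF L]) auto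
    qed
    then show ?thesis by simp
  qed
  then show ?thesis
    unfolding poly_span_def mem_Collect_eq
    by (intro exI[of _ T] exI[of _ a]) (use T pe in auto)
qed

text \<open>
  A fixed fraction can be written with fixed numerator and denominator: multiply both by the other
  conjugates of the denominator, so that the new denominator is the product \<open>Q\<close> over all of \<open>\<Gamma>\<close>.
  Both then have
  fixed coefficients by the previous lemma. The product is invariant since composition with
  \<open>\<gamma> \<in> \<Gamma>\<close> permutes the finite set \<open>\<Gamma>\<close>.
\<close>

lemma fixed_field_of_adjoined_invariants:
  assumes L: "is_subfield L" and V: "indep L V x"
    and fin: "finite \<Gamma>" and id: "(\<lambda>a. a) \<in> \<Gamma>"
    and comp: "\<And>\<gamma> \<delta>. \<gamma> \<in> \<Gamma> \<Longrightarrow> \<delta> \<in> \<Gamma> \<Longrightarrow> (\<lambda>a. \<gamma> (\<delta> a)) \<in> \<Gamma>"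
    and \<Gamma>: "\<And>\<gamma>. \<gamma> \<in> \<Gamma> \<Longrightarrow> field_hom \<gamma>" "\<And>\<gamma>. \<gamma> \<in> \<Gamma> \<Longrightarrow> \<gamma> ` L \<subseteq> L"
      "\<And>\<gamma> i. \<gamma> \<in> \<Gamma> \<Longrightarrow> i \<in> V \<Longrightarrow> \<gamma> (x i) = x i"
    and f: "f \<in> gen_field (L \<union> x ` V)" "\<And>\<gamma>. \<gamma> \<in> \<Gamma> \<Longrightarrow> \<gamma> f = f"
  shows "f \<in> gen_field ({a \<in> L. \<forall>\<gamma>\<in>\<Gamma>. \<gamma> a = a} \<union> x ` V)"
proof -
  let ?R = "poly_span L V x" and ?L = "{a \<in> L. \<forall>\<gamma>\<in>\<Gamma>. \<gamma> a = a}"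
  obtain p q where pq: "p \<in> ?R" "q \<in> ?R" "q \<noteq> 0" "f = p / q"
    by (rule gen_field_fractions[OF L f(1)])
  define Q where "Q = (\<Prod>\<delta>\<in>\<Gamma>. \<delta> q)"
  have R: "\<gamma> r \<in> ?R" if g: "\<gamma> \<in> \<Gamma>" and r: "r \<in> ?R" for \<gamma> r
  proof -
    interpret field_hom \<gamma> by (rule \<Gamma>(1)[OF g])
    obtain T a where T: "finite T" "T \<subseteq> exps V" "\<And>t. t \<in> T \<Longrightarrow> a t \<in> L"
        and re: "r = (\<Sum>t\<in>T. a t * monom_eval x t)"
      by (rule poly_spanE[OF r]) blast
    have "\<gamma> r = (\<Sum>t\<in>T. \<gamma> (a t) * monom_eval x t)"
      unfolding re by (rule field_hom_poly_sum[OF \<Gamma>(1)[OF g] \<Gamma>(3)[OF g] T(2)])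
    also have "\<dots> \<in> ?R"
      by (rule poly_spanI[OF L]) (use T \<Gamma>(2)[OF g] in auto)
    finally show ?thesis .
  qed
  have Q: "Q \<in> ?R"
    unfolding Q_def by (rule poly_span_prod[OF L R[OF _ pq(2)]])
  have Q_fixed: "\<gamma> Q = Q" if g: "\<gamma> \<in> \<Gamma>" for \<gamma>
  proof -
    interpret field_hom \<gamma> by (rule \<Gamma>(1)[OF g])
    have inj: "inj_on (\<lambda>\<delta> a. \<gamma> (\<delta> a)) \<Gamma>"
      by (rule inj_onI) (metis inj injD ext)
    moreover have "(\<lambda>\<delta> a. \<gamma> (\<delta> a)) ` \<Gamma> \<subseteq> \<Gamma>" using comp[OF g] by auto
    ultimately have im: "(\<lambda>\<delta> a. \<gamma> (\<delta> a)) ` \<Gamma> = \<Gamma>" by (rule endo_inj_surj[OF fin, rotated])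
    have "\<gamma> Q = (\<Prod>\<delta>\<in>\<Gamma>. \<gamma> (\<delta> q))" unfolding Q_def c_prod ..
    also have "\<dots> = (\<Prod>\<delta>\<in>(\<lambda>\<delta> a. \<gamma> (\<delta> a)) ` \<Gamma>. \<delta> q)" by (simp add: prod.reindex[OF inj])
    finally show ?thesis by (simp add: im Q_def)
  qed
  have "Q = q * (\<Prod>\<delta>\<in>\<Gamma> - {\<lambda>a. a}. \<delta> q)"
    unfolding Q_def by (subst prod.remove[OF fin id]) simp
  then have "f * Q = p * (\<Prod>\<delta>\<in>\<Gamma> - {\<lambda>a. a}. \<delta> q)"
    using pq by simp
  moreover have "(\<Prod>\<delta>\<in>\<Gamma> - {\<lambda>a. a}. \<delta> q) \<in> ?R"
    by (rule poly_span_prod[OF L R[OF _ pq(2)]]) simp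
  ultimately have P: "f * Q \<in> ?R" using poly_span_mult[OF L pq(1)] by simp
  have P_fixed: "\<gamma> (f * Q) = f * Q" if g: "\<gamma> \<in> \<Gamma>" for \<gamma>
  proof -
    interpret field_hom \<gamma> by (rule \<Gamma>(1)[OF g])
    show ?thesis by (simp add: c_mult f(2)[OF g] Q_fixed[OF g])
  qed
  have "f * Q \<in> poly_span ?L V x"
    by (rule poly_span_fixed[OF L V]; fact \<Gamma> P P_fixed)
  moreover have "Q \<in> poly_span ?L V x"
    by (rule poly_span_fixed[OF L V]; fact \<Gamma> Q Q_fixed)
  ultimately have "(f * Q) / Q \<in> gen_field (?L \<union> x ` V)"
    using gen_field_poly_span by (intro is_subfieldD(8)[OF is_subfield_gen_field]) blast+
  moreover have "\<delta> q \<noteq> 0" if "\<delta> \<in> \<Gamma>" for \<delta>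
    using field_hom.c_eq_0_iff[OF \<Gamma>(1)[OF that]] pq(3) by simp
  then have "Q \<noteq> 0" unfolding Q_def using fin by simp
  ultimately show ?thesis by simp
qed

section \<open>Change of variables\<close>

text \<open>
  Formal polynomials with coefficients in \<open>L\<close> and variables in \<open>V\<close>. A change of variables has to be
  carried out on these, because it must be undone before any relation is known to be trivial.
\<close>

definition poly_over :: "'a::zero set \<Rightarrow> 'i set \<Rightarrow> ('i, 'a) mpoly set" where
  "poly_over L V = {p. (\<forall>t\<in>Poly_Mapping.keys p. t \<in> exps V \<and> Poly_Mapping.lookup p t \<in> L)}"

interpretation ident: coeff_hom "\<lambda>a :: 'a::comm_ring_1. a"
  by unfold_locales simp_all

interpretation mconst: coeff_hom "mpoly_const :: 'a::comm_ring_1 \<Rightarrow> ('i, 'a) mpoly"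
  by (rule coeff_hom_const)

lemma poly_over_lookup:
  "is_subfield L \<Longrightarrow> p \<in> poly_over L V \<Longrightarrow> Poly_Mapping.lookup p t \<in> L"
  unfolding poly_over_def by (cases "t \<in> Poly_Mapping.keys p") (auto simp: in_keys_iff is_subfieldD(2))

lemma poly_over_single:
  "is_subfield L \<Longrightarrow> a \<in> L \<Longrightarrow> t \<in> exps V \<Longrightarrow> Poly_Mapping.single t a \<in> poly_over L V"
  unfolding poly_over_def by (auto simp: lookup_single split: if_splits)

lemma poly_over_add:
  assumes "is_subfield L" "p \<in> poly_over L V" "q \<in> poly_over L V"
  shows "p + q \<in> poly_over L V"
proof -
  have "Poly_Mapping.lookup (p + q) t \<in> L" for t
    unfolding lookup_add using assms by (intro is_subfieldD(3)) (auto intro: poly_over_lookup)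
  moreover have "Poly_Mapping.keys (p + q) \<subseteq> exps V"
    using Poly_Mapping.keys_add[of p q] assms(2,3) unfolding poly_over_def by blast
  ultimately show ?thesis unfolding poly_over_def by blast
qed

lemma poly_over_sum:
  assumes "is_subfield L" "\<And>i. i \<in> I \<Longrightarrow> f i \<in> poly_over L V"
  shows "sum f I \<in> poly_over L V"
  using assms(2)
proof (induction I rule: infinite_finite_induct)
  case (insert i I)
  then show ?case by (simp add: poly_over_add[OF assms(1)])
qed (simp_all add: poly_over_def)

lemma poly_over_mult:
  assumes L: "is_subfield L" and pq: "p \<in> poly_over L V" "q \<in> poly_over L V"
  shows "p * q \<in> poly_over L V"
proof -
  let ?m = "\<lambda>r t. Poly_Mapping.single t (Poly_Mapping.lookup r t)"
  have "p * q = (\<Sum>s\<in>Poly_Mapping.keys p. \<Sum>t\<in>Poly_Mapping.keys q. ?m p s * ?m q t)"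
    by (subst mpoly_sum_monomials[of p], subst mpoly_sum_monomials[of q], rule sum_product)
  also have "\<dots> \<in> poly_over L V"
  proof (intro poly_over_sum L)
    fix s t assume "s \<in> Poly_Mapping.keys p" "t \<in> Poly_Mapping.keys q"
    then show "?m p s * ?m q t \<in> poly_over L V"
      unfolding mult_single using pq poly_over_lookup[OF L]
      by (intro poly_over_single[OF L] is_subfieldD(4)[OF L] exps_add) (auto simp: poly_over_def)
  qed
  finally show ?thesis .
qed

lemma poly_over_const: "is_subfield L \<Longrightarrow> a \<in> L \<Longrightarrow> mpoly_const a \<in> poly_over L V"
  unfolding mpoly_const_def by (rule poly_over_single) auto

lemma poly_over_var: "is_subfield L \<Longrightarrow> i \<in> V \<Longrightarrow> mpoly_var i \<in> poly_over L V"
  unfolding mpoly_var_def by (intro poly_over_single exps_single is_subfieldD(1))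

lemma poly_over_power: "is_subfield L \<Longrightarrow> p \<in> poly_over L V \<Longrightarrow> p ^ n \<in> poly_over L V"
  using poly_over_const[of L 1 V]
  by (induction n) (auto intro: poly_over_mult simp: is_subfieldD(1) mconst.c_1)

lemma poly_over_prod:
  assumes "is_subfield L" "\<And>i. i \<in> I \<Longrightarrow> f i \<in> poly_over L V"
  shows "prod f I \<in> poly_over L V"
  using assms(2)
proof (induction I rule: infinite_finite_induct)
  case (insert i I)
  then show ?case by (simp add: poly_over_mult[OF assms(1)])
qed (use poly_over_power[of L 0 V 0] assms(1) in \<open>simp_all add: poly_over_def\<close>)

lemma poly_over_eval:
  assumes L: "is_subfield L" and p: "p \<in> poly_over L W"
    and x: "\<And>i. i \<in> W \<Longrightarrow> x i \<in> poly_over L V"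
  shows "mpoly_eval mpoly_const x p \<in> poly_over L V"
  unfolding mpoly_eval_def monom_eval_def
  by (intro poly_over_sum[OF L] poly_over_mult[OF L] poly_over_const[OF L] poly_over_prod[OF L]
        poly_over_power[OF L] poly_over_lookup[OF L p] x)
     (use p in \<open>auto simp: poly_over_def exps_def\<close>)

lemma (in coeff_hom) eval_const [simp]: "mpoly_eval c x (mpoly_const a) = c a"
  by (simp add: mpoly_const_def eval_single)

lemma (in coeff_hom) eval_var [simp]: "mpoly_eval c x (mpoly_var i) = x i"
  by (simp add: mpoly_var_def eval_single c_1)

lemma (in coeff_hom) c_mpoly_eval:
  "c (mpoly_eval d x p) = mpoly_eval (\<lambda>a. c (d a)) (\<lambda>i. c (x i)) p"
  by (simp add: mpoly_eval_def c_sum c_mult c_monom_eval)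

lemma mpoly_eval_cong:
  "p \<in> poly_over L V \<Longrightarrow> (\<And>a. a \<in> L \<Longrightarrow> c a = d a) \<Longrightarrow> (\<And>i. i \<in> V \<Longrightarrow> x i = y i) \<Longrightarrow>
     mpoly_eval c x p = mpoly_eval d y p"
  unfolding mpoly_eval_def poly_over_def
  by (intro sum.cong refl arg_cong2[where f = "(*)"] monom_eval_cong[of _ V]) auto

lemma mpoly_eval_var: "mpoly_eval mpoly_const mpoly_var p = (p :: ('i, 'a::comm_ring_1) mpoly)"
  by (subst (2) mpoly_sum_monomials)
     (simp add: mpoly_eval_def monom_eval_var mpoly_const_def mult_single)

lemma indep_iff_mpoly_eval:
  assumes L: "is_subfield L"
  shows "indep L V x \<longleftrightarrow> (\<forall>p\<in>poly_over L V. mpoly_eval (\<lambda>a. a) x p = 0 \<longrightarrow> p = 0)"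
proof (intro iffI ballI impI)
  fix p assume V: "indep L V x" and p: "p \<in> poly_over L V" "mpoly_eval (\<lambda>a. a) x p = 0"
  have "Poly_Mapping.lookup p t = 0" if "t \<in> Poly_Mapping.keys p" for t
    by (rule indepD[OF V _ _ _ _ that])
       (use p in \<open>auto simp: poly_over_def mpoly_eval_def\<close>)
  then show "p = 0" by (metis in_keys_iff keys_eq_empty ex_in_conv)
next
  assume *: "\<forall>p\<in>poly_over L V. mpoly_eval (\<lambda>a. a) x p = 0 \<longrightarrow> p = 0"
  show "indep L V x"
  proof (rule indepI)
    fix T a t assume T: "finite T" "T \<subseteq> exps V" "\<And>t. t \<in> T \<Longrightarrow> a t \<in> L"
      "(\<Sum>t\<in>T. a t * monom_eval x t) = 0" "t \<in> T"
    let ?p = "\<Sum>t\<in>T. Poly_Mapping.single t (a t)"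
    have "?p \<in> poly_over L V"
      using T by (intro poly_over_sum[OF L] poly_over_single[OF L]) auto
    moreover have "mpoly_eval (\<lambda>a. a) x ?p = 0"
      using T by (simp add: ident.eval_sum ident.eval_single)
    ultimately have "?p = 0" by (rule *[rule_format])
    then have "Poly_Mapping.lookup ?p t = 0" by (simp only: lookup_zero)
    then show "a t = 0"
      using T(1,5) by (simp add: lookup_sum lookup_single when_def)
  qed
qed

text \<open>
  Substituting \<open>M\<close> into a relation between the new elements gives a relation \<open>q\<close> between the old
  ones, which is trivial. Substituting \<open>C\<close> into \<open>q = 0\<close> returns the relation at the start, because
  \<open>M C = 1\<close>.
\<close>

lemma indep_linear_change:
  fixes F :: "'i \<times> 'b \<Rightarrow> 'a::field" and M :: "'j \<Rightarrow> 'i \<Rightarrow> 'a" and C :: "'i \<Rightarrow> 'j \<Rightarrow> 'a"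
  assumes L: "is_subfield L" and F: "indep L (I \<times> B) F" and fin: "finite I" "finite J"
    and M: "\<And>i j. i \<in> I \<Longrightarrow> j \<in> J \<Longrightarrow> M j i \<in> L" and C: "\<And>i j. i \<in> I \<Longrightarrow> j \<in> J \<Longrightarrow> C i j \<in> L"
    and MC: "\<And>j j'. j \<in> J \<Longrightarrow> j' \<in> J \<Longrightarrow> (\<Sum>i\<in>I. M j i * C i j') = (if j = j' then 1 else 0)"
  shows "indep L (J \<times> B) (\<lambda>(j, b). \<Sum>i\<in>I. M j i * F (i, b))"
  unfolding indep_iff_mpoly_eval[OF L]
proof (intro ballI impI)
  fix p :: "('j \<times> 'b, 'a) mpoly"
  assume p: "p \<in> poly_over L (J \<times> B)"
    and 0: "mpoly_eval (\<lambda>a. a) (\<lambda>(j, b). \<Sum>i\<in>I. M j i * F (i, b)) p = 0"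
  define w :: "'j \<times> 'b \<Rightarrow> ('i \<times> 'b, 'a) mpoly"
    where "w = (\<lambda>(j, b). \<Sum>i\<in>I. mpoly_const (M j i) * mpoly_var (i, b))"
  define v :: "'i \<times> 'b \<Rightarrow> ('j \<times> 'b, 'a) mpoly"
    where "v = (\<lambda>(i, b). \<Sum>j\<in>J. mpoly_const (C i j) * mpoly_var (j, b))"
  define q where "q = mpoly_eval mpoly_const w p"
  interpret E: coeff_hom "mpoly_eval (\<lambda>a :: 'a. a) F"
    by unfold_locales (simp_all add: ident.eval_add ident.eval_mult)
  interpret E': coeff_hom "mpoly_eval (mpoly_const :: 'a \<Rightarrow> ('j \<times> 'b, 'a) mpoly) v"
    by unfold_locales (simp_all add: mconst.eval_add mconst.eval_mult)
  have q: "q \<in> poly_over L (I \<times> B)"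
    unfolding q_def w_def
    by (rule poly_over_eval[OF L p])
       (auto intro!: poly_over_sum[OF L] poly_over_mult[OF L] poly_over_const[OF L] poly_over_var[OF L] M)
  have "mpoly_eval (\<lambda>a. a) F q = 0"
    unfolding q_def E.c_mpoly_eval 0[symmetric]
    by (rule mpoly_eval_cong[OF p]) (auto simp: w_def E.c_sum E.c_mult)
  then have "q = 0"
    using F q unfolding indep_iff_mpoly_eval[OF L] by blast
  have "mpoly_eval mpoly_const v (w (j, b)) = mpoly_var (j, b)" if "j \<in> J" for j b
  proof -
    have "mpoly_eval mpoly_const v (w (j, b)) =
        (\<Sum>i\<in>I. \<Sum>j'\<in>J. mpoly_const (M j i * C i j') * mpoly_var (j', b))"
      by (simp add: w_def E'.c_sum E'.c_mult)
         (simp add: v_def sum_distrib_left mconst.c_mult mult.assoc)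
    also have "\<dots> = (\<Sum>j'\<in>J. mpoly_const (\<Sum>i\<in>I. M j i * C i j') * mpoly_var (j', b))"
      by (subst sum.swap) (simp add: mconst.c_sum sum_distrib_right)
    also have "\<dots> = (\<Sum>j'\<in>J. if j = j' then mpoly_var (j', b) else 0)"
      by (intro sum.cong refl) (simp add: MC that mconst.c_0 mconst.c_1)
    also have "\<dots> = mpoly_var (j, b)" using that fin by simp
    finally show ?thesis .
  qed
  then have "mpoly_eval mpoly_const v q = mpoly_eval mpoly_const mpoly_var p"
    unfolding q_def E'.c_mpoly_eval
    by (intro mpoly_eval_cong[OF p]) auto
  then show "p = 0" using \<open>q = 0\<close> by (simp add: mpoly_eval_var)
qed

text \<open>Renaming along \<open>\<pi>\<close> is undone by renaming along an inverse of \<open>\<pi>\<close> on \<open>W\<close>.\<close>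

lemma indep_reindex:
  fixes x :: "'c \<Rightarrow> 'a::field" and y :: "'b \<Rightarrow> 'a"
  assumes L: "is_subfield L" and V: "indep L V x"
    and \<pi>: "inj_on \<pi> W" "\<pi> ` W \<subseteq> V" and y: "\<And>i. i \<in> W \<Longrightarrow> y i = x (\<pi> i)"
  shows "indep L W y"
  unfolding indep_iff_mpoly_eval[OF L]
proof (intro ballI impI)
  fix p :: "('b, 'a) mpoly" assume p: "p \<in> poly_over L W" and 0: "mpoly_eval (\<lambda>a. a) y p = 0"
  define q where "q = mpoly_eval mpoly_const (\<lambda>i. mpoly_var (\<pi> i)) p"
  define v :: "'c \<Rightarrow> ('b, 'a) mpoly" where "v = (\<lambda>j. mpoly_var (inv_into W \<pi> j))"
  interpret E: coeff_hom "mpoly_eval (\<lambda>a :: 'a. a) x"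
    by unfold_locales (simp_all add: ident.eval_add ident.eval_mult)
  interpret E': coeff_hom "mpoly_eval (mpoly_const :: 'a \<Rightarrow> ('b, 'a) mpoly) v"
    by unfold_locales (simp_all add: mconst.eval_add mconst.eval_mult)
  have "mpoly_eval (\<lambda>a. a) x q = mpoly_eval (\<lambda>a. a) y p"
    unfolding q_def E.c_mpoly_eval
    by (rule mpoly_eval_cong[OF p]) (simp_all add: y)
  moreover have "q \<in> poly_over L V"
    unfolding q_def by (rule poly_over_eval[OF L p], rule poly_over_var[OF L]) (use \<pi>(2) in auto)
  ultimately have "q = 0"
    using V 0 unfolding indep_iff_mpoly_eval[OF L] by simp
  moreover have "mpoly_eval mpoly_const v q = mpoly_eval mpoly_const mpoly_var p"
    unfolding q_def E'.c_mpoly_eval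
    by (rule mpoly_eval_cong[OF p]) (simp_all add: v_def inv_into_f_f[OF \<pi>(1)])
  ultimately show "p = 0" by (simp add: mpoly_eval_var)
qed

lemma indep_inj_on:
  fixes x :: "'i \<Rightarrow> 'a::field"
  assumes L: "is_subfield L" and V: "indep L V x"
  shows "inj_on x V"
proof (rule inj_onI, rule ccontr)
  fix i j assume ij: "i \<in> V" "j \<in> V" "x i = x j" "i \<noteq> j"
  let ?s = "\<lambda>i. Poly_Mapping.single i (1::nat)"
  have ne: "?s i \<noteq> ?s j" using ij(4) by (metis keys_single singleton_inject one_neq_zero)
  define a where "a t = (if t = ?s i then 1 else - 1 :: 'a)" for t
  have "a (?s i) = 0"
  proof (rule indepD[OF V])
    show "finite {?s i, ?s j}" "?s i \<in> {?s i, ?s j}" "{?s i, ?s j} \<subseteq> exps V"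
      using ij by (auto intro: exps_single)
    show "a t \<in> L" for t using L by (auto simp: a_def is_subfieldD(1) intro: is_subfieldD(5))
    show "(\<Sum>t\<in>{?s i, ?s j}. a t * monom_eval x t) = 0"
      using ne ij(3) by (simp add: a_def)
  qed
  then show False by (simp add: a_def)
qed

lemma indep_image:
  assumes L: "is_subfield L" and V: "indep L V x"
  shows "indep L (x ` V) (\<lambda>b. b)"
  by (rule indep_reindex[OF L V, of "inv_into V x"])
     (auto simp: inj_on_inv_into inv_into_into f_inv_into_f)

text \<open>
  Over the image of a homomorphism the coefficients of a relation can be pulled back, so that the
  relation becomes a formal polynomial over the original field.
\<close>

lemma indep_range_iff:
  assumes c: "field_hom c"
  shows "indep (range c) V x \<longleftrightarrow>
    (\<forall>p. (\<forall>t\<in>Poly_Mapping.keys p. Poly_Mapping.keys t \<subseteq> V) \<longrightarrow> mpoly_eval c x p = 0 \<longrightarrow> p = 0)"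
proof (intro iffI allI impI)
  interpret field_hom c by fact
  fix p assume V: "indep (range c) V x" and p: "\<forall>t\<in>Poly_Mapping.keys p. Poly_Mapping.keys t \<subseteq> V"
    and 0: "mpoly_eval c x p = 0"
  have "Poly_Mapping.lookup p t = 0" if "t \<in> Poly_Mapping.keys p" for t
  proof -
    have "c (Poly_Mapping.lookup p t) = 0"
      by (rule indepD[OF V _ _ _ _ that, where a = "\<lambda>t. c (Poly_Mapping.lookup p t)"])
         (use p 0 in \<open>auto simp: exps_def mpoly_eval_def\<close>)
    then show ?thesis by (simp add: c_eq_0_iff)
  qed
  then show "p = 0" by (metis in_keys_iff keys_eq_empty ex_in_conv)
next
  interpret field_hom c by fact
  assume *: "\<forall>p. (\<forall>t\<in>Poly_Mapping.keys p. Poly_Mapping.keys t \<subseteq> V) \<longrightarrow>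
    mpoly_eval c x p = 0 \<longrightarrow> p = 0"
  show "indep (range c) V x"
  proof (rule indepI)
    fix T a t assume T: "finite T" "T \<subseteq> exps V" "\<And>t. t \<in> T \<Longrightarrow> a t \<in> range c"
      "(\<Sum>t\<in>T. a t * monom_eval x t) = 0" "t \<in> T"
    define p where "p = (\<Sum>t\<in>T. Poly_Mapping.single t (inv' c (a t)))"
    have p: "Poly_Mapping.lookup p s = (if s \<in> T then inv' c (a s) else 0)" for s
      using T(1) by (simp add: p_def lookup_sum lookup_single when_def)
    have "Poly_Mapping.keys s \<subseteq> V" if "s \<in> Poly_Mapping.keys p" for s
      using that T(2) by (auto simp: in_keys_iff p exps_def split: if_splits)
    moreover have "mpoly_eval c x p = 0"
      using T(3,4) by (simp add: p_def eval_sum eval_single f_inv_into_f cong: sum.cong)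
    ultimately have "p = 0" using * by blast
    then have "inv' c (a t) = 0" using p[of t] T(5) by simp
    then show "a t = 0" using f_inv_into_f[OF T(3)[OF T(5)]] by (simp add: c_0)
  qed
qed

lemma algebraically_independent_iff_indep:
  "field_hom c \<Longrightarrow> algebraically_independent c B \<longleftrightarrow> indep (range c) B (\<lambda>b. b)"
  by (simp add: algebraically_independent_def indep_range_iff)

section \<open>Substitution homomorphisms of rational functions\<close>

lemma field_hom_rat_const: "field_hom (rat_const :: 'k::field \<Rightarrow> 'k rat_fun)"
proof -
  have "coeff_hom (rat_const :: 'k \<Rightarrow> 'k rat_fun)"
    by unfold_locales
      (simp_all add: rat_const_def const.c_0 const.c_1 const.c_add const.c_mult
         Zero_fract_def One_fract_def)
  then show ?thesis by (simp add: field_hom_def)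
qed

lemma mpoly_eval_rat_var: "mpoly_eval rat_const rat_var p = Fraction_Field.Fract p 1"
proof -
  interpret F: coeff_hom "\<lambda>p :: (nat, 'a) mpoly. Fraction_Field.Fract p 1"
    by unfold_locales (simp_all add: Zero_fract_def One_fract_def)
  show ?thesis
    using F.c_mpoly_eval[of mpoly_const mpoly_var p]
    by (simp add: mpoly_eval_var rat_const_def[abs_def] rat_var_def[abs_def])
qed

abbreviation rat_consts :: "'k::field rat_fun set" where
  "rat_consts \<equiv> range rat_const"

lemma indep_rat_var: "indep (rat_consts :: 'k::field rat_fun set) UNIV rat_var"
  unfolding indep_range_iff[OF field_hom_rat_const] mpoly_eval_rat_var
  by (simp add: Zero_fract_def eq_fract)

lemma is_subfield_rat_consts: "is_subfield (rat_consts :: 'k::field rat_fun set)"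
proof -
  interpret field_hom "rat_const :: 'k \<Rightarrow> 'k rat_fun" by (rule field_hom_rat_const)
  show ?thesis
    by (rule is_subfield_image) (simp add: is_subfield_def)
qed

text \<open>
  Since the \<open>x i\<close> are independent, no nonzero denominator evaluates to \<open>0\<close>. Independence is required
  for all natural numbers as indices, so that the homomorphism is total on \<^typ>\<open>'k rat_fun\<close>; a finite
  family is first continued by fresh variables.
\<close>

lemma substitution_hom:
  fixes c :: "'k::field \<Rightarrow> 'a::field" and x :: "nat \<Rightarrow> 'a"
  assumes c: "field_hom c" and x: "indep (range c) UNIV x"
  obtains \<phi> :: "'k rat_fun \<Rightarrow> 'a" where "field_hom \<phi>" "\<And>a. \<phi> (rat_const a) = c a"
    "\<And>i. \<phi> (rat_var i) = x i"
proof -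
  interpret field_hom c by fact
  define E where "E = mpoly_eval c x"
  interpret E: coeff_hom E
    unfolding E_def by unfold_locales (simp_all add: eval_add eval_mult)
  have E0: "E p = 0 \<longleftrightarrow> p = 0" for p
    using x unfolding indep_range_iff[OF c] E_def by auto
  define \<phi> where "\<phi> f = (THE r. \<exists>p q. q \<noteq> 0 \<and> f = Fraction_Field.Fract p q \<and> r = E p / E q)" for f
  have \<phi>: "\<phi> (Fraction_Field.Fract p q) = E p / E q" if q: "q \<noteq> 0" for p q
    unfolding \<phi>_def
  proof (rule the_equality)
    fix r assume "\<exists>p' q'. q' \<noteq> 0 \<and> Fraction_Field.Fract p q = Fraction_Field.Fract p' q' \<and> r = E p' / E q'"
    then obtain p' q' where *: "q' \<noteq> 0" "Fraction_Field.Fract p q = Fraction_Field.Fract p' q'"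
      "r = E p' / E q'" by blast
    then have "E (p * q') = E (p' * q)" using q by (simp add: eq_fract)
    then show "r = E p / E q" using * q by (simp add: E.c_mult E0 frac_eq_eq)
  qed (use q in blast)
  have "\<phi> (f + g) = \<phi> f + \<phi> g" for f g
    by (cases f; cases g) (simp add: \<phi> E.c_add E.c_mult E0 add_frac_eq)
  moreover have "\<phi> (f * g) = \<phi> f * \<phi> g" for f g
    by (cases f; cases g) (simp add: \<phi> E.c_mult)
  ultimately have "field_hom \<phi>"
    by unfold_locales (simp_all add: Zero_fract_def One_fract_def \<phi> E.c_0 E.c_1)
  moreover have "\<phi> (rat_const a) = c a" for a
    by (simp add: rat_const_def \<phi> E.c_1) (simp add: E_def)
  moreover have "\<phi> (rat_var i) = x i" for i
    by (simp add: rat_var_def \<phi> E.c_1) (simp add: E_def)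
  ultimately show ?thesis by (rule that)
qed

lemma field_hom_perm_rat_fun: "bij \<sigma> \<Longrightarrow> field_hom (perm_rat_fun \<sigma> :: 'k::field rat_fun \<Rightarrow> _)"
proof -
  assume \<sigma>: "bij \<sigma>"
  have "perm_rat_fun \<sigma> (0 :: 'k rat_fun) = 0" "perm_rat_fun \<sigma> (1 :: 'k rat_fun) = 1"
    using \<sigma> by (simp_all add: Zero_fract_def One_fract_def perm_rat_fun_Fract perm_mpoly_hom)
  then show ?thesis
    using \<sigma> by unfold_locales (simp_all add: perm_rat_fun_hom)
qed

lemma perm_rat_fun_comp:
  "bij \<sigma> \<Longrightarrow> bij \<tau> \<Longrightarrow> perm_rat_fun (\<sigma> \<circ> \<tau>) f = perm_rat_fun \<sigma> (perm_rat_fun \<tau> f)"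
  by (cases f) (simp add: perm_rat_fun_Fract perm_mpoly_comp perm_mpoly_eq_0_iff bij_comp)

lemma perm_rat_fun_id: "perm_rat_fun id f = f"
  by (cases f) (simp add: perm_rat_fun_Fract perm_mpoly_id)

text \<open>The finite monoids of automorphisms to which the descent lemma is applied.\<close>

lemma perm_rat_fun_image_monoid:
  fixes \<Gamma> :: "('k::field rat_fun \<Rightarrow> 'k rat_fun) set"
  assumes \<Gamma>: "\<Gamma> = perm_rat_fun ` Q" and Q: "\<forall>\<sigma>\<in>Q. bij \<sigma>" "id \<in> Q"
    "\<forall>\<sigma>\<in>Q. \<forall>\<tau>\<in>Q. \<sigma> \<circ> \<tau> \<in> Q"
  shows "\<And>\<gamma>. \<gamma> \<in> \<Gamma> \<Longrightarrow> field_hom \<gamma>"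
    and "\<And>\<gamma> a. \<gamma> \<in> \<Gamma> \<Longrightarrow> \<gamma> (rat_const a) = rat_const a"
    and "(\<lambda>a. a) \<in> \<Gamma>"
    and "\<And>\<gamma> \<delta>. \<gamma> \<in> \<Gamma> \<Longrightarrow> \<delta> \<in> \<Gamma> \<Longrightarrow> (\<lambda>a. \<gamma> (\<delta> a)) \<in> \<Gamma>"
proof -
  show "field_hom \<gamma>" "\<gamma> (rat_const a) = rat_const a" if "\<gamma> \<in> \<Gamma>" for \<gamma> a
    using that Q(1) by (auto simp: \<Gamma> field_hom_perm_rat_fun perm_rat_fun_hom)
  have "(\<lambda>a. a) = (perm_rat_fun id :: 'k rat_fun \<Rightarrow> _)" by (rule ext) (simp add: perm_rat_fun_id)
  then show "(\<lambda>a. a) \<in> \<Gamma>" unfolding \<Gamma> using Q(2) by (intro image_eqI[where x = id])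
  show "(\<lambda>a. \<gamma> (\<delta> a)) \<in> \<Gamma>" if \<gamma>\<delta>: "\<gamma> \<in> \<Gamma>" "\<delta> \<in> \<Gamma>" for \<gamma> \<delta>
  proof -
    obtain \<sigma> \<tau> where \<sigma>\<tau>: "\<sigma> \<in> Q" "\<tau> \<in> Q" "\<gamma> = perm_rat_fun \<sigma>" "\<delta> = perm_rat_fun \<tau>"
      using \<gamma>\<delta> by (auto simp: \<Gamma>)
    then have "(\<lambda>a. \<gamma> (\<delta> a)) = perm_rat_fun (\<sigma> \<circ> \<tau>)"
      using Q(1) by (intro ext) (simp add: perm_rat_fun_comp)
    then show ?thesis
      unfolding \<Gamma> using Q(3) \<sigma>\<tau>(1,2) by (intro image_eqI[where x = "\<sigma> \<circ> \<tau>"]) auto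
  qed
qed

text \<open>
  A map in \<open>\<Gamma>\<close> that acts on the \<open>\<phi> (rat_var j)\<close> as \<open>\<sigma>\<close> acts on the variables corresponds to \<open>\<sigma>\<close> on
  all of \<open>k(x 1, \<dots>, x N)\<close>. As \<open>\<phi>\<close> is injective, an element of the image that is fixed by \<open>\<Gamma>\<close> comes
  from an element fixed by \<open>P\<close>. The lemma turns the hypotheses on \<open>G\<close> and \<open>H\<close> into statements about
  subfields of the big field.
\<close>

lemma fixed_elements_transfer:
  fixes \<phi> :: "'k::field rat_fun \<Rightarrow> 'k rat_fun"
  assumes \<phi>: "field_hom \<phi>" "\<And>a. \<phi> (rat_const a) = rat_const a"
    and fixed: "fixed_field N P = gen_field (rat_consts \<union> B)"
    and P: "\<And>\<sigma>. \<sigma> \<in> P \<Longrightarrow> bij \<sigma>"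
      "\<And>\<sigma>. \<sigma> \<in> P \<Longrightarrow> \<exists>\<gamma>\<in>\<Gamma>. \<forall>j\<in>{1..N}. \<gamma> (\<phi> (rat_var j)) = \<phi> (rat_var (\<sigma> j))"
    and \<Gamma>: "\<And>\<gamma>. \<gamma> \<in> \<Gamma> \<Longrightarrow> field_hom \<gamma>" "\<And>\<gamma> a. \<gamma> \<in> \<Gamma> \<Longrightarrow> \<gamma> (rat_const a) = rat_const a"
    and u: "u \<in> gen_field (rat_consts \<union> \<phi> ` rat_var ` {1..N})" "\<And>\<gamma>. \<gamma> \<in> \<Gamma> \<Longrightarrow> \<gamma> u = u"
  shows "u \<in> gen_field (rat_consts \<union> \<phi> ` B)"
proof -
  interpret \<phi>: field_hom \<phi> by (rule \<phi>)
  have im_consts: "\<phi> ` rat_consts = rat_consts" using \<phi>(2) by (simp add: image_image)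
  have im: "\<phi> ` gen_field (rat_consts \<union> S) = gen_field (rat_consts \<union> \<phi> ` S)" for S
    by (simp add: \<phi>.image_gen_field image_Un im_consts)
  obtain v where v: "v \<in> gen_field (rat_consts \<union> rat_var ` {1..N})" "u = \<phi> v"
    using u(1) unfolding im[symmetric] by blast
  have "perm_rat_fun \<sigma> v = v" if \<sigma>: "\<sigma> \<in> P" for \<sigma>
  proof -
    obtain \<gamma> where \<gamma>: "\<gamma> \<in> \<Gamma>" "\<And>j. j \<in> {1..N} \<Longrightarrow> \<gamma> (\<phi> (rat_var j)) = \<phi> (rat_var (\<sigma> j))"
      using P(2)[OF \<sigma>] by blast
    have "\<gamma> (\<phi> v) = \<phi> (perm_rat_fun \<sigma> v)"
    proof (rule field_homs_agree[OF _ _ _ v(1)])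
      show "field_hom (\<lambda>v. \<gamma> (\<phi> v))"
        by (rule field_hom_compose[OF \<Gamma>(1)[OF \<gamma>(1)] \<phi>(1)])
      show "field_hom (\<lambda>v. \<phi> (perm_rat_fun \<sigma> v))"
        by (rule field_hom_compose[OF \<phi>(1) field_hom_perm_rat_fun[OF P(1)[OF \<sigma>]]])
      show "\<gamma> (\<phi> a) = \<phi> (perm_rat_fun \<sigma> a)" if "a \<in> rat_consts \<union> rat_var ` {1..N}" for a
        using that \<gamma> \<Gamma>(2) \<phi>(2) P(1)[OF \<sigma>] by (auto simp: perm_rat_fun_hom)
    qed
    then have "\<phi> (perm_rat_fun \<sigma> v) = \<phi> v" using u(2)[OF \<gamma>(1)] v(2) by simp
    then show ?thesis using \<phi>.inj by (rule injD[rotated])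
  qed
  then have "v \<in> fixed_field N P"
    using v(1) by (simp add: fixed_field_def rat_fun_field_def field_adjoin_def)
  then show ?thesis unfolding fixed im[symmetric] v(2) by (rule imageI)
qed

section \<open>Lagrange interpolation\<close>

text \<open>
  \<open>C i\<close> lists the coefficients of the polynomial \<open>\<ll> i\<close> of degree less than \<open>card I\<close> that is \<open>1\<close> at
  \<open>\<theta> i\<close> and \<open>0\<close> at the other nodes. It inverts the Vandermonde matrix on both sides: one side is this
  property of \<open>\<ll> i\<close>, and the other says that a power \<open>X ^ t\<close> with \<open>t < card I\<close> is equal to its own
  interpolation polynomial.
\<close>

lemma Lagrange_coefficients:
  fixes \<theta> :: "'i \<Rightarrow> 'a::field"
  assumes L: "is_subfield L" and fin: "finite I" and inj: "inj_on \<theta> I" and \<theta>: "\<theta> ` I \<subseteq> L"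
  obtains C :: "'i \<Rightarrow> nat \<Rightarrow> 'a"
  where "\<And>i t. i \<in> I \<Longrightarrow> C i t \<in> L"
    "\<And>i i'. i \<in> I \<Longrightarrow> i' \<in> I \<Longrightarrow> (\<Sum>t<card I. C i t * \<theta> i' ^ t) = (if i = i' then 1 else 0)"
    "\<And>t t'. t < card I \<Longrightarrow> t' < card I \<Longrightarrow> (\<Sum>i\<in>I. \<theta> i ^ t * C i t') = (if t = t' then 1 else 0)"
proof -
  define \<ll> where "\<ll> i = (\<Prod>j\<in>I - {i}. Polynomial.smult (inverse (\<theta> i - \<theta> j)) [:- \<theta> j, 1:])" for i
  define C where "C i = Polynomial.coeff (\<ll> i)" for i
  have L_prod: "Polynomial.coeff (\<Prod>j\<in>J. f j) t \<in> L"
    if "\<And>j t. j \<in> J \<Longrightarrow> Polynomial.coeff (f j) t \<in> L" for J :: "'i set" and f t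
    using that
  proof (induction J arbitrary: t rule: infinite_finite_induct)
    case (insert j J)
    then show ?case
      by (auto simp: Polynomial.coeff_mult intro!: is_subfield_sum[OF L] is_subfieldD(4)[OF L])
  qed (auto simp: is_subfieldD(1,2)[OF L])
  have C: "C i t \<in> L" if i: "i \<in> I" for i t
    unfolding C_def \<ll>_def
  proof (rule L_prod)
    fix j t assume "j \<in> I - {i}"
    then have "\<theta> j \<in> L" "inverse (\<theta> i - \<theta> j) \<in> L"
      using \<theta> i by (auto intro!: is_subfieldD(6,7)[OF L])
    then show "Polynomial.coeff (Polynomial.smult (inverse (\<theta> i - \<theta> j)) [:- \<theta> j, 1:]) t \<in> L"
      by (auto simp: coeff_pCons split: nat.splits intro!: is_subfieldD(1-5)[OF L])
  qed
  have poly: "Polynomial.poly (\<ll> i) (\<theta> i') = (if i = i' then 1 else 0)"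
    if "i \<in> I" "i' \<in> I" for i i'
  proof (cases "i = i'")
    case True
    have "Polynomial.poly (Polynomial.smult (inverse (\<theta> i - \<theta> j)) [:- \<theta> j, 1:]) (\<theta> i) = 1"
      if "j \<in> I - {i}" for j
    proof -
      have "\<theta> i - \<theta> j \<noteq> 0" using that \<open>i \<in> I\<close> inj by (auto simp: inj_on_def)
      then show ?thesis unfolding Polynomial.poly_smult by simp
    qed
    then show ?thesis
      using True unfolding \<ll>_def poly_prod by (simp only: prod.neutral_const simp_thms if_True cong: prod.cong)
  next
    case False
    then show ?thesis using that fin by (auto simp: \<ll>_def poly_prod)
  qed
  have deg: "Polynomial.degree (\<ll> i) < card I" if "i \<in> I" for i
  proof -
    have "Polynomial.degree (\<ll> i) \<le>
        sum (Polynomial.degree \<circ> (\<lambda>j. Polynomial.smult (inverse (\<theta> i - \<theta> j)) [:- \<theta> j, 1:])) (I - {i})"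
      unfolding \<ll>_def by (rule degree_prod_sum_le) (simp add: fin)
    also have "\<dots> \<le> (\<Sum>j\<in>I - {i}. 1)"
      unfolding o_def by (rule sum_mono, rule order.trans[OF Polynomial.degree_smult_le]) simp
    also have "\<dots> = card I - 1" using that fin by simp
    also have "\<dots> < card I" using that fin by (metis card_gt_0_iff diff_less empty_iff zero_less_one)
    finally show ?thesis .
  qed
  show ?thesis
  proof (rule that[of C])
    show "C i t \<in> L" if "i \<in> I" for i t by (rule C[OF that])
    show "(\<Sum>t<card I. C i t * \<theta> i' ^ t) = (if i = i' then 1 else 0)" if "i \<in> I" "i' \<in> I" for i i'
    proof -
      have "(\<Sum>t<card I. C i t * \<theta> i' ^ t) = Polynomial.poly (\<ll> i) (\<theta> i')"
        unfolding poly_altdef C_def using deg[OF that(1)]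
        by (intro sum.mono_neutral_right) (auto simp: Polynomial.coeff_eq_0)
      then show ?thesis using poly[OF that] by simp
    qed
    show "(\<Sum>i\<in>I. \<theta> i ^ t * C i t') = (if t = t' then 1 else 0)" if t: "t < card I" for t t'
    proof -
      define p where "p = (\<Sum>i\<in>I. Polynomial.smult (\<theta> i ^ t) (\<ll> i))"
      have "p - Polynomial.monom 1 t = 0"
      proof (rule ccontr)
        assume "p - Polynomial.monom 1 t \<noteq> 0"
        then have fin_roots: "finite {a. Polynomial.poly (p - Polynomial.monom 1 t) a = 0}"
          and roots: "card {a. Polynomial.poly (p - Polynomial.monom 1 t) a = 0} \<le>
            Polynomial.degree (p - Polynomial.monom 1 t)"
          by (rule poly_roots_finite, rule card_poly_roots_bound)
        have "Polynomial.poly (p - Polynomial.monom 1 t) (\<theta> i') = 0" if i': "i' \<in> I" for i'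
        proof -
          have "Polynomial.poly p (\<theta> i') = (\<Sum>i\<in>I. if i = i' then \<theta> i ^ t else 0)"
            unfolding p_def Polynomial.poly_sum by (intro sum.cong refl) (simp add: poly i')
          then show ?thesis using i' fin by (simp add: Polynomial.poly_monom)
        qed
        then have "\<theta> ` I \<subseteq> {a. Polynomial.poly (p - Polynomial.monom 1 t) a = 0}" by blast
        then have "card I \<le> Polynomial.degree (p - Polynomial.monom 1 t)"
          using card_mono[OF fin_roots] roots card_image[OF inj] by (metis order.trans)
        moreover have "Polynomial.degree p < card I"
          unfolding p_def using t deg
          by (intro Polynomial.degree_sum_less) (auto intro: le_less_trans[OF Polynomial.degree_smult_le])
        then have "Polynomial.degree (p - Polynomial.monom 1 t) < card I"
          using t by (intro Polynomial.degree_diff_less) (simp_all add: Polynomial.degree_monom_eq)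
        ultimately show False by simp
      qed
      then have "p = Polynomial.monom 1 t" by simp
      then have "Polynomial.coeff p t' = (if t = t' then 1 else 0)" by simp
      then show ?thesis by (simp add: p_def Polynomial.coeff_sum C_def)
    qed
  qed
qed

section \<open>Wreath products of permutation groups\<close>

lemma group_semidirect_product:
  assumes A: "group A" and G: "group G"
    and act: "\<And>g a. g \<in> carrier G \<Longrightarrow> a \<in> carrier A \<Longrightarrow> \<phi> g a \<in> carrier A"
      "\<And>g a b. g \<in> carrier G \<Longrightarrow> a \<in> carrier A \<Longrightarrow> b \<in> carrier A \<Longrightarrow>
         \<phi> g (a \<otimes>\<^bsub>A\<^esub> b) = \<phi> g a \<otimes>\<^bsub>A\<^esub> \<phi> g b"
      "\<And>g h a. g \<in> carrier G \<Longrightarrow> h \<in> carrier G \<Longrightarrow> a \<in> carrier A \<Longrightarrow>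
         \<phi> (g \<otimes>\<^bsub>G\<^esub> h) a = \<phi> g (\<phi> h a)"
      "\<And>a. a \<in> carrier A \<Longrightarrow> \<phi> \<one>\<^bsub>G\<^esub> a = a"
  shows "group (semidirect_product A G \<phi>)"
proof -
  interpret A: group A by fact
  interpret G: group G by fact
  have one: "\<phi> g \<one>\<^bsub>A\<^esub> = \<one>\<^bsub>A\<^esub>" if "g \<in> carrier G" for g
    using act(2)[OF that A.one_closed A.one_closed] act(1)[OF that A.one_closed]
    by (simp add: A.r_cancel_one')
  show ?thesis
  proof (rule groupI)
    fix u assume "u \<in> carrier (semidirect_product A G \<phi>)"
    then obtain a g where u: "u = (a, g)" "a \<in> carrier A" "g \<in> carrier G"
      by (auto simp: semidirect_product_def)
    define v where "v = (\<phi> (inv\<^bsub>G\<^esub> g) (inv\<^bsub>A\<^esub> a), inv\<^bsub>G\<^esub> g)"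
    have "\<phi> (inv\<^bsub>G\<^esub> g) (inv\<^bsub>A\<^esub> a) \<otimes>\<^bsub>A\<^esub> \<phi> (inv\<^bsub>G\<^esub> g) a = \<one>\<^bsub>A\<^esub>"
      using act(2)[of "inv\<^bsub>G\<^esub> g" "inv\<^bsub>A\<^esub> a" a] u one by simp
    then show "\<exists>v\<in>carrier (semidirect_product A G \<phi>).
        v \<otimes>\<^bsub>semidirect_product A G \<phi>\<^esub> u = \<one>\<^bsub>semidirect_product A G \<phi>\<^esub>"
      by (intro bexI[of _ v]) (use u act(1) in \<open>auto simp: semidirect_product_def v_def\<close>)
  qed (auto simp: semidirect_product_def act A.m_assoc G.m_assoc)
qed

locale permutation_groups =
  fixes m n :: nat and G H :: "(nat \<Rightarrow> nat) set"
  assumes n: "1 \<le> n" and G: "subgroup G (sym_group m)" and H: "subgroup H (sym_group n)"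
begin

abbreviation "\<Omega> \<equiv> {1..n} \<times> {1..m}"
abbreviation "G_grp \<equiv> sym_group m\<lparr>carrier := G\<rparr>"
abbreviation "H_grp \<equiv> sym_group n\<lparr>carrier := H\<rparr>"
abbreviation "W \<equiv> perm_wreath n m H G"

lemma G_permutes: "g \<in> G \<Longrightarrow> g permutes {1..m}"
  using subgroup.subset[OF G] by (auto simp: sym_group_def)

lemma H_permutes: "h \<in> H \<Longrightarrow> h permutes {1..n}"
  using subgroup.subset[OF H] by (auto simp: sym_group_def)

lemma G_id: "id \<in> G"
  using subgroup.one_closed[OF G] by (simp add: sym_group_def)

lemma H_id: "id \<in> H"
  using subgroup.one_closed[OF H] by (simp add: sym_group_def)

lemma G_in: "g \<in> G \<Longrightarrow> i \<in> {1..m} \<Longrightarrow> g i \<in> {1..m}"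
  using permutes_in_image[OF G_permutes] by blast

lemma H_in: "h \<in> H \<Longrightarrow> j \<in> {1..n} \<Longrightarrow> h j \<in> {1..n}"
  using permutes_in_image[OF H_permutes] by blast

lemma group_G: "group G_grp" and group_H: "group H_grp"
  using G H sym_group_is_group by (auto intro: subgroup.subgroup_is_group)

lemma G_inv:
  assumes g: "g \<in> G"
  shows "inv\<^bsub>G_grp\<^esub> g \<in> G" "(inv\<^bsub>G_grp\<^esub> g) (g i) = i" "g ((inv\<^bsub>G_grp\<^esub> g) i) = i"
proof -
  interpret group G_grp by (rule group_G)
  show "inv\<^bsub>G_grp\<^esub> g \<in> G" using inv_closed[of g] g by simp
  show "(inv\<^bsub>G_grp\<^esub> g) (g i) = i" "g ((inv\<^bsub>G_grp\<^esub> g) i) = i"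
    using l_inv[of g] r_inv[of g] g by (simp_all add: sym_group_def fun_eq_iff)
qed

lemma carrier_W: "carrier W = ({1..m} \<rightarrow>\<^sub>E H) \<times> G"
  by (simp add: perm_wreath_def wreath_product_def semidirect_product_def)

lemma mult_W: "(\<alpha>, g) \<otimes>\<^bsub>W\<^esub> (\<beta>, h) =
    ((\<lambda>i\<in>{1..m}. \<alpha> i \<circ> (\<lambda>i\<in>{1..m}. \<beta> ((inv\<^bsub>G_grp\<^esub> g) i)) i), g \<circ> h)"
  by (simp add: perm_wreath_def wreath_product_def semidirect_product_def sym_group_def)

lemma group_W: "group W"
  unfolding perm_wreath_def wreath_product_def
proof (rule group_semidirect_product[OF product_group[OF group_H] group_G])
  interpret G: group G_grp by (rule group_G)
  fix g h \<alpha> \<beta>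
  assume g: "g \<in> carrier G_grp" and \<alpha>: "\<alpha> \<in> carrier (product_group {1..m} (\<lambda>_. H_grp))"
  then have g': "g \<in> G" and \<alpha>': "\<alpha> \<in> {1..m} \<rightarrow>\<^sub>E H" by simp_all
  note ginv = G_in[OF G_inv(1)[OF g']]
  show "(\<lambda>i\<in>{1..m}. \<alpha> ((inv\<^bsub>G_grp\<^esub> g) i)) \<in> carrier (product_group {1..m} (\<lambda>_. H_grp))"
    using \<alpha>' ginv by (auto simp: PiE_iff simp del: atLeastAtMost_iff)
  show "(\<lambda>i\<in>{1..m}. (\<alpha> \<otimes>\<^bsub>product_group {1..m} (\<lambda>_. H_grp)\<^esub> \<beta>) ((inv\<^bsub>G_grp\<^esub> g) i)) =
      (\<lambda>i\<in>{1..m}. \<alpha> ((inv\<^bsub>G_grp\<^esub> g) i)) \<otimes>\<^bsub>product_group {1..m} (\<lambda>_. H_grp)\<^esub>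
      (\<lambda>i\<in>{1..m}. \<beta> ((inv\<^bsub>G_grp\<^esub> g) i))"
    using ginv by (auto simp: fun_eq_iff simp del: atLeastAtMost_iff)
  show "(\<lambda>i\<in>{1..m}. \<alpha> ((inv\<^bsub>G_grp\<^esub> (g \<otimes>\<^bsub>G_grp\<^esub> h)) i)) =
      (\<lambda>i\<in>{1..m}. (\<lambda>i\<in>{1..m}. \<alpha> ((inv\<^bsub>G_grp\<^esub> h) i)) ((inv\<^bsub>G_grp\<^esub> g) i))"
    if h: "h \<in> carrier G_grp"
  proof -
    have "inv\<^bsub>G_grp\<^esub> (g \<otimes>\<^bsub>G_grp\<^esub> h) = inv\<^bsub>G_grp\<^esub> h \<circ> inv\<^bsub>G_grp\<^esub> g"
      using G.inv_mult_group[OF g h] by (simp add: sym_group_def)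
    then show ?thesis using ginv by (auto simp: fun_eq_iff simp del: atLeastAtMost_iff)
  qed
next
  interpret G: group G_grp by (rule group_G)
  fix \<alpha> assume "\<alpha> \<in> carrier (product_group {1..m} (\<lambda>_. H_grp))"
  then have \<alpha>': "\<alpha> \<in> {1..m} \<rightarrow>\<^sub>E H" by simp
  have "inv\<^bsub>G_grp\<^esub> \<one>\<^bsub>G_grp\<^esub> = id" by (subst G.inv_one) (simp add: sym_group_def)
  then show "(\<lambda>i\<in>{1..m}. \<alpha> ((inv\<^bsub>G_grp\<^esub> \<one>\<^bsub>G_grp\<^esub>) i)) = \<alpha>"
    using \<alpha>' by (auto simp: fun_eq_iff PiE_iff extensional_def)
qed

lemma wreath_action_apply:
  "j \<in> {1..n} \<Longrightarrow> i \<in> {1..m} \<Longrightarrow> wreath_action n m (\<alpha>, g) (j, i) = (\<alpha> (g i) j, g i)"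
  by (simp add: wreath_action_def)

lemma wreath_action_in:
  assumes "w \<in> carrier W" "p \<in> \<Omega>"
  shows "wreath_action n m w p \<in> \<Omega>"
proof -
  obtain \<alpha> g j i where *: "w = (\<alpha>, g)" "p = (j, i)" by (metis prod.exhaust)
  then have "\<alpha> \<in> {1..m} \<rightarrow>\<^sub>E H" "g \<in> G" "j \<in> {1..n}" "i \<in> {1..m}"
    using assms by (simp_all add: carrier_W)
  moreover from this have "g i \<in> {1..m}" "\<alpha> (g i) \<in> H" using G_in by blast+
  ultimately show ?thesis using H_in by (simp add: * wreath_action_apply del: atLeastAtMost_iff)
qed

lemma wreath_action_mult:
  assumes "w \<in> carrier W" "w' \<in> carrier W" "p \<in> \<Omega>"
  shows "wreath_action n m (w \<otimes>\<^bsub>W\<^esub> w') p = wreath_action n m w (wreath_action n m w' p)"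
proof -
  obtain \<alpha> g \<beta> h j i where *: "w = (\<alpha>, g)" "w' = (\<beta>, h)" "p = (j, i)" by (metis prod.exhaust)
  then have w: "g \<in> G" "h \<in> G" "\<beta> \<in> {1..m} \<rightarrow>\<^sub>E H" "j \<in> {1..n}" "i \<in> {1..m}"
    using assms by (simp_all add: carrier_W)
  then have "h i \<in> {1..m}" "g (h i) \<in> {1..m}" "\<beta> (h i) j \<in> {1..n}"
    using G_in H_in by (blast intro: PiE_mem)+
  then show ?thesis
    using w by (simp add: * mult_W wreath_action_apply G_inv(2) del: atLeastAtMost_iff)
qed

text \<open>
  The second coordinate determines \<open>g\<close> as soon as a block has a position. Every \<open>i\<close> is of the form
  \<open>g i'\<close>, so the first coordinate then determines all components of \<open>\<alpha>\<close>.
\<close>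

lemma wreath_action_faithful:
  assumes w: "w \<in> carrier W" "w' \<in> carrier W"
    and eq: "\<And>p. p \<in> \<Omega> \<Longrightarrow> wreath_action n m w p = wreath_action n m w' p"
  shows "w = w'"
proof -
  obtain \<alpha> g \<beta> h where *: "w = (\<alpha>, g)" "w' = (\<beta>, h)" by (metis prod.exhaust)
  then have w': "g \<in> G" "h \<in> G" "\<alpha> \<in> {1..m} \<rightarrow>\<^sub>E H" "\<beta> \<in> {1..m} \<rightarrow>\<^sub>E H"
    using w by (simp_all add: carrier_W)
  have eq': "\<alpha> (g i) j = \<beta> (h i) j \<and> g i = h i" if "i \<in> {1..m}" "j \<in> {1..n}" for i j
    using eq[of "(j, i)"] that unfolding * wreath_action_apply[OF that(2,1)] prod.inject by blast
  have "g = h"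
  proof
    fix i show "g i = h i"
    proof (cases "i \<in> {1..m}")
      case True
      then show ?thesis using eq'[of i 1] n by simp
    next
      case False
      then show ?thesis using permutes_not_in[OF G_permutes] w' by metis
    qed
  qed
  moreover have "\<alpha> = \<beta>"
  proof (rule PiE_ext[OF w'(3,4)])
    fix i assume i: "i \<in> {1..m}"
    define i' where "i' = (inv\<^bsub>G_grp\<^esub> g) i"
    have i': "i' \<in> {1..m}" "g i' = i"
      using G_in[OF G_inv(1)[OF w'(1)] i] G_inv(3)[OF w'(1)] by (simp_all add: i'_def)
    have \<alpha>\<beta>: "\<alpha> i permutes {1..n}" "\<beta> i permutes {1..n}"
      using H_permutes PiE_mem[OF w'(3) i] PiE_mem[OF w'(4) i] by blast+
    show "\<alpha> i = \<beta> i"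
    proof
      fix j show "\<alpha> i j = \<beta> i j"
      proof (cases "j \<in> {1..n}")
        case True
        then show ?thesis using eq'[OF i'(1) True] i'(2) by metis
      next
        case False
        then show ?thesis
          using permutes_not_in[OF \<alpha>\<beta>(1)] permutes_not_in[OF \<alpha>\<beta>(2)] by metis
      qed
    qed
  qed
  ultimately show ?thesis by (simp add: *)
qed

lemma wreath_action_Bij:
  assumes w: "w \<in> carrier W"
  shows "wreath_action n m w \<in> Bij \<Omega>"
proof -
  interpret W: group W by (rule group_W)
  have one: "wreath_action n m \<one>\<^bsub>W\<^esub> p = p" if "p \<in> \<Omega>" for p
    using that by (auto simp: perm_wreath_def wreath_product_def semidirect_product_def sym_group_def
        wreath_action_def)
  have "bij_betw (wreath_action n m w) \<Omega> \<Omega>"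
  proof (rule bij_betw_byWitness[where f' = "wreath_action n m (inv\<^bsub>W\<^esub> w)"])
    show "\<forall>p\<in>\<Omega>. wreath_action n m (inv\<^bsub>W\<^esub> w) (wreath_action n m w p) = p"
      using wreath_action_mult[OF W.inv_closed[OF w] w] one by (simp add: W.l_inv[OF w])
    show "\<forall>p\<in>\<Omega>. wreath_action n m w (wreath_action n m (inv\<^bsub>W\<^esub> w) p) = p"
      using wreath_action_mult[OF w W.inv_closed[OF w]] one by (simp add: W.r_inv[OF w])
  qed (use wreath_action_in w W.inv_closed[OF w] in blast)+
  moreover have "wreath_action n m w \<in> extensional \<Omega>"
    by (cases w) (simp add: wreath_action_def)
  ultimately show ?thesis by (simp add: Bij_def)
qed

lemma faithful_wreath_action: "faithful_action W \<Omega> (wreath_action n m)"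
proof -
  have "wreath_action n m \<in> hom W (BijGroup \<Omega>)"
  proof (rule homI)
    fix w w' assume w: "w \<in> carrier W" "w' \<in> carrier W"
    interpret W: group W by (rule group_W)
    have "wreath_action n m (w \<otimes>\<^bsub>W\<^esub> w') = compose \<Omega> (wreath_action n m w) (wreath_action n m w')"
      by (rule extensionalityI[of _ \<Omega>])
         (use w wreath_action_Bij[OF W.m_closed[OF w]] wreath_action_mult[OF w] in
           \<open>auto simp: Bij_def compose_eq\<close>)
    then show "wreath_action n m (w \<otimes>\<^bsub>W\<^esub> w') =
        wreath_action n m w \<otimes>\<^bsub>BijGroup \<Omega>\<^esub> wreath_action n m w'"
      using w wreath_action_Bij by (simp add: BijGroup_def)
  qed (use wreath_action_Bij in \<open>simp add: BijGroup_def\<close>)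
  then have "group_action W \<Omega> (wreath_action n m)"
    using group_W group_BijGroup by (simp add: group_action_def group_hom_def group_hom_axioms_def)
  moreover have "inj_on (wreath_action n m) (carrier W)"
    by (rule inj_onI) (rule wreath_action_faithful, simp_all)
  ultimately show ?thesis by (simp add: faithful_action_def faithful_action_axioms_def)
qed

end

locale permutation_groups_numbered = permutation_groups +
  fixes e :: "nat \<times> nat \<Rightarrow> nat"
  assumes e: "bij_betw e ({1..n} \<times> {1..m}) {1..m * n}"
begin

abbreviation "P \<equiv> wreath_perm e n m ` carrier W"

lemma wreath_perm_e: "p \<in> \<Omega> \<Longrightarrow> wreath_perm e n m w (e p) = e (wreath_action n m w p)"
  using bij_betw_apply[OF e] inv_into_f_f[OF bij_betw_imp_inj_on[OF e]]
  by (simp add: wreath_perm_def del: atLeastAtMost_iff)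

lemma wreath_perm_outside: "l \<notin> {1..m * n} \<Longrightarrow> wreath_perm e n m w l = l"
  unfolding wreath_perm_def by (rule if_not_P)

lemma e_cases:
  assumes "l \<in> {1..m * n}"
  obtains p where "p \<in> \<Omega>" "l = e p"
  using assms bij_betw_imp_surj_on[OF e] by blast

lemma wreath_perm_permutes:
  assumes w: "w \<in> carrier W"
  shows "wreath_perm e n m w permutes {1..m * n}"
proof (rule bij_imp_permutes)
  have bij: "bij_betw (wreath_action n m w) \<Omega> \<Omega>"
    using wreath_action_Bij[OF w] by (simp add: Bij_def)
  have "bij_betw (e \<circ> wreath_action n m w \<circ> inv_into \<Omega> e) {1..m * n} {1..m * n}"
    by (rule bij_betw_trans[OF bij_betw_inv_into[OF e] bij_betw_trans[OF bij e]])
  then show "bij_betw (wreath_perm e n m w) {1..m * n} {1..m * n}"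
    by (rule bij_betw_cong[THEN iffD1, rotated]) (simp add: wreath_perm_def)
qed (rule wreath_perm_outside)

lemma wreath_perm_mon: "wreath_perm e n m \<in> mon W (sym_group (m * n))"
proof -
  interpret W: group W by (rule group_W)
  have "wreath_perm e n m \<in> hom W (sym_group (m * n))"
  proof (rule homI)
    fix w w' assume w: "w \<in> carrier W" "w' \<in> carrier W"
    have "wreath_perm e n m (w \<otimes>\<^bsub>W\<^esub> w') = wreath_perm e n m w \<circ> wreath_perm e n m w'"
    proof
      fix l show "wreath_perm e n m (w \<otimes>\<^bsub>W\<^esub> w') l = (wreath_perm e n m w \<circ> wreath_perm e n m w') l"
      proof (cases "l \<in> {1..m * n}")
        case True
        then obtain p where "p \<in> \<Omega>" "l = e p" by (rule e_cases)
        then show ?thesis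
          using wreath_action_mult[OF w] wreath_action_in[OF w(2)]
          by (simp add: wreath_perm_e del: mem_Sigma_iff)
      qed (simp add: wreath_perm_outside del: atLeastAtMost_iff)
    qed
    then show "wreath_perm e n m (w \<otimes>\<^bsub>W\<^esub> w') =
        wreath_perm e n m w \<otimes>\<^bsub>sym_group (m * n)\<^esub> wreath_perm e n m w'"
      by (simp add: sym_group_def)
  qed (use wreath_perm_permutes in \<open>simp add: sym_group_def\<close>)
  moreover have "inj_on (wreath_perm e n m) (carrier W)"
  proof (rule inj_onI, rule wreath_action_faithful)
    fix w w' p assume w: "w \<in> carrier W" "w' \<in> carrier W" and p: "p \<in> \<Omega>"
      and eq: "wreath_perm e n m w = wreath_perm e n m w'"
    have "e (wreath_action n m w p) = e (wreath_action n m w' p)"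
      using wreath_perm_e[OF p] eq by metis
    then show "wreath_action n m w p = wreath_action n m w' p"
      using wreath_action_in p w by (intro inj_onD[OF bij_betw_imp_inj_on[OF e]]) blast+
  qed
  ultimately show ?thesis by (simp add: mon_def)
qed

lemma subgroup_P: "subgroup P (sym_group (m * n))"
proof -
  have "group_hom W (sym_group (m * n)) (wreath_perm e n m)"
    using group_W sym_group_is_group wreath_perm_mon
    by (simp add: group_hom_def group_hom_axioms_def mon_def)
  then show ?thesis by (rule group_hom.img_is_subgroup)
qed

lemma P_form:
  assumes "\<sigma> \<in> P"
  shows "\<exists>g\<in>G. \<exists>\<alpha>\<in>{1..m} \<rightarrow> H. \<forall>i\<in>{1..m}. \<forall>j\<in>{1..n}. \<sigma> (e (j, i)) = e (\<alpha> (g i) j, g i)"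
proof -
  obtain w where "w \<in> carrier W" "\<sigma> = wreath_perm e n m w" using assms by blast
  then obtain \<alpha> g where w: "\<sigma> = wreath_perm e n m (\<alpha>, g)" "\<alpha> \<in> {1..m} \<rightarrow>\<^sub>E H" "g \<in> G"
    by (cases w) (simp add: carrier_W)
  show ?thesis
  proof (intro bexI ballI)
    show "\<sigma> (e (j, i)) = e (\<alpha> (g i) j, g i)" if "i \<in> {1..m}" "j \<in> {1..n}" for i j
      unfolding w(1) using that wreath_perm_e[of "(j, i)" "(\<alpha>, g)"] wreath_action_apply[OF that(2,1)]
      by simp
  qed (use w in auto)
qed

lemma P_contains:
  assumes "g \<in> G" "\<And>i. i \<in> {1..m} \<Longrightarrow> \<alpha> i \<in> H"
  shows "\<exists>\<sigma>\<in>P. \<forall>i\<in>{1..m}. \<forall>j\<in>{1..n}. \<sigma> (e (j, i)) = e (\<alpha> (g i) j, g i)"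
proof (intro bexI ballI)
  let ?w = "(\<lambda>i\<in>{1..m}. \<alpha> i, g)"
  have "?w \<in> carrier W" unfolding carrier_W using assms by auto
  then show "wreath_perm e n m ?w \<in> P" by (rule imageI)
  fix i j assume ij: "i \<in> {1..m}" "j \<in> {1..n}"
  then show "wreath_perm e n m ?w (e (j, i)) = e (\<alpha> (g i) j, g i)"
    using wreath_perm_e[of "(j, i)" ?w] wreath_action_apply[OF ij(2,1)] G_in[OF assms(1) ij(1)]
    by simp
qed

end

section \<open>Transcendence bases of fixed fields\<close>

lemma gen_field_finite_support:
  assumes "a \<in> gen_field (k \<union> B)"
  obtains B' where "finite B'" "B' \<subseteq> B" "a \<in> gen_field (k \<union> B')"
proof -
  define F where "F = {a. \<exists>B'. finite B' \<and> B' \<subseteq> B \<and> a \<in> gen_field (k \<union> B')}"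
  note gen = is_subfieldD[OF is_subfield_gen_field]
  have F: "a \<in> F" if "finite B'" "B' \<subseteq> B" "a \<in> gen_field (k \<union> B')" for a B'
    using that unfolding F_def by blast
  have "is_subfield F"
    unfolding is_subfield_def
  proof (intro conjI ballI)
    show "1 \<in> F" by (rule F[of "{}"]) (auto intro: gen)
  next
    fix a b assume "a \<in> F" "b \<in> F"
    then obtain A' B' where *: "finite A'" "A' \<subseteq> B" "a \<in> gen_field (k \<union> A')"
        "finite B'" "B' \<subseteq> B" "b \<in> gen_field (k \<union> B')" unfolding F_def by blast
    then have "a \<in> gen_field (k \<union> (A' \<union> B'))" "b \<in> gen_field (k \<union> (A' \<union> B'))"
      using gen_field_mono[of "k \<union> A'" "k \<union> (A' \<union> B')"] gen_field_mono[of "k \<union> B'" "k \<union> (A' \<union> B')"]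
      by auto
    then show "a + b \<in> F" "a * b \<in> F"
      using * by (auto intro!: F[of "A' \<union> B'"] gen)
  next
    fix a assume "a \<in> F"
    then obtain A' where *: "finite A'" "A' \<subseteq> B" "a \<in> gen_field (k \<union> A')" unfolding F_def by blast
    show "- a \<in> F" by (rule F[OF *(1,2) gen(5)[OF *(3)]])
    show "inverse a \<in> F" by (rule F[OF *(1,2) gen(7)[OF *(3)]])
  qed
  moreover have "k \<union> B \<subseteq> F"
  proof
    fix b assume "b \<in> k \<union> B"
    then show "b \<in> F"
      by (intro F[of "{b} \<inter> B"] subsetD[OF gen_field_incl]) auto
  qed
  ultimately have "a \<in> F" using gen_field_least assms by blast
  then show ?thesis unfolding F_def using that by blast
qed

text \<open>
  The definition of rationality allows the finite generating set and the algebraically independent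
  generating set to be unrelated. Each of the finitely many generators involves only finitely many
  basis elements, and these already form a basis.
\<close>

lemma rational_ext_finite_basis:
  assumes c: "field_hom c" and L: "rational_ext c L"
  obtains B where "finite B" "indep (range c) B (\<lambda>b. b)" "L = gen_field (range c \<union> B)"
proof -
  obtain S where S: "finite S" "L = gen_field (range c \<union> S)"
    using L by (auto simp: rational_ext_def finitely_generated_ext_def field_adjoin_def)
  obtain B where B: "indep (range c) B (\<lambda>b. b)" "L = gen_field (range c \<union> B)"
    using L by (auto simp: rational_ext_def purely_transcendental_def field_adjoin_def
        algebraically_independent_iff_indep[OF c])
  have "\<forall>s\<in>S. \<exists>B'. finite B' \<and> B' \<subseteq> B \<and> s \<in> gen_field (range c \<union> B')"
  proof
    fix s assume "s \<in> S"
    then have "s \<in> gen_field (range c \<union> B)"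
      using gen_field_incl[of "range c \<union> S"] S B by auto
    then show "\<exists>B'. finite B' \<and> B' \<subseteq> B \<and> s \<in> gen_field (range c \<union> B')"
      by (rule gen_field_finite_support) blast
  qed
  from bchoice[OF this] obtain f where
    f: "\<forall>s\<in>S. finite (f s) \<and> f s \<subseteq> B \<and> s \<in> gen_field (range c \<union> f s)" ..
  let ?B = "\<Union>s\<in>S. f s"
  have sub: "?B \<subseteq> B" using f by blast
  have "s \<in> gen_field (range c \<union> ?B)" if "s \<in> S" for s
    using f that gen_field_mono[of "range c \<union> f s" "range c \<union> ?B"] by blast
  then have "L \<subseteq> gen_field (range c \<union> ?B)"
    unfolding S(2) using gen_field_incl[of "range c \<union> ?B"] by (intro gen_field_subset) auto
  moreover have "gen_field (range c \<union> ?B) \<subseteq> L"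
    unfolding B(2) using sub by (intro gen_field_mono) auto
  ultimately have "L = gen_field (range c \<union> ?B)" by (rule antisym)
  moreover have "finite ?B" using S(1) f by blast
  ultimately show ?thesis using indep_mono[OF B(1) sub] that by blast
qed

lemma rational_extI:
  assumes "field_hom c" "finite B" "indep (range c) B (\<lambda>b. b)" "L = gen_field (range c \<union> B)"
  shows "rational_ext c L"
  using assms
  by (auto simp: rational_ext_def finitely_generated_ext_def purely_transcendental_def field_adjoin_def
      algebraically_independent_iff_indep)

lemma indep_not_in_base:
  assumes L: "is_subfield L" and V: "indep L V x" and i: "i \<in> V"
  shows "x i \<notin> L"
proof
  assume xi: "x i \<in> L"
  let ?s = "Poly_Mapping.single i (1::nat)"
  have ne: "?s \<noteq> 0" by (metis keys_single keys_zero insert_not_empty one_neq_zero)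
  define a where "a t = (if t = ?s then 1 else - x i)" for t
  have "a ?s = 0"
  proof (rule indepD[OF V])
    show "finite {?s, 0}" "?s \<in> {?s, 0}" "{?s, 0} \<subseteq> exps V"
      using i by (auto intro: exps_single)
    show "a t \<in> L" for t using is_subfieldD(1,5)[OF L] xi by (auto simp: a_def)
    show "(\<Sum>t\<in>{?s, 0}. a t * monom_eval x t) = 0"
      using ne by (simp add: a_def)
  qed
  then show False by (simp add: a_def)
qed

lemma field_hom_indep:
  assumes \<phi>: "field_hom \<phi>" "\<And>a. a \<in> L \<Longrightarrow> \<phi> a = a" and V: "indep L V x"
  shows "indep L V (\<lambda>i. \<phi> (x i))"
proof (rule indepI)
  interpret field_hom \<phi> by (rule \<phi>)
  fix T a t assume T: "finite T" "T \<subseteq> exps V" "\<And>t. t \<in> T \<Longrightarrow> a t \<in> L"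
    and 0: "(\<Sum>t\<in>T. a t * monom_eval (\<lambda>i. \<phi> (x i)) t) = 0" and t: "t \<in> T"
  have "\<phi> (\<Sum>t\<in>T. a t * monom_eval x t) = 0"
    unfolding c_sum c_mult c_monom_eval 0[symmetric]
    by (intro sum.cong refl) (simp add: \<phi>(2) T(3))
  then show "a t = 0"
    unfolding c_eq_0_iff by (intro indepD[OF V T(1,2,3) _ t])
qed

lemma is_subfield_fixed_field:
  assumes "\<And>\<sigma>. \<sigma> \<in> P \<Longrightarrow> bij \<sigma>"
  shows "is_subfield (fixed_field N P :: 'k::field rat_fun set)"
proof -
  have "is_subfield {f :: 'k rat_fun. perm_rat_fun \<sigma> f = f}" if "\<sigma> \<in> P" for \<sigma>
  proof -
    interpret field_hom "perm_rat_fun \<sigma> :: 'k rat_fun \<Rightarrow> _"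
      by (rule field_hom_perm_rat_fun[OF assms[OF that]])
    show ?thesis by (simp add: is_subfield_def c_1 c_add c_mult c_minus c_inverse)
  qed
  moreover have "is_subfield (rat_fun_field N :: 'k rat_fun set)"
    by (simp add: rat_fun_field_def field_adjoin_def is_subfield_gen_field)
  ultimately show ?thesis
    unfolding is_subfield_def fixed_field_def by blast
qed

lemma inj_rat_var: "inj (rat_var :: nat \<Rightarrow> 'k::field rat_fun)"
  by (rule indep_inj_on[OF is_subfield_rat_consts indep_rat_var])

text \<open>The sum of the variables is fixed, and it is not a constant.\<close>

lemma fixed_field_not_constant:
  assumes "1 \<le> n" and P: "\<And>\<sigma>. \<sigma> \<in> P \<Longrightarrow> \<sigma> permutes {1..n}"
  shows "\<not> fixed_field n P \<subseteq> (rat_consts :: 'k::field rat_fun set)"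
proof
  assume sub: "fixed_field n P \<subseteq> (rat_consts :: 'k rat_fun set)"
  let ?s = "\<Sum>j\<in>{1..n}. rat_var j :: 'k rat_fun"
  let ?L = "gen_field (rat_consts \<union> rat_var ` ({1..n} - {1})) :: 'k rat_fun set"
  have "?s \<in> rat_fun_field n"
    unfolding rat_fun_field_def field_adjoin_def
    by (intro is_subfield_sum[OF is_subfield_gen_field] subsetD[OF gen_field_incl]) auto
  moreover have "perm_rat_fun \<sigma> ?s = ?s" if "\<sigma> \<in> P" for \<sigma>
  proof -
    interpret field_hom "perm_rat_fun \<sigma> :: 'k rat_fun \<Rightarrow> _"
      by (rule field_hom_perm_rat_fun[OF permutes_bij[OF P[OF that]]])
    show ?thesis
      unfolding c_sum perm_rat_fun_hom(2)[OF permutes_bij[OF P[OF that]]]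
      using sum.permute[OF P[OF that], of "rat_var :: nat \<Rightarrow> 'k rat_fun"] by (simp add: o_def)
  qed
  ultimately have "?s \<in> rat_consts" using sub by (auto simp: fixed_field_def)
  then have "?s \<in> ?L" by (intro subsetD[OF gen_field_incl] UnI1)
  moreover have "(\<Sum>j\<in>{1..n} - {1}. rat_var j) \<in> ?L"
    by (intro is_subfield_sum[OF is_subfield_gen_field] subsetD[OF gen_field_incl]) auto
  ultimately have diff: "?s - (\<Sum>j\<in>{1..n} - {1}. rat_var j) \<in> ?L"
    by (rule is_subfieldD(6)[OF is_subfield_gen_field])
  have "?s = rat_var 1 + (\<Sum>j\<in>{1..n} - {1}. rat_var j)"
    using \<open>1 \<le> n\<close> by (intro sum.remove) auto
  then have "?s - (\<Sum>j\<in>{1..n} - {1}. rat_var j) = rat_var 1"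
    by (metis add_diff_cancel_right')
  with diff have "rat_var 1 \<in> ?L" by (simp only:)
  moreover have "indep ?L {1} rat_var"
    by (rule indep_over_gen_field[OF is_subfield_rat_consts indep_mono[OF indep_rat_var]]) auto
  then have "rat_var 1 \<notin> ?L"
    by (rule indep_not_in_base[OF is_subfield_gen_field]) simp
  ultimately show False by (rule notE[rotated])
qed

section \<open>Rationality of the fixed field of a wreath product\<close>

text \<open>
  What the argument uses of the permutations induced by the wreath product: every one has wreath
  form, and both \<open>G\<close> and the copy of \<open>H\<close> in each single block occur among them.
\<close>

locale wreath_permutations =
  fixes m n :: nat and G H :: "(nat \<Rightarrow> nat) set" and e :: "nat \<times> nat \<Rightarrow> nat"
    and P :: "(nat \<Rightarrow> nat) set"
  assumes n: "1 \<le> n"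
    and G: "\<And>g. g \<in> G \<Longrightarrow> g permutes {1..m}"
    and H: "\<And>h. h \<in> H \<Longrightarrow> h permutes {1..n}"
    and e: "bij_betw e ({1..n} \<times> {1..m}) {1..m * n}"
    and P: "\<And>\<sigma>. \<sigma> \<in> P \<Longrightarrow> \<sigma> permutes {1..m * n}"
    and P_id: "id \<in> P"
    and P_comp: "\<And>\<sigma> \<tau>. \<sigma> \<in> P \<Longrightarrow> \<tau> \<in> P \<Longrightarrow> \<sigma> \<circ> \<tau> \<in> P"
    and P_wreath: "\<And>\<sigma>. \<sigma> \<in> P \<Longrightarrow> \<exists>g\<in>G. \<exists>\<alpha>\<in>{1..m} \<rightarrow> H.
      \<forall>i\<in>{1..m}. \<forall>j\<in>{1..n}. \<sigma> (e (j, i)) = e (\<alpha> (g i) j, g i)"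
    and P_G: "\<And>g. g \<in> G \<Longrightarrow> \<exists>\<sigma>\<in>P. \<forall>i\<in>{1..m}. \<forall>j\<in>{1..n}. \<sigma> (e (j, i)) = e (j, g i)"
    and P_H: "\<And>h i0. h \<in> H \<Longrightarrow> i0 \<in> {1..m} \<Longrightarrow> \<exists>\<sigma>\<in>P. \<forall>i\<in>{1..m}. \<forall>j\<in>{1..n}.
      \<sigma> (e (j, i)) = e (if i = i0 then h j else j, i)"
begin

lemma e_in: "i \<in> {1..m} \<Longrightarrow> j \<in> {1..n} \<Longrightarrow> e (j, i) \<in> {1..m * n}"
  using bij_betw_apply[OF e, of "(j, i)"] by simp

lemma e_eq_iff:
  "i \<in> {1..m} \<Longrightarrow> j \<in> {1..n} \<Longrightarrow> i' \<in> {1..m} \<Longrightarrow> j' \<in> {1..n} \<Longrightarrow>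
     e (j, i) = e (j', i') \<longleftrightarrow> j = j' \<and> i = i'"
  using inj_on_eq_iff[OF bij_betw_imp_inj_on[OF e], of "(j, i)" "(j', i')"] by simp

lemma finite_P: "finite P"
  using finite_subset[of P "{\<sigma>. \<sigma> permutes {1..m * n}}"] P by (auto simp: finite_permutations)

lemma bij_P: "\<sigma> \<in> P \<Longrightarrow> bij \<sigma>"
  using P permutes_bij by blast

end

text \<open>
  \<open>\<phi> i\<close> for \<open>i \<ge> 1\<close> embeds the functions of \<open>n\<close> variables as functions of block \<open>i\<close>. The index \<open>0\<close>, with
  the identity as \<open>\<phi> 0\<close>, accounts for the variables outside all blocks. They are carried along
  because \<open>substitution_hom\<close> asks for an independent family with all natural numbers as indices.
\<close>

locale wreath_block_maps = wreath_permutations +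
  fixes \<phi> :: "nat \<Rightarrow> 'k::field rat_fun \<Rightarrow> 'k rat_fun" and B :: "'k rat_fun set"
  assumes \<phi>: "\<And>i. field_hom (\<phi> i)" and \<phi>_const: "\<And>i a. \<phi> i (rat_const a) = rat_const a"
    and \<phi>_0: "\<And>f. \<phi> 0 f = f"
    and \<phi>_var: "\<And>i j. i \<in> {1..m} \<Longrightarrow> j \<in> {1..n} \<Longrightarrow> \<phi> i (rat_var j) = rat_var (e (j, i))"
    and B: "indep rat_consts B (\<lambda>b. b)" "fixed_field n H = gen_field (rat_consts \<union> B)" "finite B"
begin

abbreviation "k \<equiv> rat_consts :: 'k rat_fun set"
abbreviation "Y \<equiv> rat_var ` {1..n} :: 'k rat_fun set"

definition copy :: "nat \<times> 'k rat_fun \<Rightarrow> 'k rat_fun" where "copy = (\<lambda>(i, b). \<phi> i b)"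

lemma copy_simp [simp]: "copy (i, b) = \<phi> i b"
  by (simp add: copy_def)

lemma copy_block: "copy ` ({i} \<times> A) = \<phi> i ` A"
  by (auto simp: copy_def image_def)

text \<open>
  The generators used for block \<open>i\<close> when the blocks in \<open>S\<close> have already been reduced to their
  fixed fields: basis elements for these, variables for the others.
\<close>

definition block_gens :: "nat set \<Rightarrow> nat \<Rightarrow> 'k rat_fun set" where
  "block_gens S i = (if i = 0 then rat_var ` (- {1..m * n}) else if i \<in> S then B else Y)"

lemma B_fixed: "B \<subseteq> fixed_field n H"
  unfolding B(2) using gen_field_incl[of "k \<union> B"] by simp

lemma B_in: "B \<subseteq> gen_field (k \<union> Y)"
  using B_fixed by (auto simp: fixed_field_def rat_fun_field_def field_adjoin_def)

lemma \<phi>_gen: "\<phi> i ` gen_field (k \<union> A) = gen_field (k \<union> \<phi> i ` A)"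
proof -
  interpret field_hom "\<phi> i" by (rule \<phi>)
  show ?thesis by (simp add: image_gen_field image_Un image_image \<phi>_const)
qed

lemma perm_\<phi>:
  assumes \<sigma>: "\<sigma> \<in> P" and i: "i \<in> {1..m}" "i' \<in> {1..m}" and h: "h permutes {1..n}"
    and \<sigma>_e: "\<And>j. j \<in> {1..n} \<Longrightarrow> \<sigma> (e (j, i)) = e (h j, i')"
    and v: "v \<in> gen_field (k \<union> Y)"
  shows "perm_rat_fun \<sigma> (\<phi> i v) = \<phi> i' (perm_rat_fun h v)"
proof (rule field_homs_agree[OF _ _ _ v])
  show "field_hom (\<lambda>v. perm_rat_fun \<sigma> (\<phi> i v))"
    by (rule field_hom_compose[OF field_hom_perm_rat_fun[OF bij_P[OF \<sigma>]] \<phi>])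
  show "field_hom (\<lambda>v. \<phi> i' (perm_rat_fun h v))"
    by (rule field_hom_compose[OF \<phi> field_hom_perm_rat_fun[OF permutes_bij[OF h]]])
  fix a assume "a \<in> k \<union> Y"
  then show "perm_rat_fun \<sigma> (\<phi> i a) = \<phi> i' (perm_rat_fun h a)"
  proof
    assume "a \<in> Y"
    then obtain j where j: "j \<in> {1..n}" "a = rat_var j" by blast
    have "h j \<in> {1..n}" using j(1) permutes_in_image[OF h] by blast
    with j i show ?thesis
      by (simp add: perm_rat_fun_hom[OF bij_P[OF \<sigma>]] perm_rat_fun_hom[OF permutes_bij[OF h]] \<phi>_var \<sigma>_e)
  qed (auto simp: \<phi>_const perm_rat_fun_hom[OF bij_P[OF \<sigma>]] perm_rat_fun_hom[OF permutes_bij[OF h]])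
qed

text \<open>Elements of \<open>B\<close> are fixed by \<open>H\<close>, so only the permutation of the blocks remains visible on them.\<close>

lemma perm_\<phi>_B:
  assumes \<sigma>: "\<sigma> \<in> P" and g: "g \<in> G" and \<alpha>: "\<alpha> \<in> {1..m} \<rightarrow> H"
    and \<sigma>_e: "\<forall>i\<in>{1..m}. \<forall>j\<in>{1..n}. \<sigma> (e (j, i)) = e (\<alpha> (g i) j, g i)"
    and i: "i \<in> {1..m}" and b: "b \<in> B"
  shows "perm_rat_fun \<sigma> (\<phi> i b) = \<phi> (g i) b"
proof -
  have gi: "g i \<in> {1..m}" using i permutes_in_image[OF G[OF g]] by blast
  then have h: "\<alpha> (g i) \<in> H" using \<alpha> by blast
  have "perm_rat_fun \<sigma> (\<phi> i b) = \<phi> (g i) (perm_rat_fun (\<alpha> (g i)) b)"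
    by (rule perm_\<phi>[OF \<sigma> i gi H[OF h]]) (use \<sigma>_e i b B_in in auto)
  also have "perm_rat_fun (\<alpha> (g i)) b = b"
    using B_fixed b h by (auto simp: fixed_field_def)
  finally show ?thesis .
qed

lemma indep_B: "indep k ({i} \<times> B) copy"
proof (rule indep_reindex[OF is_subfield_rat_consts])
  show "indep k B (\<lambda>b. \<phi> i b)"
    by (rule field_hom_indep[OF \<phi> _ B(1)]) (auto simp: \<phi>_const)
  show "inj_on snd ({i} \<times> B)" by (auto simp: inj_on_def)
qed auto

lemma Sigma_split: "i \<in> I \<Longrightarrow> Sigma I A = {i} \<times> A i \<union> Sigma (I - {i}) A"
  by auto

lemma block_gens_insert: "i \<noteq> i' \<Longrightarrow> block_gens (insert i S) i' = block_gens S i'"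
  by (simp add: block_gens_def)

text \<open>
  By induction on \<open>S\<close>, exchanging the variables of one block for its basis. The generators of the
  other blocks are independent over the functions of this block, and these contain the basis.
\<close>

lemma indep_blocks:
  assumes "S \<subseteq> {1..m}"
  shows "indep k (Sigma {0..m} (block_gens S)) copy"
proof -
  have "finite S" using assms finite_subset by blast
  then show ?thesis using assms
  proof (induction S rule: finite_induct)
    case empty
    define \<rho> :: "'k rat_fun \<Rightarrow> nat" where "\<rho> = inv' rat_var"
    have \<rho>: "\<rho> (rat_var j) = j" for j
      unfolding \<rho>_def by (rule inv_f_f[OF inj_rat_var])
    define \<pi> where "\<pi> = (\<lambda>(i, b). if i = 0 then \<rho> b else e (\<rho> b, i))"
    show ?case
    proof (rule indep_reindex[OF is_subfield_rat_consts indep_rat_var, of \<pi>])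
      show "inj_on \<pi> (Sigma {0..m} (block_gens {}))"
      proof (rule inj_onI, clarify)
        fix i a i' a'
        assume *: "i \<in> {0..m}" "a \<in> block_gens {} i" "i' \<in> {0..m}" "a' \<in> block_gens {} i'" "\<pi> (i, a) = \<pi> (i', a')"
        obtain j j' where j: "a = rat_var j" "a' = rat_var j'"
          using *(2,4) by (auto simp: block_gens_def split: if_splits)
        have jn: "i \<noteq> 0 \<Longrightarrow> j \<in> {1..n}" "i = 0 \<Longrightarrow> j \<notin> {1..m * n}"
          using *(2) j by (auto simp: block_gens_def inj_eq[OF inj_rat_var])
        have jn': "i' \<noteq> 0 \<Longrightarrow> j' \<in> {1..n}" "i' = 0 \<Longrightarrow> j' \<notin> {1..m * n}"
          using *(4) j by (auto simp: block_gens_def inj_eq[OF inj_rat_var])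
        have im: "i \<noteq> 0 \<Longrightarrow> i \<in> {1..m}" "i' \<noteq> 0 \<Longrightarrow> i' \<in> {1..m}" using *(1,3) by auto
        have eq: "(if i = 0 then j else e (j, i)) = (if i' = 0 then j' else e (j', i'))"
          using *(5) unfolding \<pi>_def j prod.case \<rho> .
        show "i = i' \<and> a = a'"
        proof (cases "i = 0"; cases "i' = 0")
          assume "i \<noteq> 0" "i' \<noteq> 0"
          then show ?thesis using eq e_eq_iff[OF im(1) jn(1) im(2) jn'(1)] j by simp
        next
          assume "i = 0" "i' \<noteq> 0"
          then show ?thesis using eq e_in[OF im(2) jn'(1)] jn by simp
        next
          assume "i \<noteq> 0" "i' = 0"
          then show ?thesis using eq e_in[OF im(1) jn(1)] jn' by simp
        qed (use eq j in simp)
      qed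
      show "copy p = rat_var (\<pi> p)" if "p \<in> Sigma {0..m} (block_gens {})" for p
        using that by (auto simp: block_gens_def \<pi>_def \<phi>_0 \<phi>_var \<rho> split: if_splits)
    qed simp
  next
    case (insert i S)
    let ?X = "Sigma ({0..m} - {i}) (block_gens S)" and ?L = "gen_field (k \<union> \<phi> i ` Y)"
    have i: "i \<in> {1..m}" "i \<noteq> 0" "i \<in> {0..m}" using insert.prems by auto
    have Di: "block_gens S i = Y" "block_gens (insert i S) i = B" using i insert.hyps by (auto simp: block_gens_def)
    have X: "Sigma ({0..m} - {i}) (block_gens (insert i S)) = ?X"
      by (intro Sigma_cong refl) (simp add: block_gens_insert)
    have "indep k ({i} \<times> Y \<union> ?X) copy"
      using insert.IH insert.prems Sigma_split[OF i(3), of "block_gens S"] Di by simp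
    then have X_indep: "indep ?L ?X copy"
      using indep_over_gen_field[OF is_subfield_rat_consts, of "{i} \<times> Y" ?X copy] by (auto simp: copy_block)
    have "indep k ({i} \<times> B \<union> ?X) copy"
    proof (rule indep_Un[OF is_subfield_rat_consts is_subfield_gen_field _ indep_B _ X_indep])
      show "k \<subseteq> ?L" using gen_field_incl[of "k \<union> \<phi> i ` Y"] by simp
      show "copy ` ({i} \<times> B) \<subseteq> ?L" using B_in by (auto simp: copy_block simp flip: \<phi>_gen)
    qed auto
    then show ?case
      using Sigma_split[OF i(3), of "block_gens (insert i S)"] X Di by simp
  qed
qed

text \<open>
  By induction on \<open>S\<close>. The descent lemma is applied over the field \<open>?L\<close> of functions of the new block
  \<open>i\<close>, with the permutations \<open>Q\<close> that move no variable outside this block. They fix the generators of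
  all other blocks, and their fixed elements in \<open>?L\<close> are generated by the copy of \<open>B\<close>.
\<close>

lemma fixed_in_blocks:
  assumes f: "f \<in> rat_fun_field (m * n)" "\<And>\<sigma>. \<sigma> \<in> P \<Longrightarrow> perm_rat_fun \<sigma> f = f"
    and S: "S \<subseteq> {1..m}"
  shows "f \<in> gen_field (k \<union> copy ` Sigma {1..m} (block_gens S))"
proof -
  have "finite S" using S finite_subset by blast
  then show ?thesis using S
  proof (induction S rule: finite_induct)
    case empty
    have "rat_var ` {1..m * n} \<subseteq> copy ` Sigma {1..m} (block_gens {})"
    proof
      fix a :: "'k rat_fun" assume "a \<in> rat_var ` {1..m * n}"
      then obtain l where l: "l \<in> {1..m * n}" "a = rat_var l" by blast
      then obtain j i where ij: "j \<in> {1..n}" "i \<in> {1..m}" "l = e (j, i)"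
        using bij_betw_imp_surj_on[OF e] by blast
      then have "a = copy (i, rat_var j)" using l by (simp add: \<phi>_var)
      then show "a \<in> copy ` Sigma {1..m} (block_gens {})"
        using ij by (auto simp: block_gens_def intro!: image_eqI[of _ copy "(i, rat_var j)"])
    qed
    then show ?case
      using f(1) gen_field_mono[of "k \<union> rat_var ` {1..m * n}" "k \<union> copy ` Sigma {1..m} (block_gens {})"]
      by (auto simp: rat_fun_field_def field_adjoin_def)
  next
    case (insert i S)
    let ?V = "Sigma ({1..m} - {i}) (block_gens S)" and ?L = "gen_field (k \<union> \<phi> i ` Y)"
    have i: "i \<in> {1..m}" "i \<noteq> 0" "i \<in> {0..m}" using insert.prems by auto
    have Di: "block_gens S i = Y" "block_gens (insert i S) i = B" using i insert.hyps by (auto simp: block_gens_def)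
    have V: "Sigma ({1..m} - {i}) (block_gens (insert i S)) = ?V"
      by (intro Sigma_cong refl) (simp add: block_gens_insert)
    define Q where "Q = {\<sigma> \<in> P. \<forall>i'\<in>{1..m} - {i}. \<forall>j\<in>{1..n}. \<sigma> (e (j, i')) = e (j, i')}"
    define \<Gamma> where "\<Gamma> = (perm_rat_fun ` Q :: ('k rat_fun \<Rightarrow> 'k rat_fun) set)"
    have QP: "\<sigma> \<in> P" if "\<sigma> \<in> Q" for \<sigma> using that by (simp add: Q_def)
    have V_indep: "indep ?L ?V copy"
    proof -
      have sub: "{i} \<times> Y \<union> ?V \<subseteq> Sigma {0..m} (block_gens S)"
        using i Di by auto
      have "indep k ({i} \<times> Y \<union> ?V) copy"
        by (rule indep_mono[OF indep_blocks[of S] sub]) (use insert.prems in auto)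
      then show ?thesis
        using indep_over_gen_field[OF is_subfield_rat_consts, of "{i} \<times> Y" ?V copy] by (auto simp: copy_block)
    qed
    have Q: "\<forall>\<sigma>\<in>Q. bij \<sigma>" "id \<in> Q" "\<forall>\<sigma>\<in>Q. \<forall>\<tau>\<in>Q. \<sigma> \<circ> \<tau> \<in> Q"
      using bij_P P_id P_comp by (auto simp: Q_def)
    note \<Gamma>_hom = perm_rat_fun_image_monoid(1)[OF \<Gamma>_def Q]
      and \<Gamma>_const = perm_rat_fun_image_monoid(2)[OF \<Gamma>_def Q]
      and \<Gamma>_id = perm_rat_fun_image_monoid(3)[OF \<Gamma>_def Q]
      and \<Gamma>_comp = perm_rat_fun_image_monoid(4)[OF \<Gamma>_def Q]
    have \<Gamma>_L: "\<gamma> ` ?L \<subseteq> ?L" if \<gamma>: "\<gamma> \<in> \<Gamma>" for \<gamma>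
    proof -
      obtain \<sigma> where \<sigma>: "\<sigma> \<in> Q" "\<gamma> = perm_rat_fun \<sigma>" using \<gamma> by (auto simp: \<Gamma>_def)
      obtain g \<alpha> where g: "g \<in> G" "\<alpha> \<in> {1..m} \<rightarrow> H"
          "\<forall>i\<in>{1..m}. \<forall>j\<in>{1..n}. \<sigma> (e (j, i)) = e (\<alpha> (g i) j, g i)"
        using P_wreath[OF QP[OF \<sigma>(1)]] by blast
      have g_in: "g i' \<in> {1..m}" if "i' \<in> {1..m}" for i'
        using that permutes_in_image[OF G[OF g(1)]] by blast
      have \<alpha>_in: "\<alpha> (g i') j \<in> {1..n}" if "i' \<in> {1..m}" "j \<in> {1..n}" for i' j
        using that(2) g_in[OF that(1)] g(2) permutes_in_image[OF H] by blast
      \<comment> \<open>A position in block \<open>i'\<close> exists because of \<open>1 \<le> n\<close>, so a permutation that moves no variable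
        of block \<open>i'\<close> leaves the block in place. Then block \<open>i\<close> stays in place as well.\<close>
      have "g i' = i'" if "i' \<in> {1..m} - {i}" for i'
      proof -
        have i': "i' \<in> {1..m}" using that by simp
        have 1: "1 \<in> {1..n}" using n by simp
        have "e (\<alpha> (g i') 1, g i') = e (1, i')"
          using \<sigma>(1) that g(3)[rule_format, OF i' 1] 1 unfolding Q_def by auto
        then show ?thesis using e_eq_iff[OF g_in[OF i'] \<alpha>_in[OF i' 1] i' 1] by simp
      qed
      then have gi: "g i = i"
        using g_in[OF i(1)] permutes_inj[OF G[OF g(1)]] by (metis Diff_iff injD singletonD)
      have \<alpha>i: "\<alpha> i \<in> H" using g(2) i(1) by blast
      interpret field_hom \<gamma> by (rule \<Gamma>_hom[OF \<gamma>])
      have "\<gamma> ` (k \<union> \<phi> i ` Y) \<subseteq> k \<union> \<phi> i ` Y"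
      proof (intro image_subsetI)
        fix a assume "a \<in> k \<union> \<phi> i ` Y"
        then show "\<gamma> a \<in> k \<union> \<phi> i ` Y"
        proof
          assume "a \<in> \<phi> i ` Y"
          then obtain j where j: "j \<in> {1..n}" "a = \<phi> i (rat_var j)" by blast
          have "\<gamma> a = rat_var (e (\<alpha> i j, i))"
            using j g(3) i(1) gi
            by (simp add: \<sigma> \<phi>_var perm_rat_fun_hom[OF bij_P[OF QP[OF \<sigma>(1)]]])
          also have "\<dots> = \<phi> i (rat_var (\<alpha> i j))"
            using \<phi>_var[OF i(1)] \<alpha>_in[OF i(1) j(1)] gi by simp
          finally show ?thesis using \<alpha>_in[OF i(1) j(1)] gi by auto
        qed (auto simp: \<sigma> perm_rat_fun_hom[OF bij_P[OF QP[OF \<sigma>(1)]]])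
      qed
      then show ?thesis unfolding image_gen_field by (rule gen_field_mono)
    qed
    have \<Gamma>_V: "\<gamma> (copy p) = copy p" if \<gamma>: "\<gamma> \<in> \<Gamma>" "p \<in> ?V" for \<gamma> p
    proof -
      obtain \<sigma> where \<sigma>: "\<sigma> \<in> Q" "\<gamma> = perm_rat_fun \<sigma>" using \<gamma>(1) by (auto simp: \<Gamma>_def)
      obtain i' b where p: "p = (i', b)" "i' \<in> {1..m}" "i' \<noteq> i" "b \<in> block_gens S i'" using \<gamma>(2) by blast
      have "b \<in> gen_field (k \<union> Y)"
        using p(2,4) B_in gen_field_incl[of "k \<union> Y"] by (auto simp: block_gens_def split: if_splits)
      then have "perm_rat_fun \<sigma> (\<phi> i' b) = \<phi> i' (perm_rat_fun id b)"
        by (intro perm_\<phi>[OF QP[OF \<sigma>(1)]]) (use \<sigma>(1) p in \<open>auto simp: Q_def permutes_id\<close>)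
      then show ?thesis by (simp add: p \<sigma> perm_rat_fun_id)
    qed
    have \<Gamma>_fin: "finite \<Gamma>" unfolding \<Gamma>_def Q_def using finite_P by simp
    have split: "Sigma {1..m} (block_gens S) = {i} \<times> Y \<union> ?V" "Sigma {1..m} (block_gens (insert i S)) = {i} \<times> B \<union> ?V"
      using Sigma_split[OF i(1), of "block_gens S"] Sigma_split[OF i(1), of "block_gens (insert i S)"] Di V by simp_all
    have f_V: "f \<in> gen_field (?L \<union> copy ` ?V)"
      using insert.IH insert.prems unfolding split image_Un copy_block gen_field_Un_gen_field
      by (simp add: Un_assoc)
    have f_fixed: "\<gamma> f = f" if "\<gamma> \<in> \<Gamma>" for \<gamma>
      using that f(2) QP unfolding \<Gamma>_def by blast
    have "f \<in> gen_field ({a \<in> ?L. \<forall>\<gamma>\<in>\<Gamma>. \<gamma> a = a} \<union> copy ` ?V)"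
      by (rule fixed_field_of_adjoined_invariants[OF is_subfield_gen_field V_indep \<Gamma>_fin \<Gamma>_id];
          fact \<Gamma>_comp \<Gamma>_hom \<Gamma>_L \<Gamma>_V f_V f_fixed)
    moreover have "{a \<in> ?L. \<forall>\<gamma>\<in>\<Gamma>. \<gamma> a = a} \<subseteq> gen_field (k \<union> \<phi> i ` B)"
    proof
      fix u assume u: "u \<in> {a \<in> ?L. \<forall>\<gamma>\<in>\<Gamma>. \<gamma> a = a}"
      show "u \<in> gen_field (k \<union> \<phi> i ` B)"
      proof (rule fixed_elements_transfer[OF \<phi> \<phi>_const B(2), where \<Gamma> = \<Gamma>])
        show "bij h" if "h \<in> H" for h using permutes_bij[OF H[OF that]] .
        show "\<exists>\<gamma>\<in>\<Gamma>. \<forall>j\<in>{1..n}. \<gamma> (\<phi> i (rat_var j)) = \<phi> i (rat_var (h j))" if h: "h \<in> H" for h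
        proof -
          obtain \<sigma> where \<sigma>: "\<sigma> \<in> P"
              "\<forall>i'\<in>{1..m}. \<forall>j\<in>{1..n}. \<sigma> (e (j, i')) = e (if i' = i then h j else j, i')"
            using P_H[OF h i(1)] by blast
          then have "\<sigma> \<in> Q" by (auto simp: Q_def)
          moreover have "perm_rat_fun \<sigma> (\<phi> i (rat_var j)) = \<phi> i (rat_var (h j))" if "j \<in> {1..n}" for j
          proof -
            have "h j \<in> {1..n}" using that permutes_in_image[OF H[OF h]] by blast
            then show ?thesis
              using \<sigma> i(1) that by (simp add: \<phi>_var perm_rat_fun_hom[OF bij_P])
          qed
          ultimately show ?thesis unfolding \<Gamma>_def by blast
        qed
      qed (use u \<Gamma>_hom \<Gamma>_const in auto)
    qed
    ultimately have "f \<in> gen_field (gen_field (k \<union> \<phi> i ` B) \<union> copy ` ?V)"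
      using gen_field_mono[of "{a \<in> ?L. \<forall>\<gamma>\<in>\<Gamma>. \<gamma> a = a} \<union> copy ` ?V" "gen_field (k \<union> \<phi> i ` B) \<union> copy ` ?V"]
      by blast
    then show ?case
      unfolding split image_Un copy_block gen_field_Un_gen_field by (simp add: Un_assoc)
  qed
qed

end

context wreath_block_maps
begin

lemma block_in_rat_fun_field:
  assumes "i \<in> {1..m}"
  shows "\<phi> i ` gen_field (k \<union> Y) \<subseteq> rat_fun_field (m * n)"
proof -
  have "\<phi> i ` Y \<subseteq> rat_var ` {1..m * n}"
    using assms e_in by (auto simp: \<phi>_var simp del: atLeastAtMost_iff)
  then show ?thesis
    unfolding \<phi>_gen rat_fun_field_def field_adjoin_def by (intro gen_field_mono) auto
qed

lemma block_basis_in_rat_fun_field: "i \<in> {1..m} \<Longrightarrow> b \<in> B \<Longrightarrow> \<phi> i b \<in> rat_fun_field (m * n)"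
  using block_in_rat_fun_field B_in by blast

text \<open>
  With \<open>L = k(\<theta> i | i \<in> I)\<close>, the generators of the reduced blocks are exchanged for the twisted power
  sums \<open>W\<close>, and the descent lemma is applied over \<open>L\<close> to all permutations in \<open>P\<close>.
\<close>

lemma rational_fixed_field:
  assumes BG: "finite BG" "indep k BG (\<lambda>b. b)" "fixed_field m G = gen_field (k \<union> BG)"
  shows "rational_ext rat_const (fixed_field (m * n) P :: 'k rat_fun set)"
proof -
  have "B \<noteq> {}"
  proof
    assume "B = {}"
    then have "fixed_field n H \<subseteq> k"
      unfolding B(2) by (simp add: gen_field_idem is_subfield_rat_consts)
    then show False using fixed_field_not_constant[OF n, of H] H by blast
  qed
  then obtain b0 where b0: "b0 \<in> B" by blast
  define I where "I = {1..m}"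
  define B' where "B' = B - {b0}"
  define \<theta> where "\<theta> i = \<phi> i b0" for i
  define L where "L = gen_field (k \<union> \<theta> ` I)"
  have L: "is_subfield L" unfolding L_def by (rule is_subfield_gen_field)
  have kL: "k \<subseteq> L" and \<theta>L: "\<theta> ` I \<subseteq> L"
    using gen_field_incl[of "k \<union> \<theta> ` I"] by (auto simp: L_def)
  have I: "finite I" "card I = m" by (simp_all add: I_def)
  have all: "indep k (Sigma {0..m} (block_gens I)) copy"
    unfolding I_def by (rule indep_blocks) simp
  have block_gens: "Sigma {0..m} (block_gens I) = I \<times> B \<union> {0} \<times> rat_var ` (- {1..m * n})"
    unfolding I_def block_gens_def by (auto split: if_splits)
  have inj_\<theta>: "inj_on \<theta> I"
  proof (rule inj_onI)
    fix i i' assume *: "i \<in> I" "i' \<in> I" "\<theta> i = \<theta> i'"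
    have "copy (i, b0) = copy (i', b0)" using * by (simp add: \<theta>_def)
    then have "(i, b0) = (i', b0)"
      by (rule inj_onD[OF indep_inj_on[OF is_subfield_rat_consts all]]) (use * b0 block_gens in auto)
    then show "i = i'" by simp
  qed

  \<comment> \<open>The embedding that sends the variables of \<open>k(x)\<close> to the \<open>\<theta> i\<close>. The remaining variables go to
    variables with numbers beyond \<open>m * n\<close>, which keeps the family \<open>y\<close> independent.\<close>
  define y where "y i = (if i \<in> I then \<theta> i else rat_var (m * n + 1 + i))" for i
  have "indep k UNIV y"
  proof (rule indep_reindex[OF is_subfield_rat_consts all])
    define \<pi> where "\<pi> i = (if i \<in> I then (i, b0) else (0, rat_var (m * n + 1 + i) :: 'k rat_fun))" for i
    show "inj \<pi>"
      by (rule injI) (auto simp: \<pi>_def I_def inj_eq[OF inj_rat_var] split: if_splits)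
    show "range \<pi> \<subseteq> Sigma {0..m} (block_gens I)"
      unfolding block_gens using b0 by (auto simp: \<pi>_def)
    show "y i = copy (\<pi> i)" for i
      by (simp add: y_def \<pi>_def \<theta>_def \<phi>_0)
  qed
  then obtain \<psi> :: "'k rat_fun \<Rightarrow> 'k rat_fun" where \<psi>: "field_hom \<psi>"
      "\<And>a. \<psi> (rat_const a) = rat_const a" "\<And>i. \<psi> (rat_var i) = y i"
    by (rule substitution_hom[OF field_hom_rat_const]) blast
  have \<psi>_var: "\<psi> (rat_var i) = \<theta> i" if "i \<in> I" for i
    using that by (simp add: \<psi>(3) y_def)
  have \<psi>_gen: "\<psi> ` gen_field (k \<union> A) = gen_field (k \<union> \<psi> ` A)" for A
  proof -
    interpret field_hom \<psi> by (rule \<psi>)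
    show ?thesis by (simp add: image_gen_field image_Un image_image \<psi>(2))
  qed
  have \<psi>_vars: "\<psi> ` rat_var ` {1..m} = \<theta> ` I"
    unfolding image_image I_def[symmetric] by (rule image_cong[OF refl \<psi>_var])
  have BG_in: "BG \<subseteq> gen_field (k \<union> rat_var ` {1..m})" and BG_fixed: "BG \<subseteq> fixed_field m G"
    using gen_field_incl[of "k \<union> BG"] BG(3)
    by (auto simp: fixed_field_def rat_fun_field_def field_adjoin_def)
  have \<psi>BG_L: "\<psi> ` BG \<subseteq> L"
    using image_mono[OF BG_in, of \<psi>] unfolding \<psi>_gen \<psi>_vars L_def .

  \<comment> \<open>The Vandermonde change of variables over \<open>L\<close>, for each basis element other than \<open>b0\<close>.\<close>
  define W where "W = (\<lambda>(t, b). \<Sum>i\<in>I. \<theta> i ^ t * \<phi> i b)"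
  let ?V = "{..<m} \<times> B'"
  obtain C where C: "\<And>i t. i \<in> I \<Longrightarrow> C i t \<in> L"
      "\<And>i i'. i \<in> I \<Longrightarrow> i' \<in> I \<Longrightarrow> (\<Sum>t<card I. C i t * \<theta> i' ^ t) = (if i = i' then 1 else 0)"
      "\<And>t t'. t < card I \<Longrightarrow> t' < card I \<Longrightarrow> (\<Sum>i\<in>I. \<theta> i ^ t * C i t') = (if t = t' then 1 else 0)"
    by (rule Lagrange_coefficients[OF L I(1) inj_\<theta> \<theta>L]) blast
  have "indep k (I \<times> {b0} \<union> I \<times> B') copy"
    by (rule indep_mono[OF all]) (use b0 block_gens in \<open>auto simp: B'_def\<close>)
  then have "indep (gen_field (k \<union> copy ` (I \<times> {b0}))) (I \<times> B') copy"
    by (rule indep_over_gen_field[OF is_subfield_rat_consts]) (auto simp: B'_def)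
  moreover have copy_b0: "copy ` (I \<times> {b0}) = \<theta> ` I"
    by (auto simp: \<theta>_def image_def)
  ultimately have "indep L (I \<times> B') copy" by (simp add: L_def)
  then have "indep L ?V (\<lambda>(t, b). \<Sum>i\<in>I. \<theta> i ^ t * copy (i, b))"
    by (rule indep_linear_change[OF L _ I(1), where C = C])
       (use C I \<theta>L in \<open>auto intro: is_subfield_power[OF L]\<close>)
  then have W_indep: "indep L ?V W" by (simp add: W_def)
  have copy_W: "\<phi> i b = (\<Sum>t<m. C i t * W (t, b))" if i: "i \<in> I" for i b
  proof -
    have "(\<Sum>t<m. C i t * W (t, b)) = (\<Sum>t<m. \<Sum>i'\<in>I. C i t * \<theta> i' ^ t * \<phi> i' b)"
      by (simp add: W_def sum_distrib_left mult.assoc)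
    also have "\<dots> = (\<Sum>i'\<in>I. (\<Sum>t<m. C i t * \<theta> i' ^ t) * \<phi> i' b)"
      by (subst sum.swap) (simp add: sum_distrib_right)
    also have "\<dots> = (\<Sum>i'\<in>I. if i = i' then \<phi> i' b else 0)"
      by (intro sum.cong refl) (simp add: C(2)[OF i, unfolded I(2)])
    finally show ?thesis using i I by simp
  qed

  \<comment> \<open>A permutation in \<open>P\<close> acts on all these elements through its component in \<open>G\<close>.\<close>
  have perm_B: "\<exists>g\<in>G. \<forall>i\<in>I. \<forall>b\<in>B. perm_rat_fun \<sigma> (\<phi> i b) = \<phi> (g i) b" if \<sigma>: "\<sigma> \<in> P" for \<sigma>
  proof -
    obtain g \<alpha> where g: "g \<in> G" "\<alpha> \<in> {1..m} \<rightarrow> H"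
        "\<forall>i\<in>{1..m}. \<forall>j\<in>{1..n}. \<sigma> (e (j, i)) = e (\<alpha> (g i) j, g i)"
      using P_wreath[OF \<sigma>] by blast
    show ?thesis
      by (intro bexI[OF _ g(1)] ballI perm_\<phi>_B[OF \<sigma> g]) (simp_all add: I_def)
  qed
  have perm_const: "perm_rat_fun \<sigma> (rat_const a) = rat_const a" if "\<sigma> \<in> P" for \<sigma> and a :: 'k
    by (rule perm_rat_fun_hom(1)[OF bij_P[OF that]])
  have g_I: "g i \<in> I" if "g \<in> G" "i \<in> I" for g i
    using that permutes_in_image[OF G] unfolding I_def by blast
  have perm_W: "perm_rat_fun \<sigma> (W (t, b)) = W (t, b)" if \<sigma>: "\<sigma> \<in> P" and b: "b \<in> B" for \<sigma> t b
  proof -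
    interpret field_hom "perm_rat_fun \<sigma> :: 'k rat_fun \<Rightarrow> _"
      by (rule field_hom_perm_rat_fun[OF bij_P[OF \<sigma>]])
    obtain g where g: "g \<in> G" "\<forall>i\<in>I. \<forall>b\<in>B. perm_rat_fun \<sigma> (\<phi> i b) = \<phi> (g i) b"
      using perm_B[OF \<sigma>] by blast
    have "perm_rat_fun \<sigma> (W (t, b)) = (\<Sum>i\<in>I. \<theta> (g i) ^ t * \<phi> (g i) b)"
      using g(2) b b0 by (simp add: W_def c_sum c_mult c_power \<theta>_def)
    also have "\<dots> = W (t, b)"
      using sum.permute[OF G[OF g(1)], of "\<lambda>i. \<theta> i ^ t * \<phi> i b"] by (simp add: W_def o_def I_def)
    finally show ?thesis .
  qed
  have perm_\<psi>: "perm_rat_fun \<sigma> (\<psi> v) = \<psi> (perm_rat_fun g v)"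
    if \<sigma>: "\<sigma> \<in> P" and g: "g \<in> G" "\<forall>i\<in>I. perm_rat_fun \<sigma> (\<theta> i) = \<theta> (g i)"
      and v: "v \<in> gen_field (k \<union> rat_var ` {1..m})" for \<sigma> g v
  proof (rule field_homs_agree[OF _ _ _ v])
    show "field_hom (\<lambda>v. perm_rat_fun \<sigma> (\<psi> v))"
      by (rule field_hom_compose[OF field_hom_perm_rat_fun[OF bij_P[OF \<sigma>]] \<psi>(1)])
    show "field_hom (\<lambda>v. \<psi> (perm_rat_fun g v))"
      by (rule field_hom_compose[OF \<psi>(1) field_hom_perm_rat_fun[OF permutes_bij[OF G[OF g(1)]]]])
    fix a assume "a \<in> k \<union> rat_var ` {1..m}"
    then show "perm_rat_fun \<sigma> (\<psi> a) = \<psi> (perm_rat_fun g a)"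
    proof
      assume "a \<in> rat_var ` {1..m}"
      then obtain i where "i \<in> I" "a = rat_var i" by (auto simp: I_def)
      then show ?thesis
        using g(2) g_I[OF g(1)]
        by (simp add: perm_rat_fun_hom(2)[OF permutes_bij[OF G[OF g(1)]]] \<psi>_var)
    qed (auto simp: \<psi>(2) perm_const[OF \<sigma>] perm_rat_fun_hom(1)[OF permutes_bij[OF G[OF g(1)]]])
  qed

  define \<Gamma> where "\<Gamma> = (perm_rat_fun ` P :: ('k rat_fun \<Rightarrow> 'k rat_fun) set)"
  have P': "\<forall>\<sigma>\<in>P. bij \<sigma>" "\<forall>\<sigma>\<in>P. \<forall>\<tau>\<in>P. \<sigma> \<circ> \<tau> \<in> P"
    using bij_P P_comp by blast+
  note \<Gamma>_hom = perm_rat_fun_image_monoid(1)[OF \<Gamma>_def P'(1) P_id P'(2)]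
    and \<Gamma>_const = perm_rat_fun_image_monoid(2)[OF \<Gamma>_def P'(1) P_id P'(2)]
    and \<Gamma>_id = perm_rat_fun_image_monoid(3)[OF \<Gamma>_def P'(1) P_id P'(2)]
    and \<Gamma>_comp = perm_rat_fun_image_monoid(4)[OF \<Gamma>_def P'(1) P_id P'(2)]
  have \<Gamma>_fin: "finite \<Gamma>" unfolding \<Gamma>_def using finite_P by simp
  have \<Gamma>_L: "\<gamma> ` L \<subseteq> L" if \<gamma>: "\<gamma> \<in> \<Gamma>" for \<gamma>
  proof -
    interpret field_hom \<gamma> by (rule \<Gamma>_hom[OF \<gamma>])
    obtain \<sigma> where \<sigma>: "\<sigma> \<in> P" "\<gamma> = perm_rat_fun \<sigma>" using \<gamma> by (auto simp: \<Gamma>_def)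
    obtain g where g: "g \<in> G" "\<forall>i\<in>I. \<forall>b\<in>B. perm_rat_fun \<sigma> (\<phi> i b) = \<phi> (g i) b"
      using perm_B[OF \<sigma>(1)] by blast
    have "\<gamma> ` (k \<union> \<theta> ` I) \<subseteq> k \<union> \<theta> ` I"
      using g(2) g_I[OF g(1)] b0 by (auto simp: \<sigma> perm_const[OF \<sigma>(1)] \<theta>_def)
    then show ?thesis unfolding L_def image_gen_field by (rule gen_field_mono)
  qed
  have \<Gamma>_V: "\<gamma> (W p) = W p" if \<gamma>: "\<gamma> \<in> \<Gamma>" and p: "p \<in> ?V" for \<gamma> p
    using \<gamma> p perm_W by (auto simp: \<Gamma>_def B'_def)

  define Bf where "Bf = \<psi> ` BG \<union> W ` ?V"
  \<comment> \<open>\<open>indep_Un\<close> is used here for sets of elements, since \<open>BG\<close> and the index set of \<open>W\<close> differ in type.\<close>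
  have W_indep': "indep L (W ` ?V) (\<lambda>b. b)"
    by (rule indep_image[OF L W_indep])
  have "indep k Bf (\<lambda>b. b)"
    unfolding Bf_def
  proof (rule indep_Un[OF is_subfield_rat_consts L kL _ _ W_indep'])
    have "indep k BG \<psi>"
      by (rule field_hom_indep[OF \<psi>(1) _ BG(2)]) (auto simp: \<psi>(2))
    then show "indep k (\<psi> ` BG) (\<lambda>b. b)"
      by (rule indep_image[OF is_subfield_rat_consts])
    show "(\<lambda>b. b) ` \<psi> ` BG \<subseteq> L" using \<psi>BG_L by simp
    show "\<psi> ` BG \<inter> W ` ?V = {}"
      using \<psi>BG_L indep_not_in_base[OF L W_indep'] by blast
  qed
  moreover have "finite Bf"
    unfolding Bf_def B'_def using BG(1) B(3) by simp
  moreover have "fixed_field (m * n) P = gen_field (k \<union> Bf)"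
  proof
    show "gen_field (k \<union> Bf) \<subseteq> fixed_field (m * n) P"
    proof (rule gen_field_least[OF is_subfield_fixed_field[OF bij_P]])
      have sub: "is_subfield (rat_fun_field (m * n) :: 'k rat_fun set)"
        by (simp add: rat_fun_field_def field_adjoin_def is_subfield_gen_field)
      have k_in: "k \<subseteq> rat_fun_field (m * n)"
        using gen_field_incl[of "k \<union> rat_var ` {1..m * n}"]
        by (simp add: rat_fun_field_def field_adjoin_def)
      have "\<theta> i \<in> rat_fun_field (m * n)" if "i \<in> I" for i
        using that block_basis_in_rat_fun_field[OF _ b0] unfolding \<theta>_def I_def by blast
      then have L_in: "L \<subseteq> rat_fun_field (m * n)"
        unfolding L_def using k_in by (intro gen_field_least[OF sub]) auto
      have "a \<in> fixed_field (m * n) P" if "a \<in> k" for a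
        using that k_in perm_const by (auto simp: fixed_field_def)
      moreover have "\<psi> b \<in> fixed_field (m * n) P" if b: "b \<in> BG" for b
      proof -
        have "perm_rat_fun \<sigma> (\<psi> b) = \<psi> b" if \<sigma>: "\<sigma> \<in> P" for \<sigma>
        proof -
          obtain g where g: "g \<in> G" "\<forall>i\<in>I. \<forall>b\<in>B. perm_rat_fun \<sigma> (\<phi> i b) = \<phi> (g i) b"
            using perm_B[OF \<sigma>] by blast
          have "perm_rat_fun \<sigma> (\<psi> b) = \<psi> (perm_rat_fun g b)"
            by (rule perm_\<psi>[OF \<sigma> g(1)]) (use g(2) b0 b BG_in in \<open>auto simp: \<theta>_def\<close>)
          also have "perm_rat_fun g b = b" using BG_fixed b g(1) by (auto simp: fixed_field_def)
          finally show ?thesis .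
        qed
        moreover have "\<psi> b \<in> rat_fun_field (m * n)" using \<psi>BG_L L_in b by blast
        ultimately show ?thesis by (simp add: fixed_field_def)
      qed
      moreover have "W (t, b) \<in> fixed_field (m * n) P" if b: "b \<in> B'" for t b
      proof -
        have "b \<in> B" using b by (simp add: B'_def)
        have "W (t, b) \<in> rat_fun_field (m * n)"
          unfolding W_def prod.case
        proof (intro is_subfield_sum[OF sub] is_subfieldD(4)[OF sub] is_subfield_power[OF sub])
          show "\<theta> i \<in> rat_fun_field (m * n)" if "i \<in> I" for i using that \<theta>L L_in by blast
          show "\<phi> i b \<in> rat_fun_field (m * n)" if "i \<in> I" for i
            using that block_basis_in_rat_fun_field[OF _ \<open>b \<in> B\<close>] unfolding I_def by blast
        qed
        then show ?thesis using perm_W[OF _ \<open>b \<in> B\<close>] by (simp add: fixed_field_def)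
      qed
      ultimately show "k \<union> Bf \<subseteq> fixed_field (m * n) P"
        unfolding Bf_def by auto
    qed
    show "fixed_field (m * n) P \<subseteq> gen_field (k \<union> Bf)"
    proof
      fix f :: "'k rat_fun" assume f: "f \<in> fixed_field (m * n) P"
      have f_fixed: "\<gamma> f = f" if "\<gamma> \<in> \<Gamma>" for \<gamma>
        using that f by (auto simp: \<Gamma>_def fixed_field_def)
      have "f \<in> gen_field (k \<union> copy ` Sigma {1..m} (block_gens I))"
        using f by (intro fixed_in_blocks) (auto simp: fixed_field_def I_def)
      moreover have "k \<union> copy ` Sigma {1..m} (block_gens I) \<subseteq> gen_field (L \<union> W ` ?V)"
      proof -
        have L_in: "L \<subseteq> gen_field (L \<union> W ` ?V)" and W_in: "W ` ?V \<subseteq> gen_field (L \<union> W ` ?V)"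
          using gen_field_incl[of "L \<union> W ` ?V"] by auto
        have "\<phi> i b \<in> gen_field (L \<union> W ` ?V)" if i: "i \<in> I" and b: "b \<in> B" for i b
        proof (cases "b = b0")
          case True
          then show ?thesis using \<theta>L L_in i by (auto simp: \<theta>_def)
        next
          case False
          then have "b \<in> B'" using b by (simp add: B'_def)
          then show ?thesis
            unfolding copy_W[OF i] using C(1)[OF i] L_in W_in
            by (intro is_subfield_sum[OF is_subfield_gen_field] is_subfieldD(4)[OF is_subfield_gen_field])
               auto
        qed
        then show ?thesis using kL L_in by (auto simp: block_gens_def I_def)
      qed
      ultimately have f_V: "f \<in> gen_field (L \<union> W ` ?V)"
        using gen_field_subset by blast
      have "f \<in> gen_field ({a \<in> L. \<forall>\<gamma>\<in>\<Gamma>. \<gamma> a = a} \<union> W ` ?V)"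
        by (rule fixed_field_of_adjoined_invariants[OF L W_indep \<Gamma>_fin \<Gamma>_id];
            fact \<Gamma>_comp \<Gamma>_hom \<Gamma>_L \<Gamma>_V f_V f_fixed)
      moreover have "{a \<in> L. \<forall>\<gamma>\<in>\<Gamma>. \<gamma> a = a} \<subseteq> gen_field (k \<union> \<psi> ` BG)"
      proof
        fix u assume u: "u \<in> {a \<in> L. \<forall>\<gamma>\<in>\<Gamma>. \<gamma> a = a}"
        show "u \<in> gen_field (k \<union> \<psi> ` BG)"
        proof (rule fixed_elements_transfer[OF \<psi>(1,2) BG(3), where \<Gamma> = \<Gamma>])
          show "bij g" if "g \<in> G" for g using permutes_bij[OF G[OF that]] .
          show "\<exists>\<gamma>\<in>\<Gamma>. \<forall>i\<in>{1..m}. \<gamma> (\<psi> (rat_var i)) = \<psi> (rat_var (g i))" if g: "g \<in> G" for g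
          proof -
            obtain \<sigma> where \<sigma>: "\<sigma> \<in> P" "\<forall>i\<in>{1..m}. \<forall>j\<in>{1..n}. \<sigma> (e (j, i)) = e (j, g i)"
              using P_G[OF g] by blast
            have "perm_rat_fun \<sigma> (\<psi> (rat_var i)) = \<psi> (rat_var (g i))" if i: "i \<in> I" for i
            proof -
              have "perm_rat_fun \<sigma> (\<phi> i b0) = \<phi> (g i) (perm_rat_fun id b0)"
                by (rule perm_\<phi>[OF \<sigma>(1)])
                   (use i g_I[OF g i] \<sigma>(2) b0 B_in in \<open>auto simp: I_def permutes_id\<close>)
              then show ?thesis
                using i g_I[OF g i] by (simp add: \<psi>_var \<theta>_def perm_rat_fun_id)
            qed
            then show ?thesis using \<sigma>(1) unfolding \<Gamma>_def I_def by blast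
          qed
          show "u \<in> gen_field (k \<union> \<psi> ` rat_var ` {1..m})"
            using u unfolding \<psi>_vars L_def by simp
        qed (use u \<Gamma>_hom \<Gamma>_const in auto)
      qed
      ultimately have "f \<in> gen_field (gen_field (k \<union> \<psi> ` BG) \<union> W ` ?V)"
        using gen_field_mono[of "{a \<in> L. \<forall>\<gamma>\<in>\<Gamma>. \<gamma> a = a} \<union> W ` ?V" "gen_field (k \<union> \<psi> ` BG) \<union> W ` ?V"]
        by blast
      then show "f \<in> gen_field (k \<union> Bf)"
        unfolding gen_field_Un_gen_field Bf_def by (simp add: Un_assoc)
    qed
  qed
  ultimately show ?thesis by (intro rational_extI[OF field_hom_rat_const])
qed

end

text \<open>
  It remains to construct the \<open>\<phi> i\<close>. The variables beyond \<open>n\<close> are sent to variables outside all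
  blocks, so that the substitution is injective on variables.
\<close>

theorem (in wreath_permutations) rational_wreath:
  assumes "rational_ext (rat_const :: 'k::field \<Rightarrow> 'k rat_fun) (fixed_field m G)"
    and "rational_ext (rat_const :: 'k \<Rightarrow> 'k rat_fun) (fixed_field n H)"
  shows "rational_ext (rat_const :: 'k \<Rightarrow> 'k rat_fun) (fixed_field (m * n) P)"
proof -
  obtain BG :: "'k rat_fun set" where BG: "finite BG" "indep rat_consts BG (\<lambda>b. b)"
      "fixed_field m G = gen_field (rat_consts \<union> BG)"
    by (rule rational_ext_finite_basis[OF field_hom_rat_const assms(1)])
  obtain BH :: "'k rat_fun set" where BH: "finite BH" "indep rat_consts BH (\<lambda>b. b)"
      "fixed_field n H = gen_field (rat_consts \<union> BH)"
    by (rule rational_ext_finite_basis[OF field_hom_rat_const assms(2)])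
  have "\<exists>\<phi> :: 'k rat_fun \<Rightarrow> 'k rat_fun. field_hom \<phi> \<and> (\<forall>a. \<phi> (rat_const a) = rat_const a) \<and>
      (i = 0 \<longrightarrow> \<phi> = (\<lambda>f. f)) \<and>
      (i \<in> {1..m} \<longrightarrow> (\<forall>j\<in>{1..n}. \<phi> (rat_var j) = rat_var (e (j, i))))" for i
  proof (cases "i \<in> {1..m}")
    case True
    define \<epsilon> where "\<epsilon> j = (if j \<in> {1..n} then e (j, i) else m * n + 1 + j)" for j
    have "inj \<epsilon>"
    proof (rule injI)
      fix j j' assume *: "\<epsilon> j = \<epsilon> j'"
      show "j = j'"
        using * e_eq_iff[OF True _ True, of j j'] e_in[OF True, of j] e_in[OF True, of j']
        by (simp add: \<epsilon>_def split: if_splits)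
    qed
    then have "indep (rat_consts :: 'k rat_fun set) UNIV (\<lambda>j. rat_var (\<epsilon> j))"
      by (intro indep_reindex[OF is_subfield_rat_consts indep_rat_var, of \<epsilon>]) auto
    then obtain \<phi> :: "'k rat_fun \<Rightarrow> 'k rat_fun" where "field_hom \<phi>"
        "\<And>a. \<phi> (rat_const a) = rat_const a" "\<And>j. \<phi> (rat_var j) = rat_var (\<epsilon> j)"
      by (rule substitution_hom[OF field_hom_rat_const]) blast
    then show ?thesis using True by (intro exI[of _ \<phi>]) (auto simp: \<epsilon>_def)
  next
    case False
    then show ?thesis by (intro exI[of _ "\<lambda>f. f"]) (auto simp: field_hom_id)
  qed
  then obtain \<phi> :: "nat \<Rightarrow> 'k rat_fun \<Rightarrow> 'k rat_fun" where \<phi>: "\<And>i. field_hom (\<phi> i)"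
      "\<And>i a. \<phi> i (rat_const a) = rat_const a" "\<And>f. \<phi> 0 f = f"
      "\<And>i j. i \<in> {1..m} \<Longrightarrow> j \<in> {1..n} \<Longrightarrow> \<phi> i (rat_var j) = rat_var (e (j, i))"
    by metis
  interpret wreath_block_maps m n G H e P \<phi> BH
    by (intro wreath_block_maps.intro wreath_block_maps_axioms.intro wreath_permutations_axioms)
       (fact \<phi> BH)+
  show ?thesis by (rule rational_fixed_field[OF BG])
qed

theorem theorem1p3:
  fixes m n :: nat and G H :: "(nat \<Rightarrow> nat) set" and e :: "nat \<times> nat \<Rightarrow> nat"
  assumes "1 \<le> m" and "1 \<le> n"
    and "subgroup G (sym_group m)" and "subgroup H (sym_group n)"
    and "bij_betw e ({1..n} \<times> {1..m}) {1..m * n}"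
  shows "group (perm_wreath n m H G) \<and>
    faithful_action (perm_wreath n m H G) ({1..n} \<times> {1..m}) (wreath_action n m) \<and>
    wreath_perm e n m \<in> mon (perm_wreath n m H G) (sym_group (m * n)) \<and>
    subgroup (wreath_perm e n m ` carrier (perm_wreath n m H G)) (sym_group (m * n)) \<and>
    (rational_ext (rat_const :: 'k::field \<Rightarrow> 'k rat_fun) (fixed_field m G) \<and>
     rational_ext (rat_const :: 'k \<Rightarrow> 'k rat_fun) (fixed_field n H) \<longrightarrow>
     rational_ext (rat_const :: 'k \<Rightarrow> 'k rat_fun)
       (fixed_field (m * n) (wreath_perm e n m ` carrier (perm_wreath n m H G))))"
proof -
  interpret N: permutation_groups_numbered m n G H e
    by (intro permutation_groups_numbered.intro permutation_groups.intro
          permutation_groups_numbered_axioms.intro) (fact assms)+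
  interpret wreath_permutations m n G H e N.P
  proof
    show "id \<in> N.P"
      using subgroup.one_closed[OF N.subgroup_P] by (simp add: sym_group_def)
    show "\<sigma> \<circ> \<tau> \<in> N.P" if "\<sigma> \<in> N.P" "\<tau> \<in> N.P" for \<sigma> \<tau>
      using subgroup.m_closed[OF N.subgroup_P that] by (simp add: sym_group_def)
    show "\<sigma> permutes {1..m * n}" if "\<sigma> \<in> N.P" for \<sigma>
      using that N.wreath_perm_permutes by blast
    show "\<exists>\<sigma>\<in>N.P. \<forall>i\<in>{1..m}. \<forall>j\<in>{1..n}. \<sigma> (e (j, i)) = e (j, g i)" if "g \<in> G" for g
      using N.P_contains[OF that N.H_id] by (simp only: id_apply)
    show "\<exists>\<sigma>\<in>N.P. \<forall>i\<in>{1..m}. \<forall>j\<in>{1..n}. \<sigma> (e (j, i)) = e (if i = i0 then h j else j, i)"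
      if "h \<in> H" for h i0
      using N.P_contains[OF N.G_id, of "\<lambda>i. if i = i0 then h else id"] that N.H_id
      by (simp add: if_distrib[of "\<lambda>f. f _"] cong: if_cong)
  qed (fact assms N.G_permutes N.H_permutes N.P_form)+
  show ?thesis
    using N.group_W N.faithful_wreath_action N.wreath_perm_mon N.subgroup_P rational_wreath by blast
qed

end
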